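(* Let $M$ be either $B_n^+$ or $B_n^{+*}$ ($n\ge2$). For each $k\ge0$ let $\mu_{n,k}$ be the uniform probability distribution on the finite set $M(k)=\{x\in M:|x|=k\}$, viewed as a probability measure on $\overline M$. Then $(\mu_{n,k})_{k\ge0}$ converges weakly, as $k\to\infty$, to the uniform measure at infinity $\nu_{q_n}$.
   Context: $M$ is either (a) the positive braid monoid $B_n^+$, generated by $\Sigma=\{\sigma_1,\dots,\sigma_{n-1}\}$ with relations $\sigma_i\sigma_j=\sigma_j\sigma_i$ for $|i-j|\ge2$, $\sigma_i\sigma_j\sigma_i=\sigma_j\sigma_i\sigma_j$ for $|i-j|=1$; or (b) the dual braid monoid $B_n^{+*}$, generated by $\Sigma=\{\sigma_{i,j}:1\le i<j\le n\}$ ($\sigma_{j,i}=\sigma_{i,j}$) with relations $\sigma_{i,j}\sigma_{j,k}=\sigma_{j,k}\sigma_{k,i}=\sigma_{k,i}\sigma_{i,j}$ for $i<j<k$ and $\sigma_{i,j}\sigma_{k,\ell}=\sigma_{k,\ell}\sigma_{i,j}$ whenever $i<j<k<\ell$ or $i<k<\ell<j$. Unit $\mathbf e$; $|x|$ word length; $x\le_l y$ iff $y=xz$. $M$ is a Garside monoid; $\Delta$ is the least upper bound of $\Sigma$ for $\le_l$, $\mathcal S_n$ the set of left divisors of $\Delta$. For $x\in\mathcal S_n$, $\mathsf R(x)=\{\sigma\in\Sigma:x\sigma\notin\mathcal S_n\}$, $\mathsf L(x)=\{\sigma\in\Sigma:\sigma\le_l x\}$, $x\to y$ iff $\mathsf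 L(y)\subseteq\mathsf R(x)$. Every $x\neq\mathbf e$ has a unique Garside normal form $(x_1,\dots,x_k)$ (non-unit simple braids, $x=x_1\cdots x_k$, $x_i\to x_{i+1}$); the normal form of $\mathbf e$ is $(\mathbf e)$. $q_n$ is the radius of convergence of $G_n(t)=\sum_{x\in M}t^{|x|}$. $\overline M$ is the compact space of sequences $(\xi_k)_{k\ge1}$ in $\mathcal S_n$ with $\xi_k\to\xi_{k+1}$ for all $k$, with product topology ($\mathcal S_n$ discrete); $M$ is identified with sequences eventually equal to $\mathbf e$ via $x\mapsto$ its normal form followed by infinitely many $\mathbf e$; $\partial M=\overline M\setminus M$. $\Uparrow x$ is the closure of $\{xz:z\in M\}$ in $\overline M$ and $\uparrow x=\Uparrow x\cap\partial M$. The uniform measure at infinity $\nu_{q_n}$ is the unique probability measure on $\overline M$ with $\nu_{q_n}(\uparrow x)=q_n^{|x|}$ for all $x\in M$ (it is supported by $\partial M$). *)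

theory Defs
  imports "HOL-Probability.Probability"
begin

definition rstep :: "('g list \<times> 'g list) set \<Rightarrow> ('g list \<times> 'g list) set" where
  "rstep R = {(u @ l @ v, u @ r @ v) | u l r v. (l, r) \<in> R}"

definition wcong :: "('g list \<times> 'g list) set \<Rightarrow> ('g list \<times> 'g list) set" where
  "wcong R = (rstep R \<union> (rstep R)\<inverse>)\<^sup>*"

definition cls :: "('g list \<times> 'g list) set \<Rightarrow> 'g list \<Rightarrow> 'g list set" where
  "cls R w = wcong R `` {w}"

definition Mon :: "'g set \<Rightarrow> ('g list \<times> 'g list) set \<Rightarrow> 'g list set set" where
  "Mon G R = cls R ` lists G"

definition rep :: "'g list set \<Rightarrow> 'g list" where
  "rep x = (SOME w. w \<in> x)"

definition mmult :: "('g list \<times> 'g list) set \<Rightarrow> 'g list set \<Rightarrow> 'g list set \<Rightarrow> 'g list set" where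
  "mmult R x y = cls R (rep x @ rep y)"

definition munit :: "('g list \<times> 'g list) set \<Rightarrow> 'g list set" where
  "munit R = cls R []"

text \<open>Word length |x| (the relations considered are homogeneous).\<close>
definition mlen :: "'g list set \<Rightarrow> nat" where
  "mlen x = length (rep x)"

definition gen :: "('g list \<times> 'g list) set \<Rightarrow> 'g \<Rightarrow> 'g list set" where
  "gen R s = cls R [s]"

definition ldiv :: "'g set \<Rightarrow> ('g list \<times> 'g list) set \<Rightarrow> 'g list set \<Rightarrow> 'g list set \<Rightarrow> bool" where
  "ldiv G R x y \<longleftrightarrow> (\<exists>z \<in> Mon G R. y = mmult R x z)"

definition Delta :: "'g set \<Rightarrow> ('g list \<times> 'g list) set \<Rightarrow> 'g list set" where
  "Delta G R = (THE d. d \<in> Mon G R \<and> (\<forall>s\<in>G. ldiv G R (gen R s) d) \<and>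
       (\<forall>y\<in>Mon G R. (\<forall>s\<in>G. ldiv G R (gen R s) y) \<longrightarrow> ldiv G R d y))"

definition Simples :: "'g set \<Rightarrow> ('g list \<times> 'g list) set \<Rightarrow> 'g list set set" where
  "Simples G R = {x \<in> Mon G R. ldiv G R x (Delta G R)}"

definition Rset :: "'g set \<Rightarrow> ('g list \<times> 'g list) set \<Rightarrow> 'g list set \<Rightarrow> 'g set" where
  "Rset G R x = {s \<in> G. mmult R x (gen R s) \<notin> Simples G R}"

definition Lset :: "'g set \<Rightarrow> ('g list \<times> 'g list) set \<Rightarrow> 'g list set \<Rightarrow> 'g set" where
  "Lset G R x = {s \<in> G. ldiv G R (gen R s) x}"

definition arrow :: "'g set \<Rightarrow> ('g list \<times> 'g list) set \<Rightarrow> 'g list set \<Rightarrow> 'g list set \<Rightarrow> bool" where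
  "arrow G R x y \<longleftrightarrow> Lset G R y \<subseteq> Rset G R x"

definition is_nf :: "'g set \<Rightarrow> ('g list \<times> 'g list) set \<Rightarrow> 'g list set \<Rightarrow> 'g list set list \<Rightarrow> bool" where
  "is_nf G R x xs \<longleftrightarrow> xs \<noteq> [] \<and> set xs \<subseteq> Simples G R \<and> munit R \<notin> set xs \<and>
     foldr (mmult R) xs (munit R) = x \<and>
     (\<forall>i. Suc i < length xs \<longrightarrow> arrow G R (xs ! i) (xs ! Suc i))"

definition nf :: "'g set \<Rightarrow> ('g list \<times> 'g list) set \<Rightarrow> 'g list set \<Rightarrow> 'g list set list" where
  "nf G R x = (if x = munit R then [munit R] else (THE xs. is_nf G R x xs))"

definition Mbar :: "'g set \<Rightarrow> ('g list \<times> 'g list) set \<Rightarrow> (nat \<Rightarrow> 'g list set) set" where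
  "Mbar G R = {\<xi>. (\<forall>k. \<xi> k \<in> Simples G R) \<and> (\<forall>k. arrow G R (\<xi> k) (\<xi> (Suc k)))}"

text \<open>Indices start at 0 (the paper's \<open>\<xi>_1\<close> is \<open>\<xi> 0\<close>).\<close>
definition Mbar_top :: "'g set \<Rightarrow> ('g list \<times> 'g list) set \<Rightarrow> (nat \<Rightarrow> 'g list set) topology" where
  "Mbar_top G R = subtopology (product_topology (\<lambda>_. discrete_topology (Simples G R)) UNIV) (Mbar G R)"

definition Mbar_meas :: "'g set \<Rightarrow> ('g list \<times> 'g list) set \<Rightarrow> (nat \<Rightarrow> 'g list set) measure" where
  "Mbar_meas G R = sigma (topspace (Mbar_top G R)) {U. openin (Mbar_top G R) U}"

definition emb :: "'g set \<Rightarrow> ('g list \<times> 'g list) set \<Rightarrow> 'g list set \<Rightarrow> nat \<Rightarrow> 'g list set" where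
  "emb G R x = (\<lambda>k. if k < length (nf G R x) then nf G R x ! k else munit R)"

definition boundary :: "'g set \<Rightarrow> ('g list \<times> 'g list) set \<Rightarrow> (nat \<Rightarrow> 'g list set) set" where
  "boundary G R = Mbar G R - emb G R ` Mon G R"

definition UUp :: "'g set \<Rightarrow> ('g list \<times> 'g list) set \<Rightarrow> 'g list set \<Rightarrow> (nat \<Rightarrow> 'g list set) set" where
  "UUp G R x = Mbar_top G R closure_of (emb G R ` {mmult R x z | z. z \<in> Mon G R})"

definition Up :: "'g set \<Rightarrow> ('g list \<times> 'g list) set \<Rightarrow> 'g list set \<Rightarrow> (nat \<Rightarrow> 'g list set) set" where
  "Up G R x = UUp G R x \<inter> boundary G R"

definition Msphere :: "'g set \<Rightarrow> ('g list \<times> 'g list) set \<Rightarrow> nat \<Rightarrow> 'g list set set" where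
  "Msphere G R k = {x \<in> Mon G R. mlen x = k}"

definition qrad :: "'g set \<Rightarrow> ('g list \<times> 'g list) set \<Rightarrow> real" where
  "qrad G R = real_of_ereal (conv_radius (\<lambda>k. real (card (Msphere G R k))))"

definition mu :: "'g set \<Rightarrow> ('g list \<times> 'g list) set \<Rightarrow> nat \<Rightarrow> (nat \<Rightarrow> 'g list set) measure" where
  "mu G R k = distr (uniform_count_measure (Msphere G R k)) (Mbar_meas G R) (emb G R)"

definition is_unif_inf :: "'g set \<Rightarrow> ('g list \<times> 'g list) set \<Rightarrow> (nat \<Rightarrow> 'g list set) measure \<Rightarrow> bool" where
  "is_unif_inf G R \<nu> \<longleftrightarrow> prob_space \<nu> \<and> sets \<nu> = sets (Mbar_meas G R) \<and>
     (\<forall>x \<in> Mon G R. measure \<nu> (Up G R x) = qrad G R ^ mlen x)"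

definition weak_conv_top :: "'a topology \<Rightarrow> (nat \<Rightarrow> 'a measure) \<Rightarrow> 'a measure \<Rightarrow> bool" where
  "weak_conv_top X \<mu>s \<nu> \<longleftrightarrow>
     (\<forall>f. continuous_map X euclideanreal f \<and> bounded (f ` topspace X) \<longrightarrow>
        (\<lambda>k. integral\<^sup>L (\<mu>s k) f) \<longlonglongrightarrow> integral\<^sup>L \<nu> f)"

text \<open>Artin (classical) positive braid monoid: generators \<open>\<sigma>_i\<close> encoded as i, 1 \<le> i \<le> n-1.\<close>
definition artin_gens :: "nat \<Rightarrow> nat set" where
  "artin_gens n = {1..n - 1}"

definition artin_rels :: "nat \<Rightarrow> (nat list \<times> nat list) set" where
  "artin_rels n =
     {([i, j], [j, i]) | i j. i \<in> artin_gens n \<and> j \<in> artin_gens n \<and> (i + 2 \<le> j \<or> j + 2 \<le> i)} \<union>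
     {([i, j, i], [j, i, j]) | i j. i \<in> artin_gens n \<and> j \<in> artin_gens n \<and> (j = i + 1 \<or> i = j + 1)}"

text \<open>Dual braid monoid: generator \<open>\<sigma>_{i,j}\<close> (i<j) encoded as (i,j); \<open>\<sigma>_{j,i} = \<sigma>_{i,j}\<close>.\<close>
definition sg :: "nat \<Rightarrow> nat \<Rightarrow> nat \<times> nat" where
  "sg i j = (min i j, max i j)"

definition dual_gens :: "nat \<Rightarrow> (nat \<times> nat) set" where
  "dual_gens n = {(i, j). 1 \<le> i \<and> i < j \<and> j \<le> n}"

definition dual_rels :: "nat \<Rightarrow> ((nat \<times> nat) list \<times> (nat \<times> nat) list) set" where
  "dual_rels n =
     {([sg i j, sg j k], [sg j k, sg k i]) | i j k. 1 \<le> i \<and> i < j \<and> j < k \<and> k \<le> n} \<union>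
     {([sg j k, sg k i], [sg k i, sg i j]) | i j k. 1 \<le> i \<and> i < j \<and> j < k \<and> k \<le> n} \<union>
     {([sg i j, sg k l], [sg k l, sg i j]) | i j k l. 1 \<le> i \<and> i < j \<and> j < k \<and> k < l \<and> l \<le> n} \<union>
     {([sg i j, sg k l], [sg k l, sg i j]) | i j k l. 1 \<le> i \<and> i < k \<and> k < l \<and> l < j \<and> j \<le> n}"

end

theory Submission
  imports Defs
begin

text \<open>
  Both presentations are complemented, and the cube condition on triples of generators makes word
  reversing complete; hence the monoids are left cancellative with least common multiples, and
  Garside normal forms exist. The number of multiples of \<open>x\<close> of length \<open>k\<close> is the number
  \<open>\<lambda>\<close> of elements of length \<open>k - |x|\<close>, so everything reduces to the convergence of
  \<open>\<lambda>(k - 1) / \<lambda>(k)\<close>: triangular inversion over the divisors of \<open>\<Delta>\<^sup>m\<close> then yields the limits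
  of the measures of cylinders, and the clopen sets of the compact space carry both the construction
  of the limit measure and the weak convergence.

  For the ratio, let \<open>h\<close> be the limit at the radius of convergence \<open>q\<close> of the proportion of elements
  whose first normal form factor is a given simple element. It is harmonic for the normal form automaton,
  and conjugating by \<open>h\<close> turns the recursion for the numbers of elements with given first factor into
  an averaging with delays, which contracts because of a loop at a generator. Positivity of \<open>h\<close> amounts
  to the growth series of a parabolic submonoid being finite at \<open>q\<close>; this is proved by enlarging the
  parabolic step by step, comparing the elements that no generator of the parabolic divides.
\<close>

subsection \<open>Presented monoids\<close>

text \<open>For n at least 3 the automaton is not strongly connected: every non-unit simple element
  leads to the chosen generator, but \<Delta> is entered only from itself. A priori the growth could
  be carried by states that are eventually left for good, with \<open>h\<close> zero at the
  generator; this is what positivity of \<open>h\<close> excludes. As an Abel limit of ratios of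
  growth series for \<open>t\<close> increasing to \<open>q\<close>, \<open>h\<close> exists before
  anything is known about the coefficients.

  The comparison of parabolics is one chain of inequalities. Let \<open>G_X\<close> be the growth
  series of the submonoid generated by \<open>X\<close>, and \<open>F_X\<close> that of the elements
  without divisor in \<open>X\<close>. Unique factorization gives \<open>G_X F_X = G_M\<close> if
  \<open>X\<close> is closed under complements; existence alone gives \<open>G_M <= G_Y F_Y\<close>
  for every \<open>Y\<close>. If multiplication by \<open>w\<close> takes the elements counted by
  \<open>F_Y\<close> to some counted by \<open>F_X\<close>, then
  \<open>G_X t^|w| F_Y <= G_Y F_Y\<close>; for \<open>t < q\<close> the factor \<open>F_Y\<close>
  cancels, and the bound on \<open>G_X\<close> survives the limit \<open>t = q\<close>. A step
  trades some generators for a single one commuting with the rest, which costs only a geometric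
  series, finite because \<open>q < 1\<close>.\<close>

lemma rstep_ctx: "(u, v) \<in> rstep R \<Longrightarrow> (a @ u @ b, a @ v @ b) \<in> rstep R"
proof -
  assume "(u, v) \<in> rstep R"
  then obtain c l r d where "u = c @ l @ d" "v = c @ r @ d" "(l, r) \<in> R"
    unfolding rstep_def by blast
  then have "a @ u @ b = (a @ c) @ l @ (d @ b)" "a @ v @ b = (a @ c) @ r @ (d @ b)" "(l, r) \<in> R"
    by auto
  then show ?thesis unfolding rstep_def by blast
qed

lemma wcong_refl [simp, intro]: "(u, u) \<in> wcong R"
  by (simp add: wcong_def)

lemma wcong_sym: "(u, v) \<in> wcong R \<Longrightarrow> (v, u) \<in> wcong R"
  unfolding wcong_def by (metis converse_Un converse_converse rtrancl_converseI sup_commute)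

lemma wcong_trans [trans]: "(u, v) \<in> wcong R \<Longrightarrow> (v, w) \<in> wcong R \<Longrightarrow> (u, w) \<in> wcong R"
  unfolding wcong_def by (rule rtrancl_trans)

lemma wcong_ctx: "(u, v) \<in> wcong R \<Longrightarrow> (a @ u @ b, a @ v @ b) \<in> wcong R"
  unfolding wcong_def
proof (induction rule: rtrancl_induct)
  case (step y z)
  then have "(a @ y @ b, a @ z @ b) \<in> rstep R \<union> (rstep R)\<inverse>"
    using rstep_ctx by blast
  with step show ?case by (meson rtrancl.simps)
qed simp

lemma wcong_append: "(u, v) \<in> wcong R \<Longrightarrow> (u', v') \<in> wcong R \<Longrightarrow> (u @ u', v @ v') \<in> wcong R"
  using wcong_trans[of "u @ u'" "v @ u'" R "v @ v'"] wcong_ctx[of u v R "[]" u'] wcong_ctx[of u' v' R v "[]"] by simp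

lemma wcong_appendL: "(u, v) \<in> wcong R \<Longrightarrow> (a @ u, a @ v) \<in> wcong R"
  using wcong_append by blast

lemma wcong_appendR: "(u, v) \<in> wcong R \<Longrightarrow> (u @ a, v @ a) \<in> wcong R"
  using wcong_append by blast

lemma wcong_Cons: "(u, v) \<in> wcong R \<Longrightarrow> (s # u, s # v) \<in> wcong R"
  using wcong_appendL[of u v R "[s]"] by simp

lemma wcong_rel: "(l, r) \<in> R \<Longrightarrow> (l, r) \<in> wcong R"
proof -
  assume "(l, r) \<in> R"
  then have "([] @ l @ [], [] @ r @ []) \<in> rstep R" unfolding rstep_def by blast
  then show ?thesis unfolding wcong_def by auto
qed

text \<open>All invariants below come from here: the length, the alphabet, the letters of a
  parabolic, the multiset of crossings.\<close>

lemma wcong_invariant: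
  assumes "\<And>a b l r. (l, r) \<in> R \<Longrightarrow> P (a @ l @ b) = P (a @ r @ b)" "(u, v) \<in> wcong R"
  shows "P u = P v"
  using assms(2) unfolding wcong_def
proof (induction rule: rtrancl_induct)
  case (step y z)
  then have "P y = P z" unfolding rstep_def using assms(1) by auto
  with step show ?case by simp
qed simp

lemma cls_eq_iff: "cls R u = cls R v \<longleftrightarrow> (u, v) \<in> wcong R"
proof
  assume "cls R u = cls R v"
  moreover have "v \<in> cls R v" by (simp add: cls_def)
  ultimately show "(u, v) \<in> wcong R" unfolding cls_def by blast
next
  assume "(u, v) \<in> wcong R"
  then show "cls R u = cls R v"
    unfolding cls_def by (auto intro: wcong_trans wcong_sym dest: wcong_trans[OF wcong_sym])
qed

lemma rep_cls: "(rep (cls R w), w) \<in> wcong R"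
proof -
  have "w \<in> cls R w" by (simp add: cls_def)
  then have "rep (cls R w) \<in> cls R w" unfolding rep_def by (rule someI)
  then show ?thesis by (simp add: cls_def wcong_sym)
qed

lemma mmult_cls: "mmult R (cls R u) (cls R v) = cls R (u @ v)"
  unfolding mmult_def cls_eq_iff by (intro wcong_append rep_cls)

locale graded_presentation =
  fixes G :: "'g set" and R :: "('g list \<times> 'g list) set"
  assumes finite_G: "finite G" and G_nonempty: "G \<noteq> {}"
    and rel_lists: "(l, r) \<in> R \<Longrightarrow> l \<in> lists G \<and> r \<in> lists G \<and> length l = length r"
begin

abbreviation equivalent (infix "\<doteq>" 50) where "u \<doteq> v \<equiv> (u, v) \<in> wcong R"
abbreviation M where "M \<equiv> Mon G R"
abbreviation mul (infixl "\<odot>" 70) where "x \<odot> y \<equiv> mmult R x y"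
abbreviation unit ("\<one>") where "\<one> \<equiv> munit R"
abbreviation le (infix "\<preceq>" 50) where "x \<preceq> y \<equiv> ldiv G R x y"

lemma equivalent_length: "u \<doteq> v \<Longrightarrow> length u = length v"
  by (erule wcong_invariant[rotated]) (use rel_lists in auto)

lemma equivalent_lists: "u \<doteq> v \<Longrightarrow> u \<in> lists G \<longleftrightarrow> v \<in> lists G"
  by (erule wcong_invariant[rotated, where P = "\<lambda>u. u \<in> lists G"]) (use rel_lists in fastforce)

lemma cls_in_M [intro]: "w \<in> lists G \<Longrightarrow> cls R w \<in> M"
  by (auto simp: Mon_def)

lemma M_cases [elim?]: assumes "x \<in> M" obtains w where "w \<in> lists G" "x = cls R w"
  using assms by (auto simp: Mon_def)

lemma unit_in_M [simp, intro]: "\<one> \<in> M"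
  by (auto simp: munit_def)

lemma gen_in_M [simp, intro]: "s \<in> G \<Longrightarrow> gen R s \<in> M"
  by (auto simp: gen_def)

lemma mul_in_M [simp, intro]: "x \<in> M \<Longrightarrow> y \<in> M \<Longrightarrow> x \<odot> y \<in> M"
  by (metis M_cases append_in_lists_conv cls_in_M mmult_cls)

lemma mul_assoc: "x \<in> M \<Longrightarrow> y \<in> M \<Longrightarrow> z \<in> M \<Longrightarrow> x \<odot> y \<odot> z = x \<odot> (y \<odot> z)"
  by (elim M_cases) (simp add: mmult_cls)

lemma unit_mul [simp]: "x \<in> M \<Longrightarrow> \<one> \<odot> x = x" "x \<in> M \<Longrightarrow> x \<odot> \<one> = x"
  unfolding munit_def by (metis M_cases append_Nil append_Nil2 mmult_cls)+

lemma mlen_cls: "mlen (cls R w) = length w"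
  unfolding mlen_def by (simp add: equivalent_length rep_cls)

lemma mlen_mul [simp]: "x \<in> M \<Longrightarrow> y \<in> M \<Longrightarrow> mlen (x \<odot> y) = mlen x + mlen y"
  by (metis M_cases length_append mlen_cls mmult_cls)

lemma mlen_unit [simp]: "mlen \<one> = 0"
  by (simp add: munit_def mlen_cls)

lemma mlen_gen [simp]: "mlen (gen R s) = 1"
  by (simp add: gen_def mlen_cls)

lemma mlen_0: "x \<in> M \<Longrightarrow> mlen x = 0 \<longleftrightarrow> x = \<one>"
  by (metis M_cases length_0_conv mlen_cls munit_def)

lemma cls_Cons: "cls R (s # w) = gen R s \<odot> cls R w"
  by (simp add: gen_def mmult_cls)

lemma M_Cons: assumes "x \<in> M" "x \<noteq> \<one>" obtains s y where "s \<in> G" "y \<in> M" "x = gen R s \<odot> y"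
proof -
  obtain w where w: "w \<in> lists G" "x = cls R w" using assms M_cases by blast
  then obtain s v where "w = s # v" using assms(2) by (cases w) (auto simp: munit_def)
  then show ?thesis using that[of s "cls R v"] w cls_Cons by auto
qed

lemma M_snoc: assumes "x \<in> M" "x \<noteq> \<one>" obtains s y where "s \<in> G" "y \<in> M" "x = y \<odot> gen R s"
proof -
  obtain w where w: "w \<in> lists G" "x = cls R w" using assms M_cases by blast
  then obtain s v where "w = v @ [s]" using assms(2) by (cases w rule: rev_cases) (auto simp: munit_def)
  then show ?thesis using that[of s "cls R v"] w by (auto simp: gen_def mmult_cls)
qed

lemma M_induct [consumes 1, case_names unit Cons]:
  assumes "x \<in> M" "P \<one>" "\<And>s y. s \<in> G \<Longrightarrow> y \<in> M \<Longrightarrow> P y \<Longrightarrow> P (gen R s \<odot> y)"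
  shows "P x"
proof -
  obtain w where w: "w \<in> lists G" "x = cls R w" using assms M_cases by blast
  from w(1) have "P (cls R w)"
    by (induction w) (use assms(2,3) in \<open>auto simp: munit_def cls_Cons\<close>)
  with w show ?thesis by simp
qed

lemma ldivI: "z \<in> M \<Longrightarrow> y = x \<odot> z \<Longrightarrow> x \<preceq> y"
  by (auto simp: ldiv_def)

lemma ldivE: assumes "x \<preceq> y" obtains z where "z \<in> M" "y = x \<odot> z"
  using assms by (auto simp: ldiv_def)

lemma dv_refl [simp]: "x \<in> M \<Longrightarrow> x \<preceq> x"
  by (rule ldivI[of \<one>]) auto

lemma unit_le [simp]: "x \<in> M \<Longrightarrow> \<one> \<preceq> x"
  by (rule ldivI[of x]) auto

lemma dv_trans: "x \<in> M \<Longrightarrow> x \<preceq> y \<Longrightarrow> y \<preceq> z \<Longrightarrow> x \<preceq> z"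
  unfolding ldiv_def using mul_assoc by force

lemma le_mulR [simp]: "x \<in> M \<Longrightarrow> y \<in> M \<Longrightarrow> x \<preceq> x \<odot> y"
  by (rule ldivI) auto

lemma le_mulL: "a \<in> M \<Longrightarrow> x \<in> M \<Longrightarrow> x \<preceq> y \<Longrightarrow> a \<odot> x \<preceq> a \<odot> y"
  unfolding ldiv_def using mul_assoc by force

lemma le_in_M: "x \<in> M \<Longrightarrow> x \<preceq> y \<Longrightarrow> y \<in> M"
  by (auto simp: ldiv_def)

lemma le_mlen: "x \<in> M \<Longrightarrow> x \<preceq> y \<Longrightarrow> mlen x \<le> mlen y"
  by (auto simp: ldiv_def)

lemma le_mlen_eq: "x \<in> M \<Longrightarrow> x \<preceq> y \<Longrightarrow> mlen x = mlen y \<Longrightarrow> x = y"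
  by (auto simp: ldiv_def mlen_0)

lemma dv_antisym: "x \<in> M \<Longrightarrow> x \<preceq> y \<Longrightarrow> y \<preceq> x \<Longrightarrow> x = y"
  by (rule le_mlen_eq) (simp_all add: le_mlen le_in_M order_antisym)

lemma le_unit: "x \<in> M \<Longrightarrow> x \<preceq> \<one> \<Longrightarrow> x = \<one>"
  by (rule dv_antisym) simp_all

lemma cls_le_iff: "u \<in> lists G \<Longrightarrow> cls R u \<preceq> cls R w \<longleftrightarrow> (\<exists>v\<in>lists G. u @ v \<doteq> w)"
  unfolding ldiv_def Mon_def by (auto simp: mmult_cls cls_eq_iff dest: wcong_sym)

lemma gen_le_gen: assumes "s \<in> G" "t \<in> G" "gen R s \<preceq> gen R t" shows "gen R s = gen R t"
  using assms by (intro le_mlen_eq) simp_all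

end

subsection \<open>Word reversing\<close>

text \<open>Word reversing: if it succeeds, \<open>rv C n u v\<close> is the pair of complements
  \<open>u\<^sup>-\<^sup>1(u \<or> v)\<close> and \<open>v\<^sup>-\<^sup>1(u \<or> v)\<close>; the argument \<open>n\<close> is fuel.\<close>

fun rv :: "('g \<Rightarrow> 'g \<Rightarrow> 'g list) \<Rightarrow> nat \<Rightarrow> 'g list \<Rightarrow> 'g list \<Rightarrow> ('g list \<times> 'g list) option" where
  "rv C n [] v = Some (v, [])"
| "rv C n (s # u) [] = Some ([], s # u)"
| "rv C 0 (s # u) (t # v) = None"
| "rv C (Suc n) (s # u) (t # v) =
     (case rv C n u (C s t) of None \<Rightarrow> None | Some (a, b) \<Rightarrow>
     (case rv C n v (C t s) of None \<Rightarrow> None | Some (c, d) \<Rightarrow>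
     (case rv C n b d of None \<Rightarrow> None | Some (e, f) \<Rightarrow> Some (a @ e, c @ f))))"

text \<open>The words \<open>p\<close>, \<open>p'\<close> lead to the lcm of \<open>r\<close>,
  \<open>s\<close>, \<open>t\<close> by way of \<open>s\<close> and by way of \<open>t\<close>. The
  test asks that this lcm be a multiple of the lcm of \<open>s\<close> and \<open>t\<close>, with
  the same quotient \<open>w\<close> on both sides. Equality in the monoid is tested by reversing to
  empty words, so that the condition can be evaluated.\<close>

definition cube :: "('g \<Rightarrow> 'g \<Rightarrow> 'g list) \<Rightarrow> nat \<Rightarrow> 'g \<Rightarrow> 'g \<Rightarrow> 'g \<Rightarrow> bool" where
  "cube C n r s t = (case rv C n (C r s) (C r t) of None \<Rightarrow> False | Some (p, p') \<Rightarrow>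
     (case rv C n (C s r @ p) (C s t) of None \<Rightarrow> False | Some (a, w) \<Rightarrow>
        a = [] \<and> rv C n (C t r @ p') (C t s @ w) = Some ([], [])))"

lemma cubeE:
  assumes "cube C n r s t"
  obtains p p' w where "rv C n (C r s) (C r t) = Some (p, p')"
    "rv C n (C s r @ p) (C s t) = Some ([], w)" "rv C n (C t r @ p') (C t s @ w) = Some ([], [])"
proof -
  from assms obtain p p' where 1: "rv C n (C r s) (C r t) = Some (p, p')"
    by (cases "rv C n (C r s) (C r t)") (auto simp: cube_def)
  with assms obtain a w where 2: "rv C n (C s r @ p) (C s t) = Some (a, w)"
    by (cases "rv C n (C s r @ p) (C s t)") (auto simp: cube_def)
  show ?thesis using that[of p p' w] assms 1 2 by (simp add: cube_def)
qed

text \<open>Reversing sees letters only through \<open>C\<close>, so it commutes with every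
  relabelling compatible with the complements. This reduces the cube condition for all n to finitely
  many evaluations.\<close>

lemma rv_map:
  assumes C: "\<And>s t. s \<in> A \<Longrightarrow> t \<in> A \<Longrightarrow> C' s t \<in> lists A \<and> C (\<phi> s) (\<phi> t) = map \<phi> (C' s t)"
    and "u \<in> lists A" "v \<in> lists A"
  shows "rv C n (map \<phi> u) (map \<phi> v) = map_option (map_prod (map \<phi>) (map \<phi>)) (rv C' n u v) \<and>
    (\<forall>a b. rv C' n u v = Some (a, b) \<longrightarrow> a \<in> lists A \<and> b \<in> lists A)"
  using assms(2,3)
proof (induction n arbitrary: u v)
  case 0
  then show ?case by (cases u; cases v) auto
next
  case (Suc n)
  show ?case
  proof (cases "u = [] \<or> v = []")
    case True
    then show ?thesis using Suc.prems by (cases u; cases v) auto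
  next
    case False
    then obtain s u0 t v0 where uv: "u = s # u0" "v = t # v0" by (meson list.exhaust)
    have st: "s \<in> A" "t \<in> A" "u0 \<in> lists A" "v0 \<in> lists A" using Suc.prems uv by auto
    have 1: "C' s t \<in> lists A" "C (\<phi> s) (\<phi> t) = map \<phi> (C' s t)"
      "C' t s \<in> lists A" "C (\<phi> t) (\<phi> s) = map \<phi> (C' t s)" using C st by auto
    note IH1 = Suc.IH[OF st(3) 1(1)] and IH2 = Suc.IH[OF st(4) 1(3)]
    show ?thesis
    proof (cases "rv C' n u0 (C' s t)")
      case None
      then show ?thesis using uv IH1 1 by simp
    next
      case (Some ab)
      then obtain a b where ab: "rv C' n u0 (C' s t) = Some (a, b)" by (cases ab) auto
      show ?thesis
      proof (cases "rv C' n v0 (C' t s)")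
        case None
        then show ?thesis using uv IH1 IH2 1 ab by simp
      next
        case (Some cd)
        then obtain c d where cd: "rv C' n v0 (C' t s) = Some (c, d)" by (cases cd) auto
        have "b \<in> lists A" "d \<in> lists A" using IH1 IH2 ab cd by auto
        note IH3 = Suc.IH[OF this]
        show ?thesis
        proof (cases "rv C' n b d")
          case None
          then show ?thesis using uv IH1 IH2 IH3 1 ab cd by simp
        next
          case (Some ef)
          then show ?thesis using uv IH1 IH2 IH3 1 ab cd by (cases ef) auto
        qed
      qed
    qed
  qed
qed

lemma cube_map:
  assumes C: "\<And>s t. s \<in> A \<Longrightarrow> t \<in> A \<Longrightarrow> C' s t \<in> lists A \<and> C (\<phi> s) (\<phi> t) = map \<phi> (C' s t)"
    and rst: "r \<in> A" "s \<in> A" "t \<in> A" and "cube C' n r s t"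
  shows "cube C n (\<phi> r) (\<phi> s) (\<phi> t)"
proof -
  obtain p p' w where 1: "rv C' n (C' r s) (C' r t) = Some (p, p')"
    "rv C' n (C' s r @ p) (C' s t) = Some ([], w)"
    "rv C' n (C' t r @ p') (C' t s @ w) = Some ([], [])"
    using cubeE[OF assms(5)] by metis
  have C': "\<And>x y. x \<in> A \<Longrightarrow> y \<in> A \<Longrightarrow> C (\<phi> x) (\<phi> y) = map \<phi> (C' x y)"
    "\<And>x y. x \<in> A \<Longrightarrow> y \<in> A \<Longrightarrow> C' x y \<in> lists A" using C by auto
  note m = rv_map[where A = A and C = C and C' = C' and \<phi> = \<phi>, OF C]
  have 2: "rv C n (map \<phi> (C' r s)) (map \<phi> (C' r t)) = Some (map \<phi> p, map \<phi> p')" "p \<in> lists A" "p' \<in> lists A"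
    using m[of "C' r s" "C' r t" n] 1 C' rst by auto
  have 3: "rv C n (map \<phi> (C' s r @ p)) (map \<phi> (C' s t)) = Some ([], map \<phi> w)" "w \<in> lists A"
    using m[of "C' s r @ p" "C' s t" n] 1 2 C' rst by auto
  have 4: "rv C n (map \<phi> (C' t r @ p')) (map \<phi> (C' t s @ w)) = Some ([], [])"
    using m[of "C' t r @ p'" "C' t s @ w" n] 1 2 3 C' rst by auto
  show ?thesis using 2 3 4 C'(1) rst by (simp add: cube_def)
qed

text \<open>\<open>C_equiv\<close> asks only for a derivable equivalence, whereas
  \<open>rel_C\<close> asks that every defining relation equate the two completions of a pair. So
  \<open>C\<close> can also provide an lcm for pairs of generators without a relation of their own,
  as crossing chords require.\<close>

locale complemented = graded_presentation +
  fixes C :: "'a \<Rightarrow> 'a \<Rightarrow> 'a list"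
  assumes C_lists: "s \<in> G \<Longrightarrow> t \<in> G \<Longrightarrow> C s t \<in> lists G"
    and C_same: "s \<in> G \<Longrightarrow> C s s = []"
    and C_equiv: "s \<in> G \<Longrightarrow> t \<in> G \<Longrightarrow> (s # C s t, t # C t s) \<in> wcong R"
    and rel_C: "(l, r) \<in> R \<Longrightarrow> \<exists>s\<in>G. \<exists>t\<in>G. l = s # C s t \<and> r = t # C t s"
    and cube_C: "s \<in> G \<Longrightarrow> t \<in> G \<Longrightarrow> t' \<in> G \<Longrightarrow> \<exists>n. cube C n s t t'"
begin

lemma rv_sound:
  assumes "u \<in> lists G" "v \<in> lists G" "rv C n u v = Some (a, b)"
  shows "a \<in> lists G \<and> b \<in> lists G \<and> u @ a \<doteq> v @ b"
  using assms
proof (induction n arbitrary: u v a b)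
  case 0
  then show ?case by (cases u; cases v) auto
next
  case (Suc n)
  show ?case
  proof (cases "u = [] \<or> v = []")
    case True
    then show ?thesis using Suc.prems by (cases u; cases v) auto
  next
    case False
    then obtain s u0 t v0 where uv: "u = s # u0" "v = t # v0" by (meson list.exhaust)
    have st: "s \<in> G" "t \<in> G" "u0 \<in> lists G" "v0 \<in> lists G" using Suc.prems uv by auto
    obtain a1 b1 a2 b2 a3 b3 where r: "rv C n u0 (C s t) = Some (a1, b1)"
      "rv C n v0 (C t s) = Some (a2, b2)" "rv C n b1 b2 = Some (a3, b3)" "a = a1 @ a3" "b = a2 @ b3"
      using Suc.prems(3) uv by (auto split: option.splits)
    have 1: "a1 \<in> lists G" "b1 \<in> lists G" "u0 @ a1 \<doteq> C s t @ b1"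
      using Suc.IH[OF st(3) C_lists r(1)] st by auto
    have 2: "a2 \<in> lists G" "b2 \<in> lists G" "v0 @ a2 \<doteq> C t s @ b2"
      using Suc.IH[OF st(4) C_lists r(2)] st by auto
    have 3: "a3 \<in> lists G" "b3 \<in> lists G" "b1 @ a3 \<doteq> b2 @ b3"
      using Suc.IH[OF 1(2) 2(2) r(3)] by auto
    have "s # (u0 @ a1) @ a3 \<doteq> s # (C s t @ b1) @ a3"
      using 1(3) by (intro wcong_Cons wcong_appendR)
    also have "(s # (C s t @ b1) @ a3, (s # C s t) @ b2 @ b3) \<in> wcong R"
      using wcong_appendL[OF 3(3), of "s # C s t"] by simp
    also have "((s # C s t) @ b2 @ b3, (t # C t s) @ b2 @ b3) \<in> wcong R"
      using st by (intro wcong_appendR C_equiv)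
    also have "((t # C t s) @ b2 @ b3, t # (v0 @ a2) @ b3) \<in> wcong R"
      using wcong_Cons[OF wcong_appendR[OF wcong_sym[OF 2(3)], of b3], of t] by simp
    finally show ?thesis using uv r 1 2 3 by simp
  qed
qed

text \<open>The bound \<open>N\<close> breaks a circle: that reversing finds all common multiples of
  length at most \<open>N\<close> follows from this property at \<open>N\<close>, and is used in
  turn to prove it at \<open>Suc N\<close>.\<close>

definition common_multiples_factor :: "nat \<Rightarrow> bool" where
  "common_multiples_factor N \<longleftrightarrow> (\<forall>s\<in>G. \<forall>t\<in>G. \<forall>u\<in>lists G. \<forall>v\<in>lists G.
     length u < N \<longrightarrow> s # u \<doteq> t # v \<longrightarrow> (\<exists>w\<in>lists G. u \<doteq> C s t @ w \<and> v \<doteq> C t s @ w))"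

text \<open>The three recursive calls tile the reversing diagram. A common multiple of
  \<open>s # u0\<close> and \<open>t # v0\<close> factors through the lcm of \<open>s\<close> and
  \<open>t\<close>; the remainder \<open>w\<close> is divisible by both \<open>b1\<close> and
  \<open>b2\<close>, hence is a common multiple for the third cell.\<close>

lemma rv_complete:
  assumes N: "common_multiples_factor N"
    and "u \<in> lists G" "v \<in> lists G" "x \<in> lists G" "y \<in> lists G"
    and "rv C n u v = Some (a, b)" "u @ x \<doteq> v @ y" "length (u @ x) \<le> N"
  shows "\<exists>z\<in>lists G. x \<doteq> a @ z \<and> y \<doteq> b @ z"
  using assms(2-)
proof (induction n arbitrary: u v x y a b)
  case 0
  then show ?case by (cases u; cases v) (auto intro: wcong_sym)
next
  case (Suc n)
  show ?case
  proof (cases "u = [] \<or> v = []")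
    case True
    then show ?thesis using Suc.prems by (cases u; cases v) (auto intro: wcong_sym)
  next
    case False
    then obtain s u0 t v0 where uv: "u = s # u0" "v = t # v0" by (meson list.exhaust)
    have st: "s \<in> G" "t \<in> G" "u0 \<in> lists G" "v0 \<in> lists G" using Suc.prems uv by auto
    obtain a1 b1 a2 b2 a3 b3 where r: "rv C n u0 (C s t) = Some (a1, b1)"
      "rv C n v0 (C t s) = Some (a2, b2)" "rv C n b1 b2 = Some (a3, b3)" "a = a1 @ a3" "b = a2 @ b3"
      using Suc.prems(5) uv by (auto split: option.splits)
    have l: "u0 @ x \<in> lists G" "v0 @ y \<in> lists G" "length (u0 @ x) < N" "s # (u0 @ x) \<doteq> t # (v0 @ y)"
      using Suc.prems uv by auto
    obtain w where w: "w \<in> lists G" "u0 @ x \<doteq> C s t @ w" "v0 @ y \<doteq> C t s @ w"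
      using N[unfolded common_multiples_factor_def, rule_format, OF st(1,2) l] by blast
    have len: "length (u0 @ x) \<le> N" "length (v0 @ y) \<le> N"
      using l equivalent_length[OF l(4)] by auto
    obtain z1 where z1: "z1 \<in> lists G" "x \<doteq> a1 @ z1" "w \<doteq> b1 @ z1"
      using Suc.IH[OF st(3) C_lists[OF st(1,2)] Suc.prems(3) w(1) r(1) w(2) len(1)] by blast
    obtain z2 where z2: "z2 \<in> lists G" "y \<doteq> a2 @ z2" "w \<doteq> b2 @ z2"
      using Suc.IH[OF st(4) C_lists[OF st(2,1)] Suc.prems(4) w(1) r(2) w(3) len(2)] by blast
    have b: "b1 \<in> lists G" "b2 \<in> lists G"
      using rv_sound[OF st(3) C_lists r(1)] rv_sound[OF st(4) C_lists r(2)] st by auto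
    have "b1 @ z1 \<doteq> b2 @ z2" using z1 z2 by (blast intro: wcong_trans wcong_sym)
    moreover have "length (b1 @ z1) \<le> N"
      using equivalent_length[OF z1(3)] equivalent_length[OF w(2)] len(1) by simp
    ultimately obtain z where z: "z \<in> lists G" "z1 \<doteq> a3 @ z" "z2 \<doteq> b3 @ z"
      using Suc.IH[OF b z1(1) z2(1) r(3)] by blast
    have "x \<doteq> a1 @ a3 @ z" using wcong_trans[OF z1(2) wcong_appendL[OF z(2)]] .
    moreover have "y \<doteq> a2 @ b3 @ z" using wcong_trans[OF z2(2) wcong_appendL[OF z(3)]] .
    ultimately show ?thesis using r z(1) by auto
  qed
qed

text \<open>Induction along a derivation from \<open>s # u\<close>, carrying a factorization through
  the lcm of \<open>s\<close> and the current first letter. Only a relation applied at the very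
  front changes that letter, say from \<open>r\<close> to \<open>t\<close>; the cube condition then
  converts the factorization for \<open>s\<close>, \<open>r\<close> into one for \<open>s\<close>,
  \<open>t\<close>.\<close>

lemma common_multiples_factor_Suc:
  assumes N: "common_multiples_factor N"
  shows "common_multiples_factor (Suc N)"
  unfolding common_multiples_factor_def
proof (intro ballI impI)
  fix s t0 u v0
  assume s: "s \<in> G" "t0 \<in> G" "u \<in> lists G" "v0 \<in> lists G" "length u < Suc N" "s # u \<doteq> t0 # v0"
  have "(s # u, t0 # v0) \<in> (rstep R \<union> (rstep R)\<inverse>)\<^sup>*" using s(6) by (simp add: wcong_def)
  then have "\<forall>t v. t0 # v0 = t # v \<longrightarrow> (\<exists>w\<in>lists G. u \<doteq> C s t @ w \<and> v \<doteq> C t s @ w)"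
  proof (induction rule: rtrancl_induct)
    case base
    then show ?case using s C_same by auto
  next
    case (step y z)
    show ?case
    proof (intro allI impI)
      fix t v assume z: "z = t # v"
      have sy: "s # u \<doteq> y" using step.hyps(1) by (simp add: wcong_def)
      have yz: "y \<doteq> z" using step.hyps(2) by (auto simp: wcong_def)
      have "length y = Suc (length u)" using equivalent_length[OF sy] by simp
      then obtain r y' where y: "y = r # y'" by (cases y) auto
      have "y \<in> lists G" "z \<in> lists G" using equivalent_lists[OF sy] equivalent_lists[OF yz] s by auto
      then have G: "r \<in> G" "y' \<in> lists G" "t \<in> G" "v \<in> lists G" using y z by auto
      obtain a where a: "a \<in> lists G" "u \<doteq> C s r @ a" "y' \<doteq> C r s @ a"
        using step.IH y by blast
      obtain k l l' b where kb: "y = k @ l @ b" "z = k @ l' @ b" "(l, l') \<in> R \<or> (l', l) \<in> R"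
        using step.hyps(2) by (auto simp: rstep_def)
      then obtain p q where pq: "p \<in> G" "q \<in> G" "l = p # C p q" "l' = q # C q p"
        using rel_C by metis
      show "\<exists>w\<in>lists G. u \<doteq> C s t @ w \<and> v \<doteq> C t s @ w"
      proof (cases k)
        case (Cons k0 k')
        then have "t = r" "y' = k' @ l @ b" "v = k' @ l' @ b" using kb y z by auto
        moreover have "k' @ l' @ b \<doteq> k' @ l @ b"
          using kb(3) wcong_rel wcong_sym by (intro wcong_ctx) blast
        ultimately show ?thesis using a wcong_trans by blast
      next
        case Nil
        then have e: "p = r" "q = t" "y' = C r t @ b" "v = C t r @ b" using kb y z pq by auto
        obtain n x x' w where n: "rv C n (C r s) (C r t) = Some (x, x')"
          "rv C n (C s r @ x) (C s t) = Some ([], w)"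
          "rv C n (C t r @ x') (C t s @ w) = Some ([], [])"
          using cube_C[OF G(1) s(1) G(3)] cubeE by metis
        have cl: "C r s \<in> lists G" "C r t \<in> lists G" "C s r \<in> lists G" "C s t \<in> lists G"
          "C t r \<in> lists G" "C t s \<in> lists G" using C_lists G s by auto
        have x: "x \<in> lists G" "x' \<in> lists G" using rv_sound[OF cl(1,2) n(1)] by auto
        have w: "w \<in> lists G" "C s r @ x \<doteq> C s t @ w" using rv_sound[OF _ cl(4) n(2)] cl x by auto
        have w': "C t r @ x' \<doteq> C t s @ w" using rv_sound[OF _ _ n(3)] cl x w by auto
        have b: "b \<in> lists G" using G e by auto
        \<comment> \<open>Without its first letter the word has length at most \<open>N\<close>, so
          completeness of reversing is available for \<open>C r s\<close> and
          \<open>C r t\<close>.\<close>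
        have "length (C r s @ a) \<le> N"
          using s(5) equivalent_length[OF a(3)] \<open>length y = Suc (length u)\<close> y by simp
        then obtain c where c: "c \<in> lists G" "a \<doteq> x @ c" "b \<doteq> x' @ c"
          using rv_complete[OF N cl(1,2) a(1) b n(1)] wcong_sym[OF a(3)] e by auto
        have "u \<doteq> (C s r @ x) @ c" using wcong_trans[OF a(2) wcong_appendL[OF c(2)]] by simp
        then have 1: "u \<doteq> C s t @ w @ c" using wcong_trans[OF _ wcong_appendR[OF w(2), of c]] by simp
        have "v \<doteq> (C t r @ x') @ c" using wcong_appendL[OF c(3)] e by simp
        then have 2: "v \<doteq> C t s @ w @ c" using wcong_trans[OF _ wcong_appendR[OF w', of c]] by simp
        show ?thesis using 1 2 w c by (intro bexI[of _ "w @ c"]) auto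
      qed
    qed
  qed
  then show "\<exists>w\<in>lists G. u \<doteq> C s t0 @ w \<and> v0 \<doteq> C t0 s @ w" by blast
qed

lemma common_multiple_factor:
  assumes "s \<in> G" "t \<in> G" "u \<in> lists G" "v \<in> lists G" "s # u \<doteq> t # v"
  obtains w where "w \<in> lists G" "u \<doteq> C s t @ w" "v \<doteq> C t s @ w"
proof -
  have "common_multiples_factor N" for N
    by (induction N) (simp add: common_multiples_factor_def, rule common_multiples_factor_Suc)
  from this[of "Suc (length u)", unfolded common_multiples_factor_def, rule_format, OF assms(1-4) _ assms(5)]
  show ?thesis using that by auto
qed

lemma equivalent_cancel:
  assumes "a \<in> lists G" "u \<in> lists G" "v \<in> lists G" "a @ u \<doteq> a @ v"
  shows "u \<doteq> v"
  using assms
proof (induction a)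
  case (Cons s a)
  then have "s \<in> G" "a @ u \<in> lists G" "a @ v \<in> lists G" "s # a @ u \<doteq> s # a @ v" by auto
  then obtain w where "a @ u \<doteq> C s s @ w" "a @ v \<doteq> C s s @ w"
    using common_multiple_factor by metis
  then have "a @ u \<doteq> a @ v" using C_same[OF \<open>s \<in> G\<close>] by (metis append_Nil wcong_sym wcong_trans)
  then show ?case using Cons by auto
qed auto

section \<open>Least common multiples within a set of generators\<close>

definition lcm_closed :: "'a set \<Rightarrow> bool" where
  "lcm_closed X \<longleftrightarrow> X \<subseteq> G \<and> (\<forall>s\<in>X. \<forall>t\<in>X. C s t \<in> lists X)"

lemma lcm_closed_G: "lcm_closed G"
  using C_lists by (auto simp: lcm_closed_def)

text \<open>Reversing might run for ever; the length of the given common multiple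
  \<open>p @ x0\<close> bounds the recursion instead. The completing words \<open>u\<close>,
  \<open>v\<close> stay over \<open>X\<close>, while their minimality holds against all words over
  \<open>G\<close>.\<close>

lemma lcm_words:
  assumes X: "lcm_closed X" and "p \<in> lists X" "r \<in> lists X"
    and "x0 \<in> lists G" "y0 \<in> lists G" "p @ x0 \<doteq> r @ y0"
  shows "\<exists>u\<in>lists X. \<exists>v\<in>lists X. p @ u \<doteq> r @ v \<and>
    (\<forall>x\<in>lists G. \<forall>y\<in>lists G. p @ x \<doteq> r @ y \<longrightarrow> (\<exists>z\<in>lists G. x \<doteq> u @ z \<and> y \<doteq> v @ z))"
  using assms(2-)
proof (induction "length (p @ x0)" arbitrary: p r x0 y0 rule: less_induct)
  case less
  have XG: "lists X \<subseteq> lists G" using X by (intro lists_mono) (auto simp: lcm_closed_def)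
  show ?case
  proof (cases "p = [] \<or> r = []")
    case True
    then show ?thesis
    proof
      assume p: "p = []"
      show ?thesis
        by (rule bexI[of _ r], rule bexI[of _ "[]"]) (use p less.prems in auto)
    next
      assume r: "r = []"
      show ?thesis
        by (rule bexI[of _ "[]"], rule bexI[of _ p]) (use r less.prems in \<open>auto intro: wcong_sym\<close>)
    qed
  next
    case False
    then obtain s p' t r' where pr: "p = s # p'" "r = t # r'" by (meson list.exhaust)
    have st: "s \<in> X" "t \<in> X" "p' \<in> lists X" "r' \<in> lists X" using less.prems pr by auto
    have stG: "s \<in> G" "t \<in> G" using st X by (auto simp: lcm_closed_def)
    have cX: "C s t \<in> lists X" "C t s \<in> lists X" using X st by (auto simp: lcm_closed_def)
    have prG: "p' \<in> lists G" "r' \<in> lists G" using st XG by auto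
    have l: "length (r @ y0) = length (p @ x0)" using equivalent_length[OF less.prems(5)] by simp
    have "s # (p' @ x0) \<doteq> t # (r' @ y0)" using less.prems pr by simp
    then obtain w0 where w0: "w0 \<in> lists G" "p' @ x0 \<doteq> C s t @ w0" "r' @ y0 \<doteq> C t s @ w0"
      using common_multiple_factor[OF stG, of "p' @ x0" "r' @ y0"] prG less.prems by auto
    have "length (p' @ x0) < length (p @ x0)" using pr by simp
    from less.hyps[OF this st(3) cX(1) less.prems(3) w0(1,2)] obtain u1 v1 where
      1: "u1 \<in> lists X" "v1 \<in> lists X" "p' @ u1 \<doteq> C s t @ v1"
      "\<forall>x\<in>lists G. \<forall>y\<in>lists G. p' @ x \<doteq> C s t @ y \<longrightarrow> (\<exists>z\<in>lists G. x \<doteq> u1 @ z \<and> y \<doteq> v1 @ z)" by blast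
    have "length (r' @ y0) < length (p @ x0)" using pr l by simp
    from less.hyps[OF this st(4) cX(2) less.prems(4) w0(1,3)] obtain u2 v2 where
      2: "u2 \<in> lists X" "v2 \<in> lists X" "r' @ u2 \<doteq> C t s @ v2"
      "\<forall>x\<in>lists G. \<forall>y\<in>lists G. r' @ x \<doteq> C t s @ y \<longrightarrow> (\<exists>z\<in>lists G. x \<doteq> u2 @ z \<and> y \<doteq> v2 @ z)" by blast
    obtain z1 where z1: "z1 \<in> lists G" "w0 \<doteq> v1 @ z1" using 1(4) w0 less.prems by blast
    obtain z2 where z2: "z2 \<in> lists G" "w0 \<doteq> v2 @ z2" using 2(4) w0 less.prems by blast
    have "length (v1 @ z1) < length (p @ x0)"
      using equivalent_length[OF z1(2)] equivalent_length[OF w0(2)] pr by simp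
    from less.hyps[OF this 1(2) 2(2) z1(1) z2(1)] wcong_trans[OF wcong_sym[OF z1(2)] z2(2)]
    obtain u3 v3 where
      3: "u3 \<in> lists X" "v3 \<in> lists X" "v1 @ u3 \<doteq> v2 @ v3"
      "\<forall>x\<in>lists G. \<forall>y\<in>lists G. v1 @ x \<doteq> v2 @ y \<longrightarrow> (\<exists>z\<in>lists G. x \<doteq> u3 @ z \<and> y \<doteq> v3 @ z)" by blast
    have "s # (p' @ u1) @ u3 \<doteq> s # (C s t @ v1) @ u3"
      using 1(3) by (intro wcong_Cons wcong_appendR)
    also have "(s # (C s t @ v1) @ u3, (s # C s t) @ v2 @ v3) \<in> wcong R"
      using wcong_appendL[OF 3(3), of "s # C s t"] by simp
    also have "((s # C s t) @ v2 @ v3, (t # C t s) @ v2 @ v3) \<in> wcong R"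
      using stG by (intro wcong_appendR C_equiv)
    also have "((t # C t s) @ v2 @ v3, t # (r' @ u2) @ v3) \<in> wcong R"
      using wcong_Cons[OF wcong_appendR[OF wcong_sym[OF 2(3)], of v3], of t] by simp
    finally have eq: "p @ u1 @ u3 \<doteq> r @ u2 @ v3" using pr by simp
    have "\<exists>z\<in>lists G. x \<doteq> (u1 @ u3) @ z \<and> y \<doteq> (u2 @ v3) @ z"
      if xy: "x \<in> lists G" "y \<in> lists G" "p @ x \<doteq> r @ y" for x y
    proof -
      have "s # (p' @ x) \<doteq> t # (r' @ y)" using xy pr by simp
      then obtain w where w: "w \<in> lists G" "p' @ x \<doteq> C s t @ w" "r' @ y \<doteq> C t s @ w"
        using common_multiple_factor[OF stG, of "p' @ x" "r' @ y"] prG xy by auto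
      obtain z1 where z1: "z1 \<in> lists G" "x \<doteq> u1 @ z1" "w \<doteq> v1 @ z1" using 1(4) w xy by blast
      obtain z2 where z2: "z2 \<in> lists G" "y \<doteq> u2 @ z2" "w \<doteq> v2 @ z2" using 2(4) w xy by blast
      have "v1 @ z1 \<doteq> v2 @ z2" using wcong_trans[OF wcong_sym[OF z1(3)] z2(3)] .
      then obtain z where z: "z \<in> lists G" "z1 \<doteq> u3 @ z" "z2 \<doteq> v3 @ z" using 3(4) z1 z2 by blast
      show ?thesis
        using wcong_trans[OF z1(2) wcong_appendL[OF z(2)]] wcong_trans[OF z2(2) wcong_appendL[OF z(3)]] z(1)
        by auto
    qed
    then show ?thesis
      using eq 1 2 3 by (intro bexI[of _ "u1 @ u3"] bexI[of _ "u2 @ v3"]) auto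
  qed
qed

end

subsection \<open>Garside normal forms\<close>

context graded_presentation
begin

lemma finite_ball: "finite {x \<in> M. mlen x \<le> k}"
proof (rule finite_subset)
  show "{x \<in> M. mlen x \<le> k} \<subseteq> cls R ` {w. set w \<subseteq> G \<and> length w \<le> k}"
    by (auto simp: Mon_def mlen_cls)
  show "finite (cls R ` {w. set w \<subseteq> G \<and> length w \<le> k})"
    using finite_lists_length_le[OF finite_G] by auto
qed

abbreviation submonoid where "submonoid X \<equiv> cls R ` lists X"

lemma submonoid_subset: "X \<subseteq> G \<Longrightarrow> submonoid X \<subseteq> M"
  by (auto simp: Mon_def)

lemma submonoid_mul: "p \<in> submonoid X \<Longrightarrow> r \<in> submonoid X \<Longrightarrow> p \<odot> r \<in> submonoid X"
proof -
  assume "p \<in> submonoid X" "r \<in> submonoid X"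
  then obtain u v where "u \<in> lists X" "p = cls R u" "v \<in> lists X" "r = cls R v" by auto
  then have "p \<odot> r = cls R (u @ v)" "u @ v \<in> lists X" by (auto simp: mmult_cls)
  then show ?thesis by blast
qed

lemma submonoid_gen: "s \<in> X \<Longrightarrow> gen R s \<in> submonoid X"
  by (auto simp: gen_def)

lemma submonoid_unit: "\<one> \<in> submonoid X"
  by (auto simp: munit_def)

lemma submonoid_Cons:
  assumes "x \<in> submonoid X" "X \<subseteq> G" "x \<noteq> \<one>"
  obtains s y where "s \<in> X" "y \<in> submonoid X" "x = gen R s \<odot> y"
proof -
  obtain w where w: "w \<in> lists X" "x = cls R w" using assms by auto
  then obtain s v where "w = s # v" using assms(3) by (cases w) (auto simp: munit_def)
  then show ?thesis using that[of s "cls R v"] w cls_Cons by auto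
qed

end

context complemented
begin

lemma mul_cancel:
  assumes "x \<in> M" "y \<in> M" "z \<in> M" "x \<odot> y = x \<odot> z"
  shows "y = z"
proof -
  obtain u v w where *: "u \<in> lists G" "x = cls R u" "v \<in> lists G" "y = cls R v" "w \<in> lists G" "z = cls R w"
    using assms(1-3) by (auto simp: Mon_def)
  then have "u @ v \<doteq> u @ w" using assms(4) by (simp add: mmult_cls cls_eq_iff)
  then show ?thesis using equivalent_cancel[OF *(1,3,5)] * by (simp add: cls_eq_iff)
qed

lemma le_cancel:
  assumes "x \<in> M" "y \<in> M" "z \<in> M" "x \<odot> y \<preceq> x \<odot> z"
  shows "y \<preceq> z"
proof -
  obtain w where "w \<in> M" "x \<odot> z = x \<odot> y \<odot> w" using assms by (auto elim: ldivE)
  then have "z = y \<odot> w" using mul_cancel[of x z "y \<odot> w"] assms by (simp add: mul_assoc)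
  then show ?thesis using \<open>w \<in> M\<close> by (simp add: assms)
qed

text \<open>All later computations of left divisors of a product push the divisor past the first
  factor in this way.\<close>

lemma gen_le_gen_mul:
  assumes "s \<in> G" "t \<in> G" "x \<in> M" "gen R s \<preceq> gen R t \<odot> x"
  shows "cls R (C t s) \<preceq> x"
proof -
  obtain y where y: "y \<in> M" "gen R t \<odot> x = gen R s \<odot> y" using assms by (auto elim: ldivE)
  obtain u v where uv: "u \<in> lists G" "x = cls R u" "v \<in> lists G" "y = cls R v"
    using y(1) assms(3) by (auto simp: Mon_def)
  then have "t # u \<doteq> s # v" using y(2) by (simp add: gen_def mmult_cls cls_eq_iff)
  then obtain w where w: "w \<in> lists G" "u \<doteq> C t s @ w"
    using common_multiple_factor[OF assms(2,1) uv(1,3)] by blast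
  show ?thesis unfolding uv(2) using w C_lists[OF assms(2,1)] wcong_sym by (subst cls_le_iff) blast+
qed

lemma gen_mul_C: "s \<in> G \<Longrightarrow> t \<in> G \<Longrightarrow> gen R s \<odot> cls R (C s t) = gen R t \<odot> cls R (C t s)"
  using C_equiv by (simp add: cls_Cons[symmetric] cls_eq_iff)

lemma submonoid_lcm:
  assumes X: "lcm_closed X" and "p \<in> submonoid X" "r \<in> submonoid X" "x0 \<in> M" "y0 \<in> M" "p \<odot> x0 = r \<odot> y0"
  obtains u v where "u \<in> submonoid X" "v \<in> submonoid X" "p \<odot> u = r \<odot> v"
    "\<And>x y. x \<in> M \<Longrightarrow> y \<in> M \<Longrightarrow> p \<odot> x = r \<odot> y \<Longrightarrow> \<exists>z\<in>M. x = u \<odot> z \<and> y = v \<odot> z"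
proof -
  obtain pw rw where w: "pw \<in> lists X" "p = cls R pw" "rw \<in> lists X" "r = cls R rw" using assms by blast
  obtain xw yw where w2: "xw \<in> lists G" "x0 = cls R xw" "yw \<in> lists G" "y0 = cls R yw"
    using assms(4,5) by (auto simp: Mon_def)
  have "pw @ xw \<doteq> rw @ yw" using assms(6) w w2 by (simp add: mmult_cls cls_eq_iff)
  from lcm_words[OF X w(1,3) w2(1,3) this] obtain u v where uv: "u \<in> lists X" "v \<in> lists X" "pw @ u \<doteq> rw @ v"
    and *: "\<And>x y. x \<in> lists G \<Longrightarrow> y \<in> lists G \<Longrightarrow> pw @ x \<doteq> rw @ y \<Longrightarrow> \<exists>z\<in>lists G. x \<doteq> u @ z \<and> y \<doteq> v @ z"
    by blast
  show ?thesis
  proof (rule that[of "cls R u" "cls R v"])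
    show "cls R u \<in> submonoid X" "cls R v \<in> submonoid X" "p \<odot> cls R u = r \<odot> cls R v"
      using uv w by (auto simp: mmult_cls cls_eq_iff)
  next
    fix x y assume xy: "x \<in> M" "y \<in> M" "p \<odot> x = r \<odot> y"
    obtain xw yw where w2: "xw \<in> lists G" "x = cls R xw" "yw \<in> lists G" "y = cls R yw"
      using xy(1,2) by (auto simp: Mon_def)
    have "pw @ xw \<doteq> rw @ yw" using xy(3) w w2 by (simp add: mmult_cls cls_eq_iff)
    from *[OF w2(1,3) this] obtain z where z: "z \<in> lists G" "xw \<doteq> u @ z" "yw \<doteq> v @ z" by blast
    show "\<exists>z\<in>M. x = cls R u \<odot> z \<and> y = cls R v \<odot> z"
      using z w2 by (intro bexI[of _ "cls R z"]) (simp_all add: mmult_cls cls_eq_iff cls_in_M)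
  qed
qed

text \<open>The bound \<open>m\<close> guarantees that lcms exist; the resulting lub lies below
  every other bound. The case of a proper parabolic matters besides \<open>X = G\<close>: the lub of
  its elements stays inside.\<close>

lemma submonoid_lub:
  assumes X: "lcm_closed X" and "finite F" "F \<subseteq> submonoid X" "m \<in> M" "\<And>p. p \<in> F \<Longrightarrow> p \<preceq> m"
  shows "\<exists>z\<in>submonoid X. (\<forall>p\<in>F. p \<preceq> z) \<and> (\<forall>m'\<in>M. (\<forall>p\<in>F. p \<preceq> m') \<longrightarrow> z \<preceq> m')"
  using assms(2-)
proof (induction F rule: finite_induct)
  case empty
  then show ?case by (intro bexI[of _ \<one>] submonoid_unit) auto
next
  case (insert a F)
  have XM: "submonoid X \<subseteq> M" using X submonoid_subset by (auto simp: lcm_closed_def)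
  obtain z where z: "z \<in> submonoid X" "\<forall>p\<in>F. p \<preceq> z" "\<forall>m'\<in>M. (\<forall>p\<in>F. p \<preceq> m') \<longrightarrow> z \<preceq> m'"
    using insert by auto
  have a: "a \<in> submonoid X" "a \<preceq> m" "z \<preceq> m" using insert z by auto
  obtain x0 y0 where 0: "x0 \<in> M" "y0 \<in> M" "m = a \<odot> x0" "m = z \<odot> y0" using a(2,3) by (auto simp: ldiv_def)
  have "a \<odot> x0 = z \<odot> y0" using 0 by simp
  from submonoid_lcm[OF X a(1) z(1) 0(1,2) this] obtain u v where
    uv: "u \<in> submonoid X" "v \<in> submonoid X" "a \<odot> u = z \<odot> v" and
    univ: "\<And>x y. x \<in> M \<Longrightarrow> y \<in> M \<Longrightarrow> a \<odot> x = z \<odot> y \<Longrightarrow> \<exists>w\<in>M. x = u \<odot> w \<and> y = v \<odot> w" by blast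
  have inM: "a \<in> M" "z \<in> M" "u \<in> M" "v \<in> M" using a z uv XM by auto
  have zz: "z \<preceq> a \<odot> u" using inM uv(3) by simp
  show ?case
  proof (intro bexI[of _ "a \<odot> u"] conjI ballI impI)
    show "a \<odot> u \<in> submonoid X" using a uv submonoid_mul by blast
    fix p assume "p \<in> insert a F"
    then show "p \<preceq> a \<odot> u"
      using zz z inM insert.prems XM by (metis dv_trans insert_iff le_mulR subset_iff)
  next
    fix m' assume m': "m' \<in> M" "\<forall>p\<in>insert a F. p \<preceq> m'"
    then have "a \<preceq> m'" "z \<preceq> m'" using z by auto
    then obtain x y where xy: "x \<in> M" "y \<in> M" "m' = a \<odot> x" "m' = z \<odot> y" by (metis ldivE)
    then obtain w where "w \<in> M" "x = u \<odot> w" using univ[of x y] by auto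
    then show "a \<odot> u \<preceq> m'" using xy inM by (intro ldivI[of w]) (simp_all add: mul_assoc)
  qed
qed

lemma lub_exists:
  assumes "F \<subseteq> M" "m \<in> M" "\<And>p. p \<in> F \<Longrightarrow> p \<preceq> m"
  shows "\<exists>z\<in>M. (\<forall>p\<in>F. p \<preceq> z) \<and> (\<forall>m'\<in>M. (\<forall>p\<in>F. p \<preceq> m') \<longrightarrow> z \<preceq> m')"
proof -
  have "finite F"
    by (rule finite_subset[OF _ finite_ball[of "mlen m"]]) (use assms le_mlen in blast)
  then show ?thesis using submonoid_lub[OF lcm_closed_G, of F m] assms unfolding Mon_def by simp
qed

end

text \<open>\<open>C_prefix\<close> makes every complement a left divisor of the lcm of two
  generators, hence of \<Delta>. This suffices to move \<Delta> from right to left past any element,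
  which takes the place of the usual automorphism given by conjugation.\<close>

locale garside = complemented +
  assumes gens_bounded: "\<exists>D\<in>M. \<forall>s\<in>G. gen R s \<preceq> D"
    and C_prefix: "s \<in> G \<Longrightarrow> t \<in> G \<Longrightarrow> \<exists>a\<in>G. \<exists>b\<in>G. \<exists>v\<in>lists G. C s t @ v = a # C a b"
begin

abbreviation \<Delta> where "\<Delta> \<equiv> Delta G R"
abbreviation S where "S \<equiv> Simples G R"
abbreviation arr (infix "\<leadsto>" 50) where "x \<leadsto> y \<equiv> arrow G R x y"

section \<open>The Garside element and its divisors\<close>

lemma Delta_lub: "\<Delta> \<in> M \<and> (\<forall>s\<in>G. gen R s \<preceq> \<Delta>) \<and> (\<forall>y\<in>M. (\<forall>s\<in>G. gen R s \<preceq> y) \<longrightarrow> \<Delta> \<preceq> y)"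
proof -
  obtain D where "D \<in> M" "\<forall>s\<in>G. gen R s \<preceq> D" using gens_bounded by blast
  then obtain z where z: "z \<in> M \<and> (\<forall>s\<in>G. gen R s \<preceq> z) \<and> (\<forall>y\<in>M. (\<forall>s\<in>G. gen R s \<preceq> y) \<longrightarrow> z \<preceq> y)"
    using lub_exists[of "gen R ` G" D] by (simp add: image_subset_iff) blast
  show ?thesis unfolding Delta_def
  proof (rule theI[of _ z])
    show "z \<in> M \<and> (\<forall>s\<in>G. gen R s \<preceq> z) \<and> (\<forall>y\<in>M. (\<forall>s\<in>G. gen R s \<preceq> y) \<longrightarrow> z \<preceq> y)" by (fact z)
  next
    fix x assume x: "x \<in> M \<and> (\<forall>s\<in>G. gen R s \<preceq> x) \<and> (\<forall>y\<in>M. (\<forall>s\<in>G. gen R s \<preceq> y) \<longrightarrow> x \<preceq> y)"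
    show "x = z" by (rule dv_antisym) (use x z in simp_all)
  qed
qed

lemma Delta_in_M [simp, intro]: "\<Delta> \<in> M"
  and gen_le_Delta: "s \<in> G \<Longrightarrow> gen R s \<preceq> \<Delta>"
  and Delta_le: "y \<in> M \<Longrightarrow> (\<And>s. s \<in> G \<Longrightarrow> gen R s \<preceq> y) \<Longrightarrow> \<Delta> \<preceq> y"
  using Delta_lub by auto

lemma simple_iff: "x \<in> S \<longleftrightarrow> x \<in> M \<and> x \<preceq> \<Delta>"
  by (simp add: Simples_def)

lemma simple_in_M [simp]: "x \<in> S \<Longrightarrow> x \<in> M"
  by (simp add: simple_iff)

lemma finite_S [simp]: "finite S"
  by (rule finite_subset[OF _ finite_ball[of "mlen \<Delta>"]]) (auto simp: simple_iff le_mlen)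

lemma unit_simple [simp]: "\<one> \<in> S"
  by (simp add: simple_iff)

lemma gen_simple [simp]: "s \<in> G \<Longrightarrow> gen R s \<in> S"
  by (simp add: simple_iff gen_le_Delta)

lemma le_simple: "x \<in> M \<Longrightarrow> x \<preceq> y \<Longrightarrow> y \<in> S \<Longrightarrow> x \<in> S"
  by (meson dv_trans simple_iff)

lemma gen_mul_C_le: assumes "s \<in> G" "t \<in> G" "x \<in> M" "gen R s \<preceq> x" "gen R t \<preceq> x"
  shows "cls R (s # C s t) \<preceq> x"
proof -
  obtain y where y: "y \<in> M" "x = gen R s \<odot> y" using assms by (auto elim: ldivE)
  then have "cls R (C s t) \<preceq> y" using gen_le_gen_mul[of t s y] assms by simp
  then show ?thesis unfolding cls_Cons y(2) using assms C_lists by (intro le_mulL) auto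
qed

lemma C_simple: assumes "s \<in> G" "t \<in> G" shows "cls R (C s t) \<preceq> \<Delta>"
proof -
  obtain a b v where ab: "a \<in> G" "b \<in> G" "v \<in> lists G" "C s t @ v = a # C a b"
    using C_prefix[OF assms] by blast
  have "cls R (a # C a b) \<preceq> \<Delta>" using ab gen_le_Delta by (intro gen_mul_C_le) auto
  moreover have "cls R (C s t) \<preceq> cls R (a # C a b)"
    unfolding ab(4)[symmetric] mmult_cls[symmetric] using ab C_lists assms by (intro le_mulR) auto
  ultimately show ?thesis using dv_trans C_lists[OF assms] by blast
qed

text \<open>Each generator \<open>t\<close> divides \<open>s\<close> times \<open>C s t\<close>, and
  \<open>C s t\<close> divides \<Delta>; so \<open>s\<close> times \<Delta> is a common multiple of
  all generators.\<close>

lemma Delta_le_gen_Delta: assumes "s \<in> G" shows "\<Delta> \<preceq> gen R s \<odot> \<Delta>"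
proof (rule Delta_le)
  show "gen R s \<odot> \<Delta> \<in> M" using assms by simp
  fix t assume t: "t \<in> G"
  have "cls R (C s t) \<in> M" "cls R (C t s) \<in> M" using C_lists t assms by auto
  then have "gen R t \<preceq> gen R s \<odot> cls R (C s t)" using t assms by (subst gen_mul_C) auto
  also have "gen R s \<odot> cls R (C s t) \<preceq> gen R s \<odot> \<Delta>"
    using C_simple t assms \<open>cls R (C s t) \<in> M\<close> by (intro le_mulL) auto
  finally (dv_trans[rotated 1]) show "gen R t \<preceq> gen R s \<odot> \<Delta>" using t by simp
qed

lemma mul_Delta: "x \<in> M \<Longrightarrow> \<exists>y\<in>M. x \<odot> \<Delta> = \<Delta> \<odot> y"
proof (induction x rule: M_induct)
  case unit
  then show ?case by (intro bexI[of _ \<one>]) simp_all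
next
  case (Cons s x)
  then obtain y where y: "y \<in> M" "x \<odot> \<Delta> = \<Delta> \<odot> y" by blast
  obtain z where z: "z \<in> M" "gen R s \<odot> \<Delta> = \<Delta> \<odot> z" using Delta_le_gen_Delta[OF Cons(1)] by (rule ldivE)
  have "gen R s \<odot> x \<odot> \<Delta> = gen R s \<odot> \<Delta> \<odot> y" using Cons y by (simp add: mul_assoc)
  also have "\<dots> = \<Delta> \<odot> (z \<odot> y)" using z y by (simp add: mul_assoc)
  finally show ?case using z y by blast
qed

text \<open>Simplicity is defined by left divisibility. For a right factor, write \<Delta> = x y w
  and x \<Delta> = \<Delta> z; cancelling x in x \<Delta> = x y w z leaves \<Delta> = y w z.\<close>

lemma simple_right: assumes "x \<in> M" "y \<in> M" "x \<odot> y \<in> S" shows "y \<in> S"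
proof -
  obtain w where w: "w \<in> M" "\<Delta> = x \<odot> y \<odot> w" using assms by (auto simp: simple_iff elim: ldivE)
  obtain z where z: "z \<in> M" "x \<odot> \<Delta> = \<Delta> \<odot> z" using mul_Delta assms by blast
  have "x \<odot> \<Delta> = x \<odot> (y \<odot> w \<odot> z)" using z w assms by (simp add: mul_assoc)
  then have "\<Delta> = y \<odot> w \<odot> z" using mul_cancel[of x \<Delta> "y \<odot> w \<odot> z"] assms w z by simp
  then have "y \<preceq> \<Delta>" using assms w z by (intro ldivI[of "w \<odot> z"]) (simp_all add: mul_assoc)
  then show ?thesis using assms by (simp add: simple_iff)
qed

lemma simple_left: "x \<in> M \<Longrightarrow> y \<in> M \<Longrightarrow> x \<odot> y \<in> S \<Longrightarrow> x \<in> S"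
  by (rule le_simple[of _ "x \<odot> y"]) simp_all

section \<open>The greatest simple left divisor\<close>

definition head where "head x = (THE d. d \<in> S \<and> d \<preceq> x \<and> (\<forall>d'\<in>S. d' \<preceq> x \<longrightarrow> d' \<preceq> d))"

lemma head_props: assumes "x \<in> M"
  shows "head x \<in> S \<and> head x \<preceq> x \<and> (\<forall>d'\<in>S. d' \<preceq> x \<longrightarrow> d' \<preceq> head x)"
proof -
  obtain z where z: "z \<in> M" "\<forall>p\<in>{d \<in> S. d \<preceq> x}. p \<preceq> z"
    "\<forall>m'\<in>M. (\<forall>p\<in>{d \<in> S. d \<preceq> x}. p \<preceq> m') \<longrightarrow> z \<preceq> m'"
  proof -
    have "{d \<in> S. d \<preceq> x} \<subseteq> M" "\<And>p. p \<in> {d \<in> S. d \<preceq> x} \<Longrightarrow> p \<preceq> x" by auto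
    from lub_exists[OF this(1) assms this(2)] show ?thesis using that by blast
  qed
  have "z \<preceq> \<Delta>" "z \<preceq> x"
    using z(3)[rule_format, of \<Delta>] z(3)[rule_format, of x] assms by (simp_all add: simple_iff)
  then have *: "z \<in> S \<and> z \<preceq> x \<and> (\<forall>d'\<in>S. d' \<preceq> x \<longrightarrow> d' \<preceq> z)" using z by (auto simp: simple_iff)
  show ?thesis unfolding head_def
  proof (rule theI[of _ z])
    show "z \<in> S \<and> z \<preceq> x \<and> (\<forall>d'\<in>S. d' \<preceq> x \<longrightarrow> d' \<preceq> z)" by (fact *)
  next
    fix d assume d: "d \<in> S \<and> d \<preceq> x \<and> (\<forall>d'\<in>S. d' \<preceq> x \<longrightarrow> d' \<preceq> d)"
    show "d = z" by (rule dv_antisym) (use d * in simp_all)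
  qed
qed

lemma head_simple [simp]: "x \<in> M \<Longrightarrow> head x \<in> S"
  and head_le: "x \<in> M \<Longrightarrow> head x \<preceq> x"
  and le_head: "x \<in> M \<Longrightarrow> d \<in> S \<Longrightarrow> d \<preceq> x \<Longrightarrow> d \<preceq> head x"
  using head_props by auto

definition tail where "tail x = (THE y. y \<in> M \<and> head x \<odot> y = x)"

lemma tail_props: assumes "x \<in> M" shows "tail x \<in> M \<and> head x \<odot> tail x = x"
proof -
  obtain y where y: "y \<in> M" "x = head x \<odot> y" using head_le[OF assms] by (rule ldivE)
  show ?thesis unfolding tail_def
  proof (rule theI[of _ y])
    show "y \<in> M \<and> head x \<odot> y = x" using y(1) y(2)[symmetric] by (rule conjI)
    fix z assume z: "z \<in> M \<and> head x \<odot> z = x"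
    have "head x \<odot> z = head x \<odot> y" using conjunct2[OF z] y(2) by (rule trans)
    then show "z = y" by (rule mul_cancel[rotated 3]) (simp_all add: assms y(1) conjunct1[OF z])
  qed
qed

lemma tail_in_M [simp]: "x \<in> M \<Longrightarrow> tail x \<in> M"
  and head_tail: "x \<in> M \<Longrightarrow> head x \<odot> tail x = x"
  using tail_props by auto

lemma tailI: "x \<in> M \<Longrightarrow> y \<in> M \<Longrightarrow> head x \<odot> y = x \<Longrightarrow> tail x = y"
  using mul_cancel[of "head x" "tail x" y] by (simp add: head_tail)

lemma head_unit [simp]: "head \<one> = \<one>"
  using head_le[of \<one>] by (intro le_unit) simp_all

lemma tail_unit [simp]: "tail \<one> = \<one>"
  by (rule tailI) simp_all

lemma head_eq_unit: assumes "x \<in> M" "head x = \<one>" shows "x = \<one>"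
proof (rule ccontr)
  assume "x \<noteq> \<one>"
  then obtain s y where s: "s \<in> G" "y \<in> M" "x = gen R s \<odot> y" using M_Cons assms by blast
  then have "gen R s \<preceq> head x" using assms by (intro le_head) simp_all
  then have "mlen (gen R s) \<le> mlen \<one>" using le_mlen s assms(2) by (metis gen_in_M)
  then show False by simp
qed

lemma mlen_tail: "x \<in> M \<Longrightarrow> x \<noteq> \<one> \<Longrightarrow> mlen (tail x) < mlen x"
proof -
  assume x: "x \<in> M" "x \<noteq> \<one>"
  then have "mlen (head x) \<noteq> 0" using head_eq_unit[of x] mlen_0[of "head x"] by auto
  moreover have "mlen x = mlen (head x) + mlen (tail x)"
    using x mlen_mul[of "head x" "tail x"] by (simp add: head_tail)
  ultimately show ?thesis by simp
qed

lemma arrow_unit [simp]: "x \<leadsto> \<one>"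
proof -
  have "Lset G R \<one> = {}"
    using le_mlen[of "gen R _" \<one>] by (auto simp: Lset_def)
  then show ?thesis by (simp add: arrow_def)
qed

lemma arrow_iff: "x \<leadsto> y \<longleftrightarrow> (\<forall>s\<in>G. gen R s \<preceq> y \<longrightarrow> x \<odot> gen R s \<notin> S)"
  by (auto simp: arrow_def Lset_def Rset_def)

lemma arrow_head_tail: assumes "x \<in> M" shows "head x \<leadsto> head (tail x)"
  unfolding arrow_iff
proof (intro ballI impI notI)
  fix s assume s: "s \<in> G" "gen R s \<preceq> head (tail x)" "head x \<odot> gen R s \<in> S"
  have "gen R s \<preceq> tail x" using s assms head_le by (meson dv_trans gen_in_M tail_in_M)
  then have "head x \<odot> gen R s \<preceq> head x \<odot> tail x" using s assms by (intro le_mulL) simp_all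
  then have "head x \<odot> gen R s \<preceq> head x" using assms s by (intro le_head) (simp_all add: head_tail)
  then have "mlen (head x \<odot> gen R s) \<le> mlen (head x)" using assms s by (intro le_mlen) simp_all
  then show False using assms s by simp
qed

text \<open>The arrow speaks only about generators, yet it pins down the whole first factor: an
  extension of \<open>a\<close> to a larger simple divisor of the product would continue with a
  generator that divides \<open>head y\<close>.\<close>

lemma head_mul: assumes "a \<in> S" "y \<in> M" "a \<leadsto> head y" shows "head (a \<odot> y) = a" "tail (a \<odot> y) = y"
proof -
  have a: "a \<in> M" using assms by simp
  have "a \<preceq> head (a \<odot> y)" using assms by (intro le_head) simp_all
  then obtain v where v: "v \<in> M" "head (a \<odot> y) = a \<odot> v" by (auto elim: ldivE)
  have "a \<odot> v \<preceq> a \<odot> y" using head_le[of "a \<odot> y"] v a assms by simp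
  then have vy: "v \<preceq> y" using le_cancel a v assms by blast
  have av: "a \<odot> v \<in> S" using head_simple[of "a \<odot> y"] v a assms by simp
  then have "v \<in> S" using simple_right a v by blast
  then have vh: "v \<preceq> head y" using le_head vy assms by blast
  have "v = \<one>"
  proof (rule ccontr)
    assume "v \<noteq> \<one>"
    then obtain s w where s: "s \<in> G" "w \<in> M" "v = gen R s \<odot> w" using M_Cons v by blast
    then have "gen R s \<preceq> v" by simp
    then have "gen R s \<preceq> head y" "a \<odot> gen R s \<preceq> a \<odot> v"
      using dv_trans[OF _ _ vh] s(1) v(1) a by (auto intro: le_mulL)
    then show False using assms(3) av s a le_simple[of "a \<odot> gen R s" "a \<odot> v"] by (simp add: arrow_iff)
  qed
  then show "head (a \<odot> y) = a" using v a by simp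
  then show "tail (a \<odot> y) = y" using a assms by (intro tailI) simp_all
qed

text \<open>In effect the left gcd of \<open>x\<close> and the \<open>m\<close>-th power of
  \<Delta>.\<close>

primrec factors_prod where
  "factors_prod 0 x = \<one>"
| "factors_prod (Suc m) x = head x \<odot> factors_prod m (tail x)"

text \<open>These sets stand in for the left divisors of the powers of \<Delta>.\<close>

primrec simple_products where
  "simple_products 0 = {\<one>}"
| "simple_products (Suc m) = {a \<odot> b | a b. a \<in> S \<and> b \<in> simple_products m}"

lemma simple_products_in_M [simp]: "x \<in> simple_products m \<Longrightarrow> x \<in> M"
  by (induction m arbitrary: x) auto

lemma factors_prod_in_M [simp]: "x \<in> M \<Longrightarrow> factors_prod m x \<in> M"
  by (induction m arbitrary: x) auto

lemma factors_prod_simple_products: "x \<in> M \<Longrightarrow> factors_prod m x \<in> simple_products m"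
proof (induction m arbitrary: x)
  case (Suc m)
  then have "head x \<in> S" "factors_prod m (tail x) \<in> simple_products m" by simp_all
  then show ?case by auto
qed simp

lemma factors_prod_le: "x \<in> M \<Longrightarrow> factors_prod m x \<preceq> x"
proof (induction m arbitrary: x)
  case (Suc m)
  then have "head x \<odot> factors_prod m (tail x) \<preceq> head x \<odot> tail x" by (intro le_mulL) simp_all
  then show ?case using Suc by (simp add: head_tail)
qed simp

lemma simple_lcm:
  assumes "a \<in> S" "b \<in> S" "m \<in> M" "a \<preceq> m" "b \<preceq> m"
  obtains v w where "v \<in> S" "w \<in> S" "a \<odot> v = b \<odot> w" "a \<odot> v \<preceq> m"
proof -
  obtain z where z: "z \<in> M" "a \<preceq> z" "b \<preceq> z" "z \<preceq> m" "z \<preceq> \<Delta>"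
    using lub_exists[of "{a, b}" m] assms by (auto simp: simple_iff)
  obtain v w where vw: "v \<in> M" "w \<in> M" "z = a \<odot> v" "z = b \<odot> w" using z(2,3) by (auto simp: ldiv_def)
  have "z \<in> S" using z by (simp add: simple_iff)
  then have "v \<in> S" "w \<in> S" using simple_right[of a v] simple_right[of b w] vw assms by auto
  then show ?thesis using that vw z by simp
qed

text \<open>The two halves support each other: maximality at level \<open>m\<close> uses the second statement at
  level \<open>m - 1\<close>, and the second statement uses maximality at the same level.\<close>

lemma factors_prod_greatest_aux:
  "(\<forall>x\<in>simple_products m. \<forall>y\<in>M. x \<preceq> y \<longrightarrow> x \<preceq> factors_prod m y) \<and>
   (\<forall>u\<in>S. \<forall>x\<in>simple_products m. \<forall>y\<in>M. x \<preceq> u \<odot> y \<longrightarrow> x \<preceq> u \<odot> factors_prod m y)"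
proof (induction m)
  case 0
  then show ?case by simp
next
  case (Suc m)
  have max: "x \<preceq> factors_prod (Suc m) y" if *: "x \<in> simple_products (Suc m)" "y \<in> M" "x \<preceq> y" for x y
  proof -
    obtain a b where ab: "x = a \<odot> b" "a \<in> S" "b \<in> simple_products m" using *(1) by auto
    have M: "a \<in> M" "b \<in> M" using ab by simp_all
    have "a \<preceq> y" using * ab M by (metis dv_trans le_mulR)
    then have "a \<preceq> head y" using le_head * ab by blast
    then obtain u where u: "u \<in> M" "head y = a \<odot> u" by (auto elim: ldivE)
    have uS: "u \<in> S" using simple_right[of a u] u M * head_simple[of y] by simp
    have "a \<odot> (u \<odot> tail y) = y" using head_tail[of y] * u M by (simp add: mul_assoc)
    then have "a \<odot> b \<preceq> a \<odot> (u \<odot> tail y)" using * ab by simp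
    then have "b \<preceq> u \<odot> tail y" using le_cancel[of a b "u \<odot> tail y"] M u(1) *(2) by simp
    then have "b \<preceq> u \<odot> factors_prod m (tail y)" using Suc.IH uS ab * by simp
    then have "a \<odot> b \<preceq> a \<odot> (u \<odot> factors_prod m (tail y))" using M by (intro le_mulL) simp_all
    then show ?thesis using u M * ab by (simp add: mul_assoc)
  qed
  have "x \<preceq> u \<odot> factors_prod (Suc m) y"
    if *: "u \<in> S" "x \<in> simple_products (Suc m)" "y \<in> M" "x \<preceq> u \<odot> y" for u x y
  proof -
    obtain a b where ab: "x = a \<odot> b" "a \<in> S" "b \<in> simple_products m" using *(2) by auto
    have M: "a \<in> M" "b \<in> M" "u \<in> M" using ab * by simp_all
    have "a \<preceq> u \<odot> y" using * ab M by (metis dv_trans le_mulR)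
    then obtain v w where vw: "v \<in> S" "w \<in> S" "u \<odot> v = a \<odot> w" "u \<odot> v \<preceq> u \<odot> y"
      using simple_lcm[of u a "u \<odot> y"] * ab M by auto
    have vwM: "v \<in> M" "w \<in> M" using vw by simp_all
    have "v \<preceq> y" using vw(4) le_cancel M vwM * by blast
    then obtain z where z: "z \<in> M" "y = v \<odot> z" by (auto elim: ldivE)
    have "u \<odot> y = a \<odot> (w \<odot> z)" using z vw M vwM by (metis mul_assoc)
    then have "a \<odot> b \<preceq> a \<odot> (w \<odot> z)" using * ab by simp
    then have "b \<preceq> w \<odot> z" using le_cancel[of a b "w \<odot> z"] M vwM z(1) by simp
    then have "b \<preceq> w \<odot> factors_prod m z" using Suc.IH vw ab z by simp
    then have "a \<odot> b \<preceq> a \<odot> (w \<odot> factors_prod m z)" using M by (intro le_mulL) simp_all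
    also have "a \<odot> (w \<odot> factors_prod m z) = u \<odot> (v \<odot> factors_prod m z)"
      using vw M vwM z by (metis factors_prod_in_M mul_assoc)
    finally have 1: "x \<preceq> u \<odot> (v \<odot> factors_prod m z)" using ab by simp
    have "v \<odot> factors_prod m z \<preceq> y" using z vwM factors_prod_le by (simp add: le_mulL)
    moreover have "v \<odot> factors_prod m z \<in> simple_products (Suc m)"
      using vw factors_prod_simple_products[OF z(1)] by auto
    ultimately have "v \<odot> factors_prod m z \<preceq> factors_prod (Suc m) y" using max * by blast
    then have "u \<odot> (v \<odot> factors_prod m z) \<preceq> u \<odot> factors_prod (Suc m) y"
      using M vwM z by (intro le_mulL) simp_all
    then show ?thesis using 1 dv_trans[of x] * by simp
  qed
  with max show ?case by blast
qed

lemma le_factors_prod: "x \<in> simple_products m \<Longrightarrow> y \<in> M \<Longrightarrow> x \<preceq> y \<Longrightarrow> x \<preceq> factors_prod m y"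
  using factors_prod_greatest_aux by blast

lemma le_factors_prod_iff: "x \<in> simple_products m \<Longrightarrow> y \<in> M \<Longrightarrow> x \<preceq> factors_prod m y \<longleftrightarrow> x \<preceq> y"
  by (meson dv_trans factors_prod_le le_factors_prod simple_products_in_M)

text \<open>The normal form as an infinite sequence padded with units. Iterating \<open>tail\<close>
  makes it available before existence and uniqueness of the finite list; it turns out to be
  \<open>emb G R x\<close>.\<close>

definition fac where "fac x k = head ((tail ^^ k) x)"

lemma fac_0 [simp]: "fac x 0 = head x"
  by (simp add: fac_def)

lemma fac_Suc [simp]: "fac x (Suc k) = fac (tail x) k"
  by (simp only: fac_def funpow_Suc_right o_apply)

lemma tail_pow_in_M [simp]: "x \<in> M \<Longrightarrow> (tail ^^ k) x \<in> M"
  by (induction k) auto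

lemma fac_in_Mbar: "x \<in> M \<Longrightarrow> fac x \<in> Mbar G R"
  unfolding Mbar_def fac_def by (auto simp: arrow_head_tail)

lemma fac_unit [simp]: "fac \<one> k = \<one>"
  by (induction k) auto

lemma fac_foldr:
  assumes "set xs \<subseteq> S" "\<And>i. Suc i < length xs \<Longrightarrow> xs ! i \<leadsto> xs ! Suc i"
  shows "foldr (mmult R) xs \<one> \<in> M \<and> (\<forall>k. fac (foldr (mmult R) xs \<one>) k = (if k < length xs then xs ! k else \<one>))"
  using assms
proof (induction xs)
  case (Cons a xs)
  let ?y = "foldr (mmult R) xs \<one>"
  have a: "a \<in> S" using Cons by simp
  have IH: "?y \<in> M" "\<And>k. fac ?y k = (if k < length xs then xs ! k else \<one>)"
    using Cons.IH Cons.prems(1) Cons.prems(2)[of "Suc _"] by auto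
  have "a \<leadsto> head ?y"
    using IH(2)[of 0] Cons.prems(2)[of 0] by (cases xs) auto
  note h = head_mul[OF a IH(1) this]
  have "fac (a \<odot> ?y) k = (if k < length (a # xs) then (a # xs) ! k else \<one>)" for k
    using h IH by (cases k) auto
  then show ?case using a IH by simp
qed simp

lemma is_nf_exists: "x \<in> M \<Longrightarrow> x \<noteq> \<one> \<Longrightarrow> \<exists>xs. is_nf G R x xs \<and> hd xs = head x"
proof (induction "mlen x" arbitrary: x rule: less_induct)
  case less
  have h1: "head x \<noteq> \<one>" using head_eq_unit less by blast
  have x: "head x \<odot> tail x = x" using head_tail less by blast
  have hS: "head x \<in> S" using less by simp
  show ?case
  proof (cases "tail x = \<one>")
    case True
    then have "head x = x" using x hS by simp
    then show ?thesis using h1 hS less.prems by (intro exI[of _ "[x]"]) (simp add: is_nf_def)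
  next
    case False
    then obtain xs where xs: "is_nf G R (tail x) xs" "hd xs = head (tail x)"
      using less mlen_tail by (metis tail_in_M)
    have "is_nf G R x (head x # xs)"
      unfolding is_nf_def
    proof (intro conjI allI impI)
      show "head x # xs \<noteq> []" by simp
      show "set (head x # xs) \<subseteq> S" "\<one> \<notin> set (head x # xs)" "foldr (mmult R) (head x # xs) \<one> = x"
        using xs hS h1 x by (simp_all add: is_nf_def)
      fix i assume "Suc i < length (head x # xs)"
      then show "(head x # xs) ! i \<leadsto> (head x # xs) ! Suc i"
        using xs arrow_head_tail[OF less.prems(1)] by (cases i) (auto simp: is_nf_def hd_conv_nth)
    qed
    then show ?thesis by auto
  qed
qed

lemma is_nf_fac:
  assumes "is_nf G R x xs" shows "fac x k = (if k < length xs then xs ! k else \<one>)"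
  using fac_foldr[of xs] assms by (auto simp: is_nf_def)

text \<open>Both lists are initial parts of the sequence \<open>fac x\<close>, and their lengths
  agree because a normal form does not contain the unit, the padding value of
  \<open>fac\<close>.\<close>

lemma is_nf_unique:
  assumes "is_nf G R x xs" "is_nf G R x ys" shows "xs = ys"
proof (rule nth_equalityI)
  have *: "length as \<le> length bs" if "is_nf G R x as" "is_nf G R x bs" for as bs
  proof (rule ccontr)
    assume "\<not> length as \<le> length bs"
    then have "as ! length bs = \<one>"
      using is_nf_fac[OF that(1), of "length bs"] is_nf_fac[OF that(2), of "length bs"] by simp
    then show False using that(1) \<open>\<not> length as \<le> length bs\<close> by (metis is_nf_def not_le nth_mem)
  qed
  then show "length xs = length ys" using assms by (meson order_antisym)
  then show "xs ! i = ys ! i" if "i < length xs" for i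
    using is_nf_fac[OF assms(1), of i] is_nf_fac[OF assms(2), of i] that by simp
qed

lemma emb_eq_fac: assumes "x \<in> M" shows "emb G R x = fac x"
proof (cases "x = \<one>")
  case True
  then show ?thesis by (auto simp: emb_def nf_def fun_eq_iff)
next
  case False
  then obtain xs where "is_nf G R x xs" using is_nf_exists assms by blast
  then have "nf G R x = xs" using False is_nf_unique by (auto simp: nf_def)
  then show ?thesis using is_nf_fac[OF \<open>is_nf G R x xs\<close>] by (simp add: emb_def fun_eq_iff)
qed

primrec prefix_prod where
  "prefix_prod \<xi> 0 = \<one>"
| "prefix_prod \<xi> (Suc m) = \<xi> 0 \<odot> prefix_prod (\<lambda>k. \<xi> (Suc k)) m"

lemma factors_prod_eq: "factors_prod m x = prefix_prod (fac x) m"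
  by (induction m arbitrary: x) auto

lemma Mbar_shift: "\<xi> \<in> Mbar G R \<Longrightarrow> (\<lambda>k. \<xi> (Suc k)) \<in> Mbar G R"
  by (simp add: Mbar_def)

lemma Mbar_simple: "\<xi> \<in> Mbar G R \<Longrightarrow> \<xi> k \<in> S"
  by (simp add: Mbar_def)

lemma prefix_prod_simple_products: "\<xi> \<in> Mbar G R \<Longrightarrow> prefix_prod \<xi> m \<in> simple_products m"
proof (induction m arbitrary: \<xi>)
  case (Suc m)
  then have "\<xi> 0 \<in> S" "prefix_prod (\<lambda>k. \<xi> (Suc k)) m \<in> simple_products m"
    using Mbar_shift Mbar_simple by auto
  then show ?case by auto
qed simp

lemma prefix_prod_in_M [simp]: "\<xi> \<in> Mbar G R \<Longrightarrow> prefix_prod \<xi> m \<in> M"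
  using prefix_prod_simple_products simple_products_in_M by blast

text \<open>Every element has an arrow to the unit, so a path cut off after \<open>m\<close> steps
  and continued by units is still a path, and hence the normal form of its product.\<close>

lemma fac_prefix_prod: "\<xi> \<in> Mbar G R \<Longrightarrow> fac (prefix_prod \<xi> m) k = (if k < m then \<xi> k else \<one>)"
proof (induction m arbitrary: \<xi> k)
  case (Suc m)
  let ?y = "prefix_prod (\<lambda>k. \<xi> (Suc k)) m"
  note sh = Mbar_shift[OF Suc.prems]
  have y: "?y \<in> M" using sh by simp
  have "\<xi> 0 \<leadsto> head ?y"
    using Suc.IH[OF sh, of 0] Suc.prems by (cases m) (auto simp: Mbar_def)
  note h = head_mul[OF Mbar_simple[OF Suc.prems] y this]
  show ?case using h Suc.IH[OF sh] by (cases k) auto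
qed simp

lemma prefix_prod_mono: "\<xi> \<in> Mbar G R \<Longrightarrow> prefix_prod \<xi> m \<preceq> prefix_prod \<xi> (m + j)"
proof (induction m arbitrary: \<xi>)
  case (Suc m)
  then show ?case using Mbar_shift[OF Suc.prems] Mbar_simple[OF Suc.prems, of 0] by (simp add: le_mulL)
qed simp

lemma simple_products_prefix: "x \<in> M \<Longrightarrow> \<exists>m. x \<in> simple_products m"
proof (induction x rule: M_induct)
  case unit
  then show ?case by (intro exI[of _ 0]) simp
next
  case (Cons s y)
  then obtain m where "y \<in> simple_products m" by blast
  then have "gen R s \<odot> y \<in> simple_products (Suc m)"
    using gen_simple[OF Cons(1)] unfolding simple_products.simps by blast
  then show ?case by blast
qed

end

subsection \<open>Averaging with delays\<close>

text \<open>A minimum principle: every later value is an average of values at most \<open>D\<close>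
  steps back, so a bound on one window of length \<open>D\<close> propagates.\<close>

lemma delayed_average_lower_bound:
  fixes a :: "'s \<Rightarrow> nat \<Rightarrow> real"
  assumes d: "\<And>y. y \<in> S \<Longrightarrow> 1 \<le> d y \<and> d y \<le> D"
    and P0: "\<And>y z. y \<in> S \<Longrightarrow> z \<in> S \<Longrightarrow> 0 \<le> P y z" and P1: "\<And>y. y \<in> S \<Longrightarrow> (\<Sum>z\<in>S. P y z) = 1"
    and rec: "\<And>y k. y \<in> S \<Longrightarrow> k \<ge> K0 \<Longrightarrow> a y (k + d y) = (\<Sum>z\<in>S. P y z * a z k)"
    and K: "K0 \<le> K" and m: "\<And>y k. y \<in> S \<Longrightarrow> K \<le> k \<Longrightarrow> k < K + D \<Longrightarrow> m \<le> a y k"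
    and "y \<in> S" "K \<le> k"
  shows "m \<le> a y k"
  using assms(7,8)
proof (induction k arbitrary: y rule: less_induct)
  case (less k)
  show ?case
  proof (cases "k < K + D")
    case False
    define j where "j = k - d y"
    have j: "k = j + d y" "j < k" "K \<le> j" using d[OF less.prems(1)] False by (auto simp: j_def)
    have "m = (\<Sum>z\<in>S. P y z * m)" using P1[OF less.prems(1)] by (simp add: sum_distrib_right[symmetric])
    also have "\<dots> \<le> (\<Sum>z\<in>S. P y z * a z j)"
      using less j P0 by (intro sum_mono mult_left_mono) auto
    also have "\<dots> = a y k" using rec[OF less.prems(1), of j] j K by simp
    finally show ?thesis .
  qed (use m less in auto)
qed

text \<open>Quantitative irreducibility: the excess of \<open>s0\<close> over the minimum at the
  single time \<open>K\<close> is felt by all states at all times from \<open>K + N\<close> on.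
  Paths to \<open>s0\<close> have various delays, but the loop of delay 1 lets the excess wait at
  \<open>s0\<close> for any number of steps, which removes periodicity. \<open>N\<close> and
  \<open>e\<close> are chosen before \<open>a\<close>, \<open>K\<close>, \<open>m\<close>, so that
  the estimate can be iterated.\<close>

lemma delayed_average_pull:
  fixes P :: "'s \<Rightarrow> 's \<Rightarrow> real" and d :: "'s \<Rightarrow> nat"
  assumes fin: "finite S" and s0: "s0 \<in> S"
    and d: "\<And>y. y \<in> S \<Longrightarrow> 1 \<le> d y \<and> d y \<le> D"
    and P0: "\<And>y z. y \<in> S \<Longrightarrow> z \<in> S \<Longrightarrow> 0 \<le> P y z" and P1: "\<And>y. y \<in> S \<Longrightarrow> (\<Sum>z\<in>S. P y z) = 1"
    and loop: "d s0 = 1" "P s0 s0 > 0"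
    and reach: "\<And>y. y \<in> S \<Longrightarrow> (y, s0) \<in> {(y, z). y \<in> S \<and> z \<in> S \<and> P y z > 0}\<^sup>*"
  shows "\<exists>N e. 0 < e \<and> e \<le> 1 \<and> (\<forall>a K m.
    (\<forall>y\<in>S. \<forall>k\<ge>K. a y (k + d y) = (\<Sum>z\<in>S. P y z * a z k)) \<longrightarrow> (\<forall>y\<in>S. \<forall>k\<ge>K. m \<le> a y k) \<longrightarrow>
    (\<forall>y\<in>S. \<forall>k\<ge>K + N. m + e * (a s0 K - m) \<le> a y k))"
proof -
  define good where "good a K m \<longleftrightarrow> (\<forall>y\<in>S. \<forall>k\<ge>K. a y (k + d y) = (\<Sum>z\<in>S. P y z * a z k)) \<and>
     (\<forall>y\<in>S. \<forall>k\<ge>K. m \<le> a y k)" for a :: "'s \<Rightarrow> nat \<Rightarrow> real" and K m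
  have one: "P y z * (a z k - m) \<le> a y (k + d y) - m"
    if *: "good a K m" "y \<in> S" "z \<in> S" "K \<le> k" for a K m y z k
  proof -
    have "P y z * (a z k - m) \<le> (\<Sum>w\<in>S. P y w * (a w k - m))"
      using * P0 fin by (intro member_le_sum) (auto simp: good_def)
    also have "\<dots> = (\<Sum>w\<in>S. P y w * a w k) - (\<Sum>w\<in>S. P y w) * m"
      by (simp add: right_diff_distrib sum_subtractf sum_distrib_right)
    also have "\<dots> = a y (k + d y) - m" using * P1 by (simp add: good_def)
    finally show ?thesis .
  qed
  have path: "\<exists>n e. 0 < e \<and> (\<forall>a K m k. good a K m \<longrightarrow> K \<le> k \<longrightarrow> e * (a s0 k - m) \<le> a y (k + n) - m)"
    if "y \<in> S" for y
    using reach[OF that]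
  proof (induction rule: converse_rtrancl_induct)
    case base
    show ?case by (rule exI[of _ 0], rule exI[of _ 1]) auto
  next
    case (step y z)
    then obtain n e where e: "0 < e" "\<And>a K m k. good a K m \<Longrightarrow> K \<le> k \<Longrightarrow> e * (a s0 k - m) \<le> a z (k + n) - m"
      by blast
    have yz: "y \<in> S" "z \<in> S" "P y z > 0" using step by auto
    have "(P y z * e) * (a s0 k - m) \<le> a y (k + (n + d y)) - m" if *: "good a K m" "K \<le> k" for a K m k
    proof -
      have "P y z * (e * (a s0 k - m)) \<le> P y z * (a z (k + n) - m)"
        using e(2)[OF *] yz by (intro mult_left_mono) auto
      also have "\<dots> \<le> a y (k + n + d y) - m" using * yz by (intro one) auto
      finally show ?thesis by (simp add: algebra_simps)
    qed
    then show ?case using e(1) yz by (intro exI[of _ "n + d y"] exI[of _ "P y z * e"]) auto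
  qed
  obtain n e where ne: "\<And>y. y \<in> S \<Longrightarrow> 0 < e y"
    "\<And>y a K m k. y \<in> S \<Longrightarrow> good a K m \<Longrightarrow> K \<le> k \<Longrightarrow> e y * (a s0 k - m) \<le> a y (k + n y) - m"
    using path by metis
  define p where "p = P s0 s0"
  have p: "0 < p" "p \<le> 1"
    using loop member_le_sum[of s0 S "P s0"] P0 P1 s0 fin by (auto simp: p_def)
  have loops: "p ^ i * (a s0 K - m) \<le> a s0 (K + i) - m" if *: "good a K m" for a K m i
  proof (induction i)
    case (Suc i)
    have "p * (p ^ i * (a s0 K - m)) \<le> p * (a s0 (K + i) - m)" using Suc p by (intro mult_left_mono) auto
    also have "\<dots> \<le> a s0 (K + i + d s0) - m" unfolding p_def using * s0 by (intro one) auto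
    finally show ?case using loop by simp
  qed simp
  define N where "N = (\<Sum>y\<in>S. n y)"
  define e0 where "e0 = Min (e ` S)"
  \<comment> \<open>\<open>e0\<close> is the worst loss along a path to \<open>s0\<close>, and
    \<open>p ^ (N + D)\<close> the worst loss from waiting there. The cap at 1 keeps
    \<open>1 - e / 2\<close> a contraction factor later on.\<close>
  define ee where "ee = min 1 (e0 * p ^ (N + D))"
  have "e ` S \<noteq> {}" using s0 by auto
  then have e0: "0 < e0" "\<And>y. y \<in> S \<Longrightarrow> e0 \<le> e y" using ne(1) fin by (auto simp: e0_def)
  have nN: "n y \<le> N" if "y \<in> S" for y using member_le_sum[of y S n] that fin by (simp add: N_def)
  have win: "m + ee * (a s0 K - m) \<le> a y (K + j)"
    if *: "good a K m" "y \<in> S" "N \<le> j" "j < N + D" for a K m y j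
  proof -
    \<comment> \<open>The number of rounds in the loop after which the path of delay
      \<open>n y\<close> arrives exactly at time \<open>K + j\<close>.\<close>
    define i where "i = j - n y"
    have i: "j = i + n y" "i \<le> N + D" using nN[OF *(2)] * by (auto simp: i_def)
    have nn: "0 \<le> a s0 K - m" using * s0 by (auto simp: good_def)
    have "ee * (a s0 K - m) \<le> (e y * p ^ i) * (a s0 K - m)"
    proof (rule mult_right_mono[OF _ nn])
      have "ee \<le> e0 * p ^ (N + D)" by (simp add: ee_def)
      also have "\<dots> \<le> e y * p ^ i"
        using e0 ne(1) * p i by (intro mult_mono power_decreasing) (auto intro: less_imp_le)
      finally show "ee \<le> e y * p ^ i" .
    qed
    also have "\<dots> \<le> e y * (a s0 (K + i) - m)"
      using loops[OF *(1), of i] ne(1)[OF *(2)] by (simp add: mult.assoc)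
    also have "\<dots> \<le> a y (K + i + n y) - m" using * by (intro ne(2)) auto
    finally show ?thesis using i by (simp add: algebra_simps)
  qed
  show ?thesis
  proof (rule exI[of _ N], rule exI[of _ ee], intro conjI allI impI ballI)
    show "0 < ee" "ee \<le> 1" using e0 p by (auto simp: ee_def)
    fix a :: "'s \<Rightarrow> nat \<Rightarrow> real" and K m y k
    assume *: "\<forall>y\<in>S. \<forall>k\<ge>K. a y (k + d y) = (\<Sum>z\<in>S. P y z * a z k)" "\<forall>y\<in>S. \<forall>k\<ge>K. m \<le> a y k"
      "y \<in> S" "K + N \<le> k"
    then have g: "good a K m" by (simp add: good_def)
    show "m + ee * (a s0 K - m) \<le> a y k"
    proof (rule delayed_average_lower_bound[where S = S and d = d and D = D and P = P and ?K0.0 = K and K = "K + N"])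
      fix y k assume y: "y \<in> S" "K + N \<le> k" "k < K + N + D"
      show "m + ee * (a s0 K - m) \<le> a y k" using win[OF g y(1), of "k - K"] y by simp
    qed (use * d P0 P1 in auto)
  qed
qed

text \<open>The range of values shrinks by the factor \<open>1 - e / 2\<close> every
  \<open>N\<close> steps: if the value at \<open>s0\<close> is in the upper half of the current
  range, the minimum is pulled up; otherwise the same estimate for the negated sequence pulls the
  maximum down. The limit is positive because the minimum over the first window already is.\<close>

lemma delayed_average_converges:
  fixes a :: "'s \<Rightarrow> nat \<Rightarrow> real"
  assumes fin: "finite S" and s0: "s0 \<in> S"
    and d: "\<And>y. y \<in> S \<Longrightarrow> 1 \<le> d y \<and> d y \<le> D"
    and P0: "\<And>y z. y \<in> S \<Longrightarrow> z \<in> S \<Longrightarrow> 0 \<le> P y z" and P1: "\<And>y. y \<in> S \<Longrightarrow> (\<Sum>z\<in>S. P y z) = 1"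
    and rec: "\<And>y k. y \<in> S \<Longrightarrow> k \<ge> K0 \<Longrightarrow> a y (k + d y) = (\<Sum>z\<in>S. P y z * a z k)"
    and loop: "d s0 = 1" "P s0 s0 > 0"
    and reach: "\<And>y. y \<in> S \<Longrightarrow> (y, s0) \<in> {(y, z). y \<in> S \<and> z \<in> S \<and> P y z > 0}\<^sup>*"
    and pos: "\<And>y k. y \<in> S \<Longrightarrow> k \<ge> K0 \<Longrightarrow> 0 < a y k"
  shows "\<exists>L>0. \<forall>y\<in>S. a y \<longlonglongrightarrow> L"
proof -
  have "\<exists>N e. 0 < e \<and> e \<le> 1 \<and> (\<forall>a K m.
    (\<forall>y\<in>S. \<forall>k\<ge>K. a y (k + d y) = (\<Sum>z\<in>S. P y z * a z k)) \<longrightarrow> (\<forall>y\<in>S. \<forall>k\<ge>K. m \<le> a y k) \<longrightarrow>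
    (\<forall>y\<in>S. \<forall>k\<ge>K + N. m + e * (a s0 K - m) \<le> a y k))"
    by (rule delayed_average_pull[where D = D]) (fact fin s0 d P0 P1 loop reach)+
  then obtain N e where e: "0 < e" "e \<le> 1" and pull: "\<And>a K m y k.
    (\<forall>y\<in>S. \<forall>k\<ge>K. a y (k + d y) = (\<Sum>z\<in>S. P y z * a z k)) \<Longrightarrow> (\<forall>y\<in>S. \<forall>k\<ge>K. m \<le> a y k) \<Longrightarrow>
    y \<in> S \<Longrightarrow> k \<ge> K + N \<Longrightarrow> m + e * (a s0 K - m) \<le> a y k"
    by (elim exE conjE) blast
  define W where "W = (\<lambda>(y, k). a y k) ` (S \<times> {K0..<K0 + D})"
  have D: "1 \<le> D" using d[OF s0] by simp
  have W: "finite W" "W \<noteq> {}" using fin s0 D by (auto simp: W_def)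
  have Wle: "Min W \<le> a y k" "a y k \<le> Max W" if "y \<in> S" "K0 \<le> k" "k < K0 + D" for y k
    using that W by (auto simp: W_def intro!: Min_le Max_ge)
  have rec': "- a y (k + d y) = (\<Sum>z\<in>S. P y z * - a z k)" if "y \<in> S" "k \<ge> K0" for y k
    using rec[OF that] by (simp add: sum_negf)
  have lo: "Min W \<le> a y k" if "y \<in> S" "K0 \<le> k" for y k
    by (rule delayed_average_lower_bound[where S = S and d = d and D = D and P = P and ?K0.0 = K0 and K = K0])
      (use that d P0 P1 rec Wle in auto)
  have hi: "- Max W \<le> - a y k" if "y \<in> S" "K0 \<le> k" for y k
    by (rule delayed_average_lower_bound[where S = S and d = d and D = D and P = P and ?K0.0 = K0 and K = K0
          and a = "\<lambda>y k. - a y k"])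
      (use that d P0 P1 rec' Wle in auto)
  have osc: "\<exists>m M. M - m \<le> (Max W - Min W) * (1 - e / 2) ^ i \<and>
    (\<forall>y\<in>S. \<forall>k\<ge>K0 + i * N. m \<le> a y k \<and> a y k \<le> M)" for i
  proof (induction i)
    case 0
    show ?case using lo hi by (intro exI[of _ "Min W"] exI[of _ "Max W"]) auto
  next
    case (Suc i)
    define K where "K = K0 + i * N"
    obtain m M where mM: "M - m \<le> (Max W - Min W) * (1 - e / 2) ^ i"
      "\<And>y k. y \<in> S \<Longrightarrow> k \<ge> K \<Longrightarrow> m \<le> a y k \<and> a y k \<le> M"
      using Suc by (auto simp: K_def)
    have K: "K0 + Suc i * N = K + N" "K0 \<le> K" by (auto simp: K_def)
    define b where "b = a s0 K"
    have b: "m \<le> b" "b \<le> M" using mM s0 by (auto simp: b_def)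
    have 1: "m + e * (b - m) \<le> a y k" if "y \<in> S" "k \<ge> K + N" for y k
      unfolding b_def using rec mM K that by (intro pull) auto
    have "- M + e * ((- b) - (- M)) \<le> - a y k" if "y \<in> S" "k \<ge> K + N" for y k
      unfolding b_def using rec' mM K that by (intro pull[of K "\<lambda>y k. - a y k"]) auto
    then have 2: "a y k \<le> M - e * (M - b)" if "y \<in> S" "k \<ge> K + N" for y k
      using that by (fastforce simp: algebra_simps)
    have shrink: "(M - m) * (1 - e / 2) \<le> (Max W - Min W) * (1 - e / 2) ^ Suc i"
      using mult_right_mono[OF mM(1), of "1 - e / 2"] e by (simp add: mult.assoc mult.commute)
    show ?case
    proof (cases "(M + m) / 2 \<le> b")
      case True
      have "M - (m + e * (b - m)) \<le> (M - m) * (1 - e / 2)"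
        using mult_left_mono[of "(M - m) / 2" "b - m" e] True e by (simp add: field_simps)
      then show ?thesis using 1 mM(2) shrink K
        by (intro exI[of _ "m + e * (b - m)"] exI[of _ M]) auto
    next
      case False
      have "M - e * (M - b) - m \<le> (M - m) * (1 - e / 2)"
        using mult_left_mono[of "(M - m) / 2" "M - b" e] False e by (simp add: field_simps)
      then show ?thesis using 2 mM(2) shrink K
        by (intro exI[of _ m] exI[of _ "M - e * (M - b)"]) auto
    qed
  qed
  have small: "\<exists>K. \<forall>y\<in>S. \<forall>z\<in>S. \<forall>k\<ge>K. \<forall>l\<ge>K. \<bar>a y k - a z l\<bar> < \<epsilon>" if "\<epsilon> > 0" for \<epsilon>
  proof -
    have "(\<lambda>i. (Max W - Min W) * (1 - e / 2) ^ i) \<longlonglongrightarrow> (Max W - Min W) * 0"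
      using e by (intro tendsto_intros LIMSEQ_power_zero) auto
    then have "\<forall>\<^sub>F i in sequentially. (Max W - Min W) * (1 - e / 2) ^ i < \<epsilon>"
      using that by (simp add: order_tendsto_iff)
    then obtain i where i: "(Max W - Min W) * (1 - e / 2) ^ i < \<epsilon>" by (auto simp: eventually_sequentially)
    obtain m M where mM: "M - m < \<epsilon>" "\<And>y k. y \<in> S \<Longrightarrow> k \<ge> K0 + i * N \<Longrightarrow> m \<le> a y k \<and> a y k \<le> M"
      using osc[of i] i by force
    show ?thesis
    proof (intro exI[of _ "K0 + i * N"] ballI allI impI)
      fix y z k l assume "y \<in> S" "z \<in> S" "K0 + i * N \<le> k" "K0 + i * N \<le> l"
      then show "\<bar>a y k - a z l\<bar> < \<epsilon>" using mM(1) mM(2)[of y k] mM(2)[of z l] by linarith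
    qed
  qed
  have "Cauchy (a s0)"
    unfolding Cauchy_def dist_real_def using small s0 by meson
  then obtain L where L: "a s0 \<longlonglongrightarrow> L" by (auto simp: Cauchy_convergent_iff convergent_def)
  have "a y \<longlonglongrightarrow> L" if "y \<in> S" for y
  proof -
    have "(\<lambda>k. a y k - a s0 k) \<longlonglongrightarrow> 0"
    proof (rule LIMSEQ_I)
      fix \<epsilon> :: real assume "0 < \<epsilon>"
      from small[OF this] obtain K where
        K: "\<forall>y\<in>S. \<forall>z\<in>S. \<forall>k\<ge>K. \<forall>l\<ge>K. \<bar>a y k - a z l\<bar> < \<epsilon>" by blast
      show "\<exists>no. \<forall>n\<ge>no. norm (a y n - a s0 n - 0) < \<epsilon>"
        using K that s0 by (intro exI[of _ K]) simp
    qed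
    from tendsto_add[OF this L] show ?thesis by simp
  qed
  moreover have "Min W \<le> L" using L lo s0 by (intro LIMSEQ_le_const) auto
  moreover have "0 < Min W" using W pos by (auto simp: W_def)
  ultimately show ?thesis by (intro exI[of _ L]) auto
qed

subsection \<open>Growth series\<close>

definition cnt :: "'g list set set \<Rightarrow> nat \<Rightarrow> nat" where
  "cnt A k = card {x \<in> A. mlen x = k}"

definition gf :: "'g list set set \<Rightarrow> real \<Rightarrow> real" where
  "gf A t = (\<Sum>k. real (cnt A k) * t ^ k)"

context graded_presentation
begin

abbreviation q where "q \<equiv> qrad G R"

lemma finite_level [simp]: "A \<subseteq> M \<Longrightarrow> finite {x \<in> A. mlen x = k}"
  by (rule finite_subset[OF _ finite_ball[of k]]) auto

lemma cnt_mono: "A \<subseteq> B \<Longrightarrow> B \<subseteq> M \<Longrightarrow> cnt A k \<le> cnt B k"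
  unfolding cnt_def by (intro card_mono) auto

lemma cnt_UN:
  assumes "finite I" "\<And>i. i \<in> I \<Longrightarrow> A i \<subseteq> M" "disjoint_family_on A I"
  shows "cnt (\<Union>i\<in>I. A i) k = (\<Sum>i\<in>I. cnt (A i) k)"
proof -
  have "{x \<in> \<Union>i\<in>I. A i. mlen x = k} = (\<Union>i\<in>I. {x \<in> A i. mlen x = k})" by auto
  then show ?thesis unfolding cnt_def using assms
    by (simp, subst card_UN_disjoint) (auto simp: disjoint_family_on_def)
qed

section \<open>Submultiplicativity and the radius of convergence\<close>

lemma gen_power_length: "s \<in> G \<Longrightarrow> cls R (replicate k s) \<in> {x \<in> M. mlen x = k}"
  by (auto simp: mlen_cls)

lemma cnt_M_pos: "1 \<le> cnt M k"
proof -
  obtain s where "s \<in> G" using G_nonempty by blast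
  then have "{x \<in> M. mlen x = k} \<noteq> {}" using gen_power_length by blast
  then show ?thesis unfolding cnt_def by (simp add: Suc_le_eq card_gt_0_iff)
qed

lemma cnt_M_submult: "cnt M (j + k) \<le> cnt M j * cnt M k"
proof -
  let ?L = "\<lambda>k. {x \<in> M. mlen x = k}"
  have "?L (j + k) \<subseteq> (\<lambda>(x, y). x \<odot> y) ` (?L j \<times> ?L k)"
  proof
    fix x assume "x \<in> ?L (j + k)"
    then have x: "x \<in> M" "mlen x = j + k" by auto
    from x(1) obtain w where w: "w \<in> lists G" "x = cls R w" by (rule M_cases)
    have "length w = j + k" using x(2) w by (simp add: mlen_cls)
    note w = w this
    have "take j w \<in> lists G" "drop j w \<in> lists G" using w by (auto dest: in_set_takeD in_set_dropD)
    then have "cls R (take j w) \<in> ?L j" "cls R (drop j w) \<in> ?L k" using w by (auto simp: mlen_cls)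
    moreover have "x = cls R (take j w) \<odot> cls R (drop j w)" using w by (simp add: mmult_cls)
    ultimately show "x \<in> (\<lambda>(x, y). x \<odot> y) ` (?L j \<times> ?L k)" by force
  qed
  then have "cnt M (j + k) \<le> card ((\<lambda>(x, y). x \<odot> y) ` (?L j \<times> ?L k))"
    unfolding cnt_def by (intro card_mono) auto
  also have "\<dots> \<le> card (?L j \<times> ?L k)" by (intro card_image_le) auto
  finally show ?thesis by (simp add: cnt_def card_cartesian_product)
qed

lemma cnt_M_0: "cnt M 0 = 1"
proof -
  have "{x \<in> M. mlen x = 0} = {\<one>}" using mlen_0 by auto
  then show ?thesis by (simp add: cnt_def)
qed

lemma cnt_M_submult_power: "cnt M (m * k + i) \<le> cnt M k ^ m * cnt M i"
proof (induction m)
  case (Suc m)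
  have "cnt M (Suc m * k + i) \<le> cnt M k * cnt M (m * k + i)"
    using cnt_M_submult[of k "m * k + i"] by (simp add: algebra_simps)
  also have "\<dots> \<le> cnt M k * (cnt M k ^ m * cnt M i)" using Suc by simp
  finally show ?case by (simp add: mult.assoc)
qed simp

text \<open>A single \<open>k\<close> suffices: dividing \<open>j\<close> by \<open>k\<close> with
  remainder, submultiplicativity bounds the weighted coefficient at \<open>j\<close> by those below
  \<open>k\<close>.\<close>

lemma summable_cnt_M_of_small:
  assumes "0 < k" "0 < r" "real (cnt M k) * r ^ k < 1" "0 < t" "t < r"
  shows "summable (\<lambda>j. real (cnt M j) * t ^ j)"
proof -
  define B where "B = (\<Sum>i<k. real (cnt M i) * r ^ i)"
  have bound: "real (cnt M j) * r ^ j \<le> B" for j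
  proof -
    define m i where "m = j div k" and "i = j mod k"
    have j: "j = m * k + i" "i < k" using assms by (auto simp: m_def i_def)
    have "real (cnt M j) * r ^ j \<le> real (cnt M k ^ m * cnt M i) * r ^ j"
      unfolding j(1) using assms
      by (intro mult_right_mono of_nat_mono[OF cnt_M_submult_power]) simp
    also have "\<dots> = (real (cnt M k) * r ^ k) ^ m * (real (cnt M i) * r ^ i)"
      unfolding j(1) by (simp add: power_add power_mult_distrib power_mult[symmetric] mult.commute mult.left_commute)
    also have "\<dots> \<le> 1 * (real (cnt M i) * r ^ i)"
      using assms by (intro mult_right_mono power_le_one) auto
    also have "\<dots> \<le> B" unfolding B_def mult_1
      using j assms by (intro member_le_sum[of i "{..<k}" "\<lambda>i. real (cnt M i) * r ^ i"]) auto
    finally show ?thesis .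
  qed
  have "summable (\<lambda>j. B * (t / r) ^ j)"
    using assms by (intro summable_mult summable_geometric) auto
  then show ?thesis
  proof (rule summable_comparison_test')
    fix j assume "0 \<le> (j::nat)"
    have "real (cnt M j) * t ^ j = (real (cnt M j) * r ^ j) * (t / r) ^ j"
      using assms by (simp add: power_divide)
    also have "\<dots> \<le> B * (t / r) ^ j" using bound assms by (intro mult_right_mono) auto
    finally show "norm (real (cnt M j) * t ^ j) \<le> B * (t / r) ^ j" using assms by simp
  qed
qed

lemma conv_radius_q: "conv_radius (\<lambda>k. real (cnt M k)) = ereal q" "0 < q" "q \<le> 1"
proof -
  let ?c = "conv_radius (\<lambda>k. real (cnt M k))"
  have "\<not> summable (\<lambda>k. real (cnt M k) * 1 ^ k)"
  proof
    assume "summable (\<lambda>k. real (cnt M k) * 1 ^ k)"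
    then have "(\<lambda>k. real (cnt M k)) \<longlonglongrightarrow> 0" using summable_LIMSEQ_zero by force
    then have "1 \<le> (0::real)"
      by (rule LIMSEQ_le_const) (use cnt_M_pos in \<open>auto simp: real_of_nat_ge_one_iff\<close>)
    then show False by simp
  qed
  then have le: "?c \<le> 1" using conv_radius_leI'[of "\<lambda>k. real (cnt M k)" 1] by (simp add: one_ereal_def)
  \<comment> \<open>With this \<open>r\<close> the criterion above applies for \<open>k = 1\<close>,
    which makes the radius positive.\<close>
  define r where "r = 1 / (2 * real (cnt M 1))"
  have c1: "1 \<le> real (cnt M 1)" using cnt_M_pos by (simp add: real_of_nat_ge_one_iff)
  have r: "0 < r" using c1 by (simp add: r_def)
  have "summable (\<lambda>j. real (cnt M j) * (r / 2) ^ j)"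
  proof (rule summable_cnt_M_of_small[of 1 r])
    show "real (cnt M 1) * r ^ 1 < 1" using c1 by (simp add: r_def)
  qed (use r in auto)
  then have ge: "?c \<ge> ereal (r / 2)" using conv_radius_geI[of "\<lambda>k. real (cnt M k)" "r / 2"] r by simp
  have q: "q = real_of_ereal ?c" by (simp add: qrad_def Msphere_def cnt_def)
  have "\<bar>?c\<bar> \<noteq> \<infinity>" using le ge by auto
  then show c: "?c = ereal q" unfolding q by (simp add: ereal_real')
  show "0 < q" "q \<le> 1" using le ge r unfolding c by (auto simp: one_ereal_def)
qed

lemma summable_cnt:
  assumes "A \<subseteq> M" "0 \<le> t" "t < q"
  shows "summable (\<lambda>k. real (cnt A k) * t ^ k)"
proof (rule summable_comparison_test')
  show "summable (\<lambda>k. real (cnt M k) * t ^ k)"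
    using assms conv_radius_q by (intro summable_in_conv_radius) simp
  show "norm (real (cnt A k) * t ^ k) \<le> real (cnt M k) * t ^ k" for k
    using assms cnt_mono[of A M k] by (simp add: mult_right_mono)
qed

text \<open>Fekete's argument: a value below 1 at \<open>q\<close> would stay below 1 at a slightly
  larger \<open>r\<close>, and the series would converge beyond its radius. This lower bound is what
  makes the growth series of \<open>M\<close> diverge at \<open>q\<close>.\<close>

lemma cnt_M_q_ge_1: "1 \<le> real (cnt M k) * q ^ k"
proof (rule ccontr)
  assume *: "\<not> ?thesis"
  then have k: "0 < k" using cnt_M_0 by (cases k) auto
  have c: "0 < real (cnt M k)" using cnt_M_pos[of k] by simp
  have "q ^ k < 1 / real (cnt M k)" using * c by (simp add: field_simps)
  then obtain u where u: "q ^ k < u" "u < 1 / real (cnt M k)" using dense by blast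
  define r where "r = root k u"
  have u0: "0 < u" using u conv_radius_q(2) by (meson less_trans zero_less_power)
  have r: "r ^ k = u" "0 < r" using u0 k by (auto simp: r_def real_root_pow_pos2)
  have qr: "q < r" using u r k conv_radius_q(2) by (metis less_imp_le not_le power_mono)
  have "summable (\<lambda>j. real (cnt M j) * ((q + r) / 2) ^ j)"
    by (rule summable_cnt_M_of_small[of k r]) (use u r k qr c conv_radius_q(2) in \<open>auto simp: field_simps\<close>)
  then have "ereal ((q + r) / 2) \<le> ereal q"
    using conv_radius_geI[of "\<lambda>k. real (cnt M k)" "(q + r) / 2"] conv_radius_q r by simp
  then show False using qr by simp
qed

lemma gf_nonneg: "A \<subseteq> M \<Longrightarrow> 0 \<le> t \<Longrightarrow> t < q \<Longrightarrow> 0 \<le> gf A t"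
  unfolding gf_def by (intro suminf_nonneg summable_cnt) auto

lemma gf_mono: "A \<subseteq> B \<Longrightarrow> B \<subseteq> M \<Longrightarrow> 0 \<le> t \<Longrightarrow> t < q \<Longrightarrow> gf A t \<le> gf B t"
  unfolding gf_def by (intro suminf_le summable_cnt mult_right_mono) (auto intro: cnt_mono)

lemma gf_ge_1: assumes "\<one> \<in> A" "A \<subseteq> M" "0 \<le> t" "t < q" shows "1 \<le> gf A t"
proof -
  have "1 \<le> cnt A 0" using assms by (auto simp: cnt_def Suc_le_eq card_gt_0_iff)
  then have "1 \<le> (\<Sum>k\<in>{0}. real (cnt A k) * t ^ k)" by simp
  also have "\<dots> \<le> gf A t" unfolding gf_def using assms by (intro sum_le_suminf summable_cnt) auto
  finally show ?thesis .
qed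

lemma gf_UN:
  assumes "finite I" "\<And>i. i \<in> I \<Longrightarrow> A i \<subseteq> M" "disjoint_family_on A I" "0 \<le> t" "t < q"
  shows "gf (\<Union>i\<in>I. A i) t = (\<Sum>i\<in>I. gf (A i) t)"
  unfolding gf_def using assms
  by (simp add: cnt_UN sum_distrib_right suminf_sum summable_cnt)

section \<open>Growth series of products and factorizations\<close>

lemma cnt_convolution:
  assumes "A \<subseteq> M" "B \<subseteq> M"
  shows "(\<Sum>i\<le>k. cnt A i * cnt B (k - i)) = card {(p, x) \<in> A \<times> B. mlen p + mlen x = k}"
proof -
  have "{(p, x) \<in> A \<times> B. mlen p + mlen x = k} = (\<Union>i\<in>{..k}. {p \<in> A. mlen p = i} \<times> {x \<in> B. mlen x = k - i})"
    by auto
  then show ?thesis using assms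
    by (simp add: cnt_def, subst card_UN_disjoint) (auto simp: card_cartesian_product)
qed

lemma gf_mult:
  assumes "A \<subseteq> M" "B \<subseteq> M" "0 \<le> t" "t < q"
  shows "(\<lambda>k. real (card {(p, x) \<in> A \<times> B. mlen p + mlen x = k}) * t ^ k) sums (gf A t * gf B t)"
proof -
  have "(\<lambda>k. \<Sum>i\<le>k. (real (cnt A i) * t ^ i) * (real (cnt B (k - i)) * t ^ (k - i))) sums (gf A t * gf B t)"
    unfolding gf_def using summable_cnt[OF assms(1,3,4)] summable_cnt[OF assms(2,3,4)] assms(3)
    by (intro Cauchy_product_sums) simp_all
  moreover have "(\<Sum>i\<le>k. (real (cnt A i) * t ^ i) * (real (cnt B (k - i)) * t ^ (k - i))) =
     real (card {(p, x) \<in> A \<times> B. mlen p + mlen x = k}) * t ^ k" for k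
    unfolding cnt_convolution[OF assms(1,2), symmetric] of_nat_sum sum_distrib_right
    by (intro sum.cong refl) (simp add: power_add[symmetric] mult_ac)
  ultimately show ?thesis by simp
qed

lemma gf_mult_le:
  assumes "A \<subseteq> M" "B \<subseteq> M" "0 \<le> t" "t < q" "inj_on (\<lambda>(p, x). p \<odot> x) (A \<times> B)"
  shows "gf A t * gf B t \<le> gf M t"
proof -
  have "card {(p, x) \<in> A \<times> B. mlen p + mlen x = k} \<le> cnt M k" for k
    unfolding cnt_def
  proof (rule card_inj_on_le[of "\<lambda>(p, x). p \<odot> x"])
    show "inj_on (\<lambda>(p, x). p \<odot> x) {(p, x) \<in> A \<times> B. mlen p + mlen x = k}"
      by (rule inj_on_subset[OF assms(5)]) auto
  qed (use assms(1,2) in \<open>auto simp: subset_iff\<close>)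
  then show ?thesis
    unfolding gf_def[of M] sums_unique[OF gf_mult[OF assms(1-4)]] using assms
    by (intro suminf_le sums_summable[OF gf_mult[OF assms(1-4)]] summable_cnt mult_right_mono) auto
qed

lemma gf_le_mult:
  assumes "A \<subseteq> M" "B \<subseteq> M" "0 \<le> t" "t < q" "M \<subseteq> (\<lambda>(p, x). p \<odot> x) ` (A \<times> B)"
  shows "gf M t \<le> gf A t * gf B t"
proof -
  have "cnt M k \<le> card {(p, x) \<in> A \<times> B. mlen p + mlen x = k}" for k
    unfolding cnt_def
  proof (rule surj_card_le[of _ _ "\<lambda>(p, x). p \<odot> x"])
    show "finite {(p, x) \<in> A \<times> B. mlen p + mlen x = k}"
      by (rule finite_subset[of _ "{p \<in> M. mlen p \<le> k} \<times> {x \<in> M. mlen x \<le> k}"])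
        (use assms(1,2) finite_ball in auto)
    show "{x \<in> M. mlen x = k} \<subseteq> (\<lambda>(p, x). p \<odot> x) ` {(p, x) \<in> A \<times> B. mlen p + mlen x = k}"
    proof
      fix x assume x: "x \<in> {x \<in> M. mlen x = k}"
      then obtain p r where "x = p \<odot> r" "p \<in> A" "r \<in> B" using assms(5) by auto
      then show "x \<in> (\<lambda>(p, x). p \<odot> x) ` {(p, x) \<in> A \<times> B. mlen p + mlen x = k}"
        using x assms(1,2) by (intro image_eqI[of _ _ "(p, r)"]) (auto simp: subset_iff)
    qed
  qed
  then show ?thesis
    unfolding gf_def[of M] sums_unique[OF gf_mult[OF assms(1-4)]] using assms
    by (intro suminf_le sums_summable[OF gf_mult[OF assms(1-4)]] summable_cnt mult_right_mono) auto
qed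

definition free where
  "free X = {x \<in> M. \<forall>s\<in>X. \<not> gen R s \<preceq> x}"

lemma free_subset: "free X \<subseteq> M"
  by (auto simp: free_def)

lemma unit_free: "X \<subseteq> G \<Longrightarrow> \<one> \<in> free X"
  using le_mlen[of "gen R _" \<one>] by (fastforce simp: free_def)

text \<open>Divisors from \<open>X\<close> are split off one by one until none is left. Different
  orders may lead to different results, hence only an inequality of growth series for general
  \<open>X\<close>.\<close>

lemma submonoid_free_decomp:
  assumes X: "X \<subseteq> G" and "x \<in> M"
  shows "\<exists>p\<in>submonoid X. \<exists>y\<in>free X. x = p \<odot> y"
  using assms(2)
proof (induction "mlen x" arbitrary: x rule: less_induct)
  case less
  show ?case
  proof (cases "x \<in> free X")
    case True
    then show ?thesis using less by (intro bexI[of _ \<one>] bexI[of _ x] submonoid_unit) simp_all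
  next
    case False
    then obtain s y where s: "s \<in> X" "y \<in> M" "x = gen R s \<odot> y" using less by (auto simp: free_def ldiv_def)
    have sG: "s \<in> G" using s X by auto
    then obtain p z where pz: "p \<in> submonoid X" "z \<in> free X" "y = p \<odot> z"
      using less.hyps[of y] s by auto
    have "p \<in> M" "z \<in> M" using pz submonoid_subset[OF X] by (auto simp: free_def)
    then have "x = (gen R s \<odot> p) \<odot> z" using s pz sG by (simp add: mul_assoc)
    then show ?thesis using submonoid_mul[OF submonoid_gen[OF s(1)] pz(1)] pz(2) by blast
  qed
qed

lemma gf_M_le_submonoid_free:
  assumes "X \<subseteq> G" "0 \<le> t" "t < q"
  shows "gf M t \<le> gf (submonoid X) t * gf (free X) t"
proof (rule gf_le_mult)
  show "M \<subseteq> (\<lambda>(p, x). p \<odot> x) ` (submonoid X \<times> free X)"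
    using submonoid_free_decomp[OF assms(1)] by force
qed (use assms submonoid_subset free_subset in auto)

end

context complemented
begin

lemma cnt_mul: assumes "x \<in> M" "A \<subseteq> M" shows "cnt ((\<lambda>y. x \<odot> y) ` A) (mlen x + k) = cnt A k"
proof -
  have "{z \<in> (\<lambda>y. x \<odot> y) ` A. mlen z = mlen x + k} = (\<lambda>y. x \<odot> y) ` {y \<in> A. mlen y = k}"
    using assms by auto
  moreover have "inj_on (\<lambda>y. x \<odot> y) {y \<in> A. mlen y = k}"
    using assms mul_cancel by (intro inj_onI) blast
  ultimately show ?thesis by (simp add: cnt_def card_image)
qed

lemma cnt_mul_0: assumes "x \<in> M" "A \<subseteq> M" "k < mlen x" shows "cnt ((\<lambda>y. x \<odot> y) ` A) k = 0"
proof -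
  have "{z \<in> (\<lambda>y. x \<odot> y) ` A. mlen z = k} = {}" using assms by auto
  then show ?thesis unfolding cnt_def by (simp only: card.empty)
qed

lemma gf_mul: assumes "x \<in> M" "A \<subseteq> M" "0 \<le> t" "t < q"
  shows "gf ((\<lambda>y. x \<odot> y) ` A) t = t ^ mlen x * gf A t"
proof -
  let ?B = "(\<lambda>y. x \<odot> y) ` A"
  have B: "?B \<subseteq> M" using assms by auto
  have "gf ?B t = (\<Sum>k. real (cnt ?B (k + mlen x)) * t ^ (k + mlen x))"
    unfolding gf_def using suminf_split_initial_segment[OF summable_cnt[OF B assms(3,4)], of "mlen x"]
      cnt_mul_0[OF assms(1,2)] by simp
  also have "\<dots> = (\<Sum>k. t ^ mlen x * (real (cnt A k) * t ^ k))"
    using cnt_mul[OF assms(1,2)] by (simp add: add.commute power_add mult_ac)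
  also have "\<dots> = t ^ mlen x * gf A t"
    unfolding gf_def using summable_cnt[OF assms(2-)] by (rule suminf_mult)
  finally show ?thesis .
qed

text \<open>If p x = r y, the complements \<open>u\<close>, \<open>v\<close> of \<open>p\<close> and
  \<open>r\<close> in their lcm lie in the parabolic and are left divisors of \<open>x\<close> and
  \<open>y\<close>. A nontrivial one would begin with a generator in \<open>X\<close>, so both are
  trivial.\<close>

lemma inj_submonoid_free:
  assumes X: "lcm_closed X"
  shows "inj_on (\<lambda>(p, x). p \<odot> x) (submonoid X \<times> free X)"
proof -
  have XG: "X \<subseteq> G" using X by (simp add: lcm_closed_def)
  have "p = r \<and> x = y"
    if *: "p \<in> submonoid X" "r \<in> submonoid X" "x \<in> free X" "y \<in> free X" "p \<odot> x = r \<odot> y" for p r x y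
  proof -
    have M: "p \<in> M" "r \<in> M" "x \<in> M" "y \<in> M" using * submonoid_subset[OF XG] by (auto simp: free_def)
    from submonoid_lcm[OF X *(1,2) M(3,4) *(5)] obtain u v where uv:
      "u \<in> submonoid X" "v \<in> submonoid X" "p \<odot> u = r \<odot> v"
      and univ: "\<And>x y. x \<in> M \<Longrightarrow> y \<in> M \<Longrightarrow> p \<odot> x = r \<odot> y \<Longrightarrow> \<exists>z\<in>M. x = u \<odot> z \<and> y = v \<odot> z" by metis
    obtain z where z: "z \<in> M" "x = u \<odot> z" "y = v \<odot> z" using univ[OF M(3,4) *(5)] by blast
    have unit: "u = \<one>" if uz: "u \<in> submonoid X" "u \<odot> z \<in> free X" for u
    proof (rule ccontr)
      assume "u \<noteq> \<one>"
      then obtain s w where s: "s \<in> X" "w \<in> submonoid X" "u = gen R s \<odot> w"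
        using submonoid_Cons[OF uz(1) XG] by metis
      have "s \<in> G" "w \<in> M" using s XG submonoid_subset[OF XG] by auto
      then have "gen R s \<preceq> u \<odot> z" using s z by (intro ldivI[of "w \<odot> z"]) (simp_all add: mul_assoc)
      then show False using uz s by (auto simp: free_def)
    qed
    have "u = \<one>" "v = \<one>" using unit[of u] unit[of v] uv z * by simp_all
    then show ?thesis using uv z M by simp
  qed
  then show ?thesis unfolding inj_on_def by (simp only: split_paired_Ball_Sigma split_conv prod.inject) blast
qed

text \<open>\<open>Y\<close> is a stepping stone, chosen such that its series is already under
  control and that a prefix \<open>w\<close> shields the elements of \<open>free Y\<close> from all
  divisors in \<open>X\<close>.\<close>

lemma summable_submonoid_step:
  assumes X: "lcm_closed X" and Y: "Y \<subseteq> G" and w: "w \<in> M"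
    and sum: "summable (\<lambda>k. real (cnt (submonoid Y) k) * q ^ k)"
    and avoid: "\<And>x. x \<in> free Y \<Longrightarrow> w \<odot> x \<in> free X"
  shows "summable (\<lambda>k. real (cnt (submonoid X) k) * q ^ k)"
proof -
  have XG: "X \<subseteq> G" using X by (simp add: lcm_closed_def)
  note sub = submonoid_subset[OF XG] submonoid_subset[OF Y] free_subset[of X] free_subset[of Y]
  define B where "B = (\<Sum>k. real (cnt (submonoid Y) k) * q ^ k)"
  note q = conv_radius_q(2)
  have le: "(\<Sum>k<K. real (cnt (submonoid X) k) * t ^ k) * t ^ mlen w \<le> B" if t: "0 < t" "t < q" for t K
  proof -
    have t': "0 \<le> t" using t by simp
    let ?F = "gf (free Y) t"
    have F: "1 \<le> ?F" using gf_ge_1[OF unit_free[OF Y] sub(4) t' t(2)] .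
    have wF: "t ^ mlen w * ?F \<le> gf (free X) t"
      using gf_mul[OF w sub(4) t' t(2)] gf_mono[of "(\<lambda>y. w \<odot> y) ` free Y" "free X" t] avoid sub t by auto
    have X0: "0 \<le> gf (submonoid X) t" using gf_nonneg sub t by simp
    have Yb: "gf (submonoid Y) t \<le> B"
      unfolding gf_def B_def using sum t q summable_cnt[OF sub(2) t' t(2)]
      by (intro suminf_le) (auto intro!: mult_left_mono power_mono)
    have "(gf (submonoid X) t * t ^ mlen w) * ?F \<le> gf (submonoid X) t * gf (free X) t"
      using mult_left_mono[OF wF X0] by (simp add: mult.assoc)
    also have "\<dots> \<le> gf M t" using inj_submonoid_free[OF X] sub t by (intro gf_mult_le) auto
    also have "\<dots> \<le> gf (submonoid Y) t * ?F" using Y t by (intro gf_M_le_submonoid_free) auto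
    also have "\<dots> \<le> B * ?F" using Yb F by (intro mult_right_mono) auto
    finally have 1: "gf (submonoid X) t * t ^ mlen w \<le> B" using F by (simp add: mult_le_cancel_right)
    have "(\<Sum>k<K. real (cnt (submonoid X) k) * t ^ k) \<le> gf (submonoid X) t"
      unfolding gf_def using t by (intro sum_le_suminf summable_cnt[OF sub(1)]) auto
    then have "(\<Sum>k<K. real (cnt (submonoid X) k) * t ^ k) * t ^ mlen w \<le> gf (submonoid X) t * t ^ mlen w"
      using t by (intro mult_right_mono) auto
    with 1 show ?thesis by simp
  qed
  \<comment> \<open>Partial sums are polynomials in \<open>t\<close>, so their bound for
    \<open>t < q\<close> extends to \<open>q\<close>, where convergence of the full series is still
    unknown.\<close>
  have "(\<Sum>k<K. real (cnt (submonoid X) k) * q ^ k) * q ^ mlen w \<le> B" for K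
  proof (rule tendsto_upperbound)
    show "((\<lambda>t. (\<Sum>k<K. real (cnt (submonoid X) k) * t ^ k) * t ^ mlen w) \<longlongrightarrow>
       (\<Sum>k<K. real (cnt (submonoid X) k) * q ^ k) * q ^ mlen w) (at_left q)"
      by (intro tendsto_intros)
    show "\<forall>\<^sub>F t in at_left q. (\<Sum>k<K. real (cnt (submonoid X) k) * t ^ k) * t ^ mlen w \<le> B"
      using eventually_at_left_real[OF q] by eventually_elim (use le in auto)
  qed simp
  then show ?thesis
    using q by (intro summableI_nonneg_bounded[where x = "B / q ^ mlen w"]) (auto simp: field_simps)
qed

text \<open>The multiples of distinct generators in \<open>T\<close> meet exactly in the multiples
  of \<delta>. Counting their union by disjoint pieces gives the left-hand side times the series of
  \<open>M\<close>, and the union is contained in \<open>M\<close>.\<close>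

lemma q_constraint:
  assumes T: "T \<subseteq> G" and \<delta>: "\<delta> \<in> M" "\<And>s. s \<in> T \<Longrightarrow> gen R s \<preceq> \<delta>"
    and lcm: "\<And>s s' x. s \<in> T \<Longrightarrow> s' \<in> T \<Longrightarrow> s \<noteq> s' \<Longrightarrow> x \<in> M \<Longrightarrow> gen R s \<preceq> x \<Longrightarrow> gen R s' \<preceq> x \<Longrightarrow> \<delta> \<preceq> x"
    and t: "0 < t" "t < q"
  shows "real (card T) * (t - t ^ mlen \<delta>) + t ^ mlen \<delta> \<le> 1"
proof -
  have fT: "finite T" using T finite_G finite_subset by blast
  define mult where "mult x = (\<lambda>y. x \<odot> y) ` M" for x
  have multM: "mult x \<subseteq> M" if "x \<in> M" for x using that by (auto simp: mult_def)
  have mult_iff: "z \<in> mult x \<longleftrightarrow> x \<preceq> z" for x z by (auto simp: mult_def ldiv_def)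
  have gm: "gf (mult x) t = t ^ mlen x * gf M t" if "x \<in> M" for x
    unfolding mult_def using that t by (intro gf_mul) auto
  have diff: "gf (mult (gen R s) - mult \<delta>) t = (t - t ^ mlen \<delta>) * gf M t" if s: "s \<in> T" for s
  proof -
    have sM: "gen R s \<in> M" using s T by auto
    let ?A = "\<lambda>b. if b then mult \<delta> else mult (gen R s) - mult \<delta>"
    have "mult (gen R s) = (\<Union>b\<in>UNIV. ?A b)"
      using \<delta>(2)[OF s] sM by (auto simp: mult_iff UNIV_bool intro: dv_trans)
    moreover have "gf (\<Union>b\<in>UNIV. ?A b) t = (\<Sum>b\<in>UNIV. gf (?A b) t)"
      using multM[OF \<delta>(1)] multM[OF sM] t
      by (intro gf_UN) (auto simp: disjoint_family_on_def)
    ultimately have "gf (mult (gen R s)) t = (\<Sum>b\<in>UNIV. gf (?A b) t)" by (rule ssubst)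
    then show ?thesis using gm[OF sM] gm[OF \<delta>(1)] by (simp add: UNIV_bool left_diff_distrib)
  qed
  define A where "A i = (case i of None \<Rightarrow> mult \<delta> | Some s \<Rightarrow> mult (gen R s) - mult \<delta>)" for i
  have AM: "A i \<subseteq> M" if "i \<in> insert None (Some ` T)" for i
  proof -
    have "mult (gen R s) \<subseteq> M" if "s \<in> T" for s using that T multM by blast
    then show ?thesis using that multM[OF \<delta>(1)] by (auto simp: A_def subset_iff)
  qed
  have "disjoint_family_on A (insert None (Some ` T))"
    unfolding disjoint_family_on_def A_def using lcm by (auto simp: mult_iff dest: multM[THEN subsetD])
      (meson T gen_in_M in_mono le_in_M lcm)
  then have "gf (\<Union>i\<in>insert None (Some ` T). A i) t = (\<Sum>i\<in>insert None (Some ` T). gf (A i) t)"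
    using fT AM t by (intro gf_UN) auto
  also have "\<dots> = gf (mult \<delta>) t + (\<Sum>s\<in>T. gf (mult (gen R s) - mult \<delta>) t)"
    using fT by (simp add: A_def sum.reindex)
  also have "\<dots> = (real (card T) * (t - t ^ mlen \<delta>) + t ^ mlen \<delta>) * gf M t"
    using gm[OF \<delta>(1)] by (simp add: sum.cong[OF refl diff] distrib_right)
  finally have "(real (card T) * (t - t ^ mlen \<delta>) + t ^ mlen \<delta>) * gf M t \<le> gf M t"
    using gf_mono[of "\<Union>i\<in>insert None (Some ` T). A i" M t] AM t by auto
  moreover have "0 < gf M t" using gf_ge_1[of M t] t by auto
  ultimately show ?thesis by simp
qed

end

subsection \<open>Asymptotic number of elements\<close>

context garside
begin

definition heads where "heads y = {x \<in> M. head x = y}"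

lemma heads_subset [simp]: "heads y \<subseteq> M"
  by (auto simp: heads_def)

lemma disjoint_heads: "disjoint_family_on heads I"
  by (auto simp: disjoint_family_on_def heads_def)

lemma cnt_unit: "cnt {\<one>} k = (if k = 0 then 1 else 0)"
proof -
  have "{x \<in> {\<one>}. mlen x = k} = (if k = 0 then {\<one>} else {})"
    by (intro equalityI subsetI) (auto split: if_splits)
  then show ?thesis unfolding cnt_def by (simp only:) simp
qed

lemma heads_unit: "heads \<one> = {\<one>}"
  using head_eq_unit by (auto simp: heads_def)

text \<open>A simple element divides \<open>z\<close> exactly if it divides
  \<open>head z\<close>.\<close>

lemma multiples_eq_heads: assumes "x \<in> S" shows "(\<lambda>y. x \<odot> y) ` M = (\<Union>y\<in>{y \<in> S. x \<preceq> y}. heads y)"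
proof -
  have 1: "z \<in> (\<lambda>y. x \<odot> y) ` M \<longleftrightarrow> z \<in> M \<and> x \<preceq> z" for z
    using assms by (auto simp: ldiv_def)
  have 2: "x \<preceq> z \<longleftrightarrow> x \<preceq> head z" if "z \<in> M" for z
    using that assms le_head head_le dv_trans simple_in_M by blast
  show ?thesis
    by (rule set_eqI, unfold 1) (use 2 in \<open>auto simp: heads_def\<close>)
qed

lemma heads_eq_mul: assumes "y \<in> S" shows "heads y = (\<lambda>x. y \<odot> x) ` (\<Union>z\<in>{z \<in> S. y \<leadsto> z}. heads z)"
proof (intro equalityI subsetI)
  fix x assume "x \<in> heads y"
  then have x: "x \<in> M" "head x = y" by (auto simp: heads_def)
  then have "y \<leadsto> head (tail x)" "tail x \<in> M" "x = y \<odot> tail x"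
    using arrow_head_tail[OF x(1)] head_tail[OF x(1)] by simp_all
  then show "x \<in> (\<lambda>x. y \<odot> x) ` (\<Union>z\<in>{z \<in> S. y \<leadsto> z}. heads z)"
    by (intro image_eqI[of _ _ "tail x"]) (simp_all add: heads_def)
next
  fix x assume "x \<in> (\<lambda>x. y \<odot> x) ` (\<Union>z\<in>{z \<in> S. y \<leadsto> z}. heads z)"
  then obtain w where "w \<in> M" "y \<leadsto> head w" "x = y \<odot> w" by (auto simp: heads_def)
  then show "x \<in> heads y" using head_mul(1)[OF assms] assms by (simp add: heads_def)
qed

lemma cnt_heads_rec:
  assumes "y \<in> S" shows "cnt (heads y) (k + mlen y) = (\<Sum>z\<in>{z \<in> S. y \<leadsto> z}. cnt (heads z) k)"
proof -
  have "cnt (heads y) (mlen y + k) = cnt (\<Union>z\<in>{z \<in> S. y \<leadsto> z}. heads z) k"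
    unfolding heads_eq_mul[OF assms] using assms by (intro cnt_mul) (auto simp: heads_def)
  also have "\<dots> = (\<Sum>z\<in>{z \<in> S. y \<leadsto> z}. cnt (heads z) k)"
    using disjoint_heads by (intro cnt_UN) auto
  finally show ?thesis by (simp add: add.commute)
qed

lemma gf_heads_rec:
  assumes "y \<in> S" "0 \<le> t" "t < q"
  shows "gf (heads y) t = t ^ mlen y * (\<Sum>z\<in>{z \<in> S. y \<leadsto> z}. gf (heads z) t)"
proof -
  have "gf (heads y) t = t ^ mlen y * gf (\<Union>z\<in>{z \<in> S. y \<leadsto> z}. heads z) t"
    unfolding heads_eq_mul[OF assms(1)] using assms by (intro gf_mul) (auto simp: heads_def)
  also have "gf (\<Union>z\<in>{z \<in> S. y \<leadsto> z}. heads z) t = (\<Sum>z\<in>{z \<in> S. y \<leadsto> z}. gf (heads z) t)"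
    using disjoint_heads assms by (intro gf_UN) auto
  finally show ?thesis .
qed

lemma gf_multiples:
  assumes "x \<in> S" "0 \<le> t" "t < q"
  shows "t ^ mlen x * gf M t = (\<Sum>y\<in>{y \<in> S. x \<preceq> y}. gf (heads y) t)"
proof -
  have "t ^ mlen x * gf M t = gf (\<Union>y\<in>{y \<in> S. x \<preceq> y}. heads y) t"
    unfolding multiples_eq_heads[OF assms(1), symmetric] using assms by (intro gf_mul[symmetric]) auto
  also have "\<dots> = (\<Sum>y\<in>{y \<in> S. x \<preceq> y}. gf (heads y) t)"
    using disjoint_heads assms by (intro gf_UN) auto
  finally show ?thesis .
qed

lemma eventually_near_q: "\<forall>\<^sub>F t in at_left q. 0 < t \<and> t < q"
  using eventually_at_left_real[OF conv_radius_q(2)] by simp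

lemma gf_M_pos: "0 \<le> t \<Longrightarrow> t < q \<Longrightarrow> 0 < gf M t"
  using gf_ge_1[of M t] by fastforce

text \<open>Since \<open>cnt M k * q ^ k\<close> is at least 1, the series of \<open>M\<close>
  dominates the geometric series in \<open>t / q\<close>.\<close>

lemma inverse_gf_M_tendsto: "((\<lambda>t. 1 / gf M t) \<longlongrightarrow> 0) (at_left q)"
proof (rule tendsto_sandwich)
  note q = conv_radius_q(2)
  show "\<forall>\<^sub>F t in at_left q. 0 \<le> 1 / gf M t"
    using eventually_near_q by eventually_elim (use gf_M_pos in \<open>simp add: less_imp_le\<close>)
  show "\<forall>\<^sub>F t in at_left q. 1 / gf M t \<le> 1 - t / q"
    using eventually_near_q
  proof eventually_elim
    case (elim t)
    have "1 / (1 - t / q) = (\<Sum>k. (t / q) ^ k)" using elim by (intro suminf_geometric[symmetric]) auto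
    also have "\<dots> \<le> gf M t"
      unfolding gf_def
    proof (rule suminf_le)
      fix k
      have "(t / q) ^ k * 1 \<le> (t / q) ^ k * (real (cnt M k) * q ^ k)"
        using elim q cnt_M_q_ge_1 by (intro mult_left_mono) auto
      also have "\<dots> = real (cnt M k) * t ^ k" using q by (simp add: power_divide)
      finally show "(t / q) ^ k \<le> real (cnt M k) * t ^ k" by simp
    qed (use elim in \<open>auto intro!: summable_geometric summable_cnt\<close>)
    finally show ?case using elim gf_M_pos[of t] by (simp add: field_simps)
  qed
  have "((\<lambda>t. 1 - t / q) \<longlongrightarrow> 1 - q / q) (at_left q)" using q by (intro tendsto_intros) auto
  then show "((\<lambda>t. 1 - t / q) \<longlongrightarrow> 0) (at_left q)" using q by simp
qed auto

text \<open>Descending induction from \<Delta>: the multiples of \<open>y\<close> have series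
  \<open>t ^ mlen y\<close> times that of \<open>M\<close>, and removing the classes of the proper
  simple multiples of \<open>y\<close> leaves \<open>heads y\<close>.\<close>

lemma gf_heads_ratio_tendsto:
  "y \<in> S \<Longrightarrow> \<exists>h. ((\<lambda>t. gf (heads y) t / gf M t) \<longlongrightarrow> h) (at_left q)"
proof (induction "mlen \<Delta> - mlen y" arbitrary: y rule: less_induct)
  case less
  let ?Z = "{z \<in> S. y \<preceq> z} - {y}"
  have fin: "finite {z \<in> S. y \<preceq> z}" "y \<in> {z \<in> S. y \<preceq> z}" using less by auto
  have lt: "mlen \<Delta> - mlen z < mlen \<Delta> - mlen y" if z: "z \<in> ?Z" for z
  proof -
    have "y \<preceq> z" "z \<preceq> \<Delta>" "y \<in> M" "z \<in> M" "z \<noteq> y" using z less.prems by (auto simp: simple_iff)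
    then have "mlen y < mlen z" "mlen z \<le> mlen \<Delta>"
      using le_mlen[of y z] le_mlen_eq[of y z] le_mlen[of z \<Delta>] by fastforce+
    then show ?thesis by simp
  qed
  have "\<forall>z\<in>?Z. \<exists>h. ((\<lambda>t. gf (heads z) t / gf M t) \<longlongrightarrow> h) (at_left q)"
    using less.hyps[OF lt] by simp
  from bchoice[OF this] obtain h where
    h: "\<And>z. z \<in> ?Z \<Longrightarrow> ((\<lambda>t. gf (heads z) t / gf M t) \<longlongrightarrow> h z) (at_left q)" by blast
  have "((\<lambda>t. t ^ mlen y - (\<Sum>z\<in>?Z. gf (heads z) t / gf M t)) \<longlongrightarrow> q ^ mlen y - (\<Sum>z\<in>?Z. h z)) (at_left q)"
    using h by (intro tendsto_intros) auto
  moreover have "\<forall>\<^sub>F t in at_left q. t ^ mlen y - (\<Sum>z\<in>?Z. gf (heads z) t / gf M t) = gf (heads y) t / gf M t"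
    using eventually_near_q
  proof eventually_elim
    case (elim t)
    have "t ^ mlen y * gf M t = gf (heads y) t + (\<Sum>z\<in>?Z. gf (heads z) t)"
      using gf_multiples[OF less.prems, of t] elim sum.remove[OF fin, of "\<lambda>z. gf (heads z) t"] by simp
    then show ?case using gf_M_pos[of t] elim by (simp add: sum_divide_distrib[symmetric] field_simps)
  qed
  ultimately have "((\<lambda>t. gf (heads y) t / gf M t) \<longlongrightarrow> q ^ mlen y - (\<Sum>z\<in>?Z. h z)) (at_left q)"
    by (rule Lim_transform_eventually)
  then show ?case by blast
qed

text \<open>\<open>G - Rset G R (gen R s0)\<close> consists of the generators that no successor of
  \<open>gen R s0\<close> may have as a divisor. Finiteness of the series of their parabolic at
  \<open>q\<close> is the source of positivity of \<open>h\<close>; the loop and the accessibility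
  feed the averaging argument.\<close>

definition dominant :: "'a \<Rightarrow> bool" where
  "dominant s0 \<longleftrightarrow> s0 \<in> G \<and> gen R s0 \<leadsto> gen R s0 \<and>
     (\<forall>y\<in>S - {\<one>}. (y, gen R s0) \<in> {(y, z). y \<in> S - {\<one>} \<and> z \<in> S - {\<one>} \<and> y \<leadsto> z}\<^sup>*) \<and>
     summable (\<lambda>k. real (cnt (submonoid (G - Rset G R (gen R s0))) k) * q ^ k)"

lemma cnt_M_asymptotics:
  assumes dom: "dominant s0"
  shows "\<exists>L>0. (\<lambda>k. real (cnt M k) * q ^ k) \<longlonglongrightarrow> L"
proof -
  note q = conv_radius_q(2)
  let ?\<sigma> = "gen R s0"
  have s0: "s0 \<in> G" "?\<sigma> \<leadsto> ?\<sigma>" "?\<sigma> \<in> S" "?\<sigma> \<noteq> \<one>"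
    using dom mlen_gen[of s0] mlen_unit by (auto simp: dominant_def simp del: mlen_gen)
  define S1 where "S1 = S - {\<one>}"
  have "\<forall>y\<in>S. \<exists>h. ((\<lambda>t. gf (heads y) t / gf M t) \<longlongrightarrow> h) (at_left q)"
    using gf_heads_ratio_tendsto by blast
  from bchoice[OF this] obtain h where
    h: "\<And>y. y \<in> S \<Longrightarrow> ((\<lambda>t. gf (heads y) t / gf M t) \<longlongrightarrow> h y) (at_left q)" by blast
  have h_unit: "h \<one> = 0"
  proof -
    have "gf (heads \<one>) t = 1" for t
      unfolding gf_def heads_unit using suminf_finite[of "{0}" "\<lambda>k. real (cnt {\<one>} k) * t ^ k"] by (simp add: cnt_unit)
    then have "((\<lambda>t. 1 / gf M t) \<longlongrightarrow> h \<one>) (at_left q)" using h[of \<one>] by simp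
    then show ?thesis using inverse_gf_M_tendsto tendsto_unique trivial_limit_at_left_real by blast
  qed
  have h_rec: "h y = q ^ mlen y * (\<Sum>z\<in>{z \<in> S. y \<leadsto> z}. h z)" if y: "y \<in> S" for y
  proof -
    have "((\<lambda>t. t ^ mlen y * (\<Sum>z\<in>{z \<in> S. y \<leadsto> z}. gf (heads z) t / gf M t)) \<longlongrightarrow>
      q ^ mlen y * (\<Sum>z\<in>{z \<in> S. y \<leadsto> z}. h z)) (at_left q)"
      using h by (intro tendsto_intros) auto
    moreover have "\<forall>\<^sub>F t in at_left q. t ^ mlen y * (\<Sum>z\<in>{z \<in> S. y \<leadsto> z}. gf (heads z) t / gf M t) = gf (heads y) t / gf M t"
      using eventually_near_q
      by eventually_elim (use gf_heads_rec[OF y] in \<open>simp add: sum_divide_distrib[symmetric]\<close>)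
    ultimately have "((\<lambda>t. gf (heads y) t / gf M t) \<longlongrightarrow> q ^ mlen y * (\<Sum>z\<in>{z \<in> S. y \<leadsto> z}. h z)) (at_left q)"
      by (rule Lim_transform_eventually)
    then show ?thesis using h[OF y] tendsto_unique trivial_limit_at_left_real by blast
  qed
  have h_nonneg: "0 \<le> h y" if y: "y \<in> S" for y
    using h[OF y]
  proof (rule tendsto_lowerbound)
    show "\<forall>\<^sub>F t in at_left q. 0 \<le> gf (heads y) t / gf M t"
      using eventually_near_q by eventually_elim (use gf_nonneg in simp)
  qed simp
  have S_arrow: "(\<Sum>z\<in>{z \<in> S. y \<leadsto> z}. f z) = (\<Sum>z\<in>S1. if y \<leadsto> z then f z else 0)"
    if "f \<one> = (0::real)" for f y
  proof -
    have "(\<Sum>z\<in>{z \<in> S. y \<leadsto> z}. f z) = (\<Sum>z\<in>S. if y \<leadsto> z then f z else 0)"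
      by (simp add: sum.inter_filter)
    also have "\<dots> = (\<Sum>z\<in>S1. if y \<leadsto> z then f z else 0)"
      unfolding S1_def using that by (intro sum.mono_neutral_right) auto
    finally show ?thesis .
  qed
  have h_arrow: "q ^ mlen y * h z \<le> h y" if yz: "y \<in> S" "z \<in> S" "y \<leadsto> z" for y z
    unfolding h_rec[OF yz(1)] using yz h_nonneg q
    by (intro mult_left_mono member_le_sum) auto
  define X where "X = G - Rset G R ?\<sigma>"
  define B where "B = (\<Sum>k. real (cnt (submonoid X) k) * q ^ k)"
  have sumX: "summable (\<lambda>k. real (cnt (submonoid X) k) * q ^ k)" using dom by (simp add: dominant_def X_def)
  have XG: "X \<subseteq> G" by (auto simp: X_def)
  have B: "1 \<le> B"
  proof -
    have "\<one> \<in> {x \<in> submonoid X. mlen x = 0}" using submonoid_unit[of X] by simp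
    then have "1 \<le> cnt (submonoid X) 0"
      unfolding cnt_def One_nat_def Suc_le_eq card_gt_0_iff using finite_level[OF submonoid_subset[OF XG]] by blast
    then have "1 \<le> (\<Sum>k\<in>{0}. real (cnt (submonoid X) k) * q ^ k)" by simp
    also have "\<dots> \<le> B" unfolding B_def using sumX q by (intro sum_le_suminf) auto
    finally show ?thesis .
  qed
  \<comment> \<open>Elements without divisor in \<open>X\<close> can follow
    \<open>?\<sigma>\<close>, so multiplying them by \<open>?\<sigma>\<close> leads into
    \<open>heads ?\<sigma>\<close>; and they account for at least the fraction \<open>1 / B\<close>
    of the series of \<open>M\<close>.\<close>
  have "q / B \<le> h ?\<sigma>"
  proof (rule tendsto_le[OF _ h[OF s0(3)]])
    show "((\<lambda>t. t / B) \<longlongrightarrow> q / B) (at_left q)" using B by (intro tendsto_intros) auto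
    show "\<forall>\<^sub>F t in at_left q. t / B \<le> gf (heads ?\<sigma>) t / gf M t"
      using eventually_near_q
    proof eventually_elim
      case (elim t)
      then have t: "0 \<le> t" "t < q" by auto
      have "gf (submonoid X) t \<le> B" unfolding gf_def B_def
        using sumX t q summable_cnt[OF submonoid_subset[OF XG] t]
        by (intro suminf_le) (auto intro!: mult_left_mono power_mono)
      then have "gf M t \<le> B * gf (free X) t"
        using gf_M_le_submonoid_free[OF XG t] gf_nonneg[OF free_subset t, of X]
          mult_right_mono[of "gf (submonoid X) t" B "gf (free X) t"] by simp
      moreover have "t * gf (free X) t \<le> gf (heads ?\<sigma>) t"
      proof -
        have "(\<lambda>x. ?\<sigma> \<odot> x) ` free X \<subseteq> heads ?\<sigma>"
        proof
          fix z assume "z \<in> (\<lambda>x. ?\<sigma> \<odot> x) ` free X"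
          then obtain x where x: "x \<in> M" "\<forall>s\<in>X. \<not> gen R s \<preceq> x" "z = ?\<sigma> \<odot> x" by (auto simp: free_def)
          have "?\<sigma> \<leadsto> head x"
            unfolding arrow_def Lset_def
          proof
            fix s assume "s \<in> {s \<in> G. gen R s \<preceq> head x}"
            then have "s \<in> G" "gen R s \<preceq> x" using x(1) head_le dv_trans gen_in_M by blast+
            then show "s \<in> Rset G R ?\<sigma>" using x(2) by (auto simp: X_def)
          qed
          then show "z \<in> heads ?\<sigma>" using head_mul(1)[OF s0(3) x(1)] x s0 by (simp add: heads_def)
        qed
        then have "gf ((\<lambda>x. ?\<sigma> \<odot> x) ` free X) t \<le> gf (heads ?\<sigma>) t"
          using t by (intro gf_mono) auto
        then show ?thesis using gf_mul[OF gen_in_M[OF s0(1)] free_subset t, of X] by simp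
      qed
      ultimately have "t * gf M t \<le> t * (B * gf (free X) t)" "B * (t * gf (free X) t) \<le> B * gf (heads ?\<sigma>) t"
        using B t by (auto intro: mult_left_mono)
      then have "t * gf M t \<le> B * gf (heads ?\<sigma>) t" by (simp only: mult.left_commute)
      then show ?case using gf_M_pos[OF t] B by (simp add: field_simps)
    qed
  qed simp
  then have h\<sigma>: "0 < h ?\<sigma>" using q B by (smt (verit) divide_pos_pos)
  define E where "E = {(y, z). y \<in> S1 \<and> z \<in> S1 \<and> y \<leadsto> z}"
  have reachE: "(y, ?\<sigma>) \<in> E\<^sup>*" if "y \<in> S1" for y
    using dom that unfolding dominant_def E_def S1_def by blast
  \<comment> \<open>By \<open>h_arrow\<close> positivity travels backwards along arrows.\<close>
  have hpos: "0 < h y" if y: "y \<in> S1" for y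
    using reachE[OF y]
  proof (induction rule: converse_rtrancl_induct)
    case (step y z)
    then have "y \<in> S" "z \<in> S" "y \<leadsto> z" by (auto simp: E_def S1_def)
    from h_arrow[OF this] show ?case using step.IH q by (smt (verit) mult_pos_pos zero_less_power)
  qed (rule h\<sigma>)
  \<comment> \<open>A Doob transform: by the harmonic equation \<open>h_rec\<close> the rows sum to
    1.\<close>
  define P where "P y z = (if y \<leadsto> z then q ^ mlen y * h z / h y else 0)" for y z
  define a where "a y k = real (cnt (heads y) k) * q ^ k / h y" for y k
  define D where "D = mlen \<Delta>"
  have len: "1 \<le> mlen y" "mlen y \<le> D" if y: "y \<in> S1" for y
    using y mlen_0[of y] le_mlen[of y \<Delta>] by (auto simp: S1_def simple_iff D_def Suc_le_eq)
  have \<sigma>S1: "?\<sigma> \<in> S1" using s0 by (simp add: S1_def)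
  have finS1: "finite S1" by (simp add: S1_def)
  have S1S: "y \<in> S" if "y \<in> S1" for y using that by (simp add: S1_def)
  have cnt_arrow: "cnt (heads z) k \<le> cnt (heads y) (k + mlen y)" if "y \<in> S" "z \<in> S" "y \<leadsto> z" for y z k
    unfolding cnt_heads_rec[OF that(1)] using that by (intro member_le_sum) auto
  \<comment> \<open>Strict positivity of \<open>a\<close> requires every class to be inhabited in
    all large lengths. The loop achieves this for the class of \<open>?\<sigma>\<close>, and arrows
    carry it backwards.\<close>
  have ev: "\<exists>n. \<forall>k\<ge>n. 1 \<le> cnt (heads y) k" if y: "y \<in> S1" for y
    using reachE[OF y]
  proof (induction rule: converse_rtrancl_induct)
    case base
    have "1 \<le> cnt (heads ?\<sigma>) (Suc k)" for k
    proof (induction k)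
      case 0
      have "?\<sigma> \<in> {x \<in> heads ?\<sigma>. mlen x = 1}" using head_mul(1)[OF s0(3), of \<one>] s0 by (simp add: heads_def)
      then show ?case by (auto simp: cnt_def Suc_le_eq card_gt_0_iff)
    next
      case (Suc k)
      then show ?case using cnt_arrow[OF s0(3,3,2), of "Suc k"] by simp
    qed
    then have "\<forall>k\<ge>1. 1 \<le> cnt (heads ?\<sigma>) k" by (metis One_nat_def Suc_le_D)
    then show ?case by blast
  next
    case (step y z)
    then obtain n where n: "\<And>k. n \<le> k \<Longrightarrow> 1 \<le> cnt (heads z) k" by blast
    have yz: "y \<in> S" "z \<in> S" "y \<leadsto> z" using step.hyps(1) by (simp_all add: E_def S1_def)
    have "1 \<le> cnt (heads y) k" if "n + mlen y \<le> k" for k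
    proof -
      have k: "k - mlen y + mlen y = k" "n \<le> k - mlen y" using that by simp_all
      show ?thesis using cnt_arrow[OF yz, of "k - mlen y"] n[OF k(2)] k(1) by simp
    qed
    then show ?case by blast
  qed
  have "\<forall>y\<in>S1. \<exists>n. \<forall>k\<ge>n. 1 \<le> cnt (heads y) k" using ev by blast
  from bchoice[OF this] obtain n where n: "\<And>y k. y \<in> S1 \<Longrightarrow> n y \<le> k \<Longrightarrow> 1 \<le> cnt (heads y) k" by blast
  \<comment> \<open>The sum dominates every \<open>n y\<close>; \<open>Suc\<close> keeps
    \<open>k\<close> positive, so that the unit, of length 0, does not contribute to the
    recursion.\<close>
  define K0 where "K0 = Suc (\<Sum>y\<in>S1. n y)"
  have nK0: "n y \<le> K0" if "y \<in> S1" for y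
    using member_le_sum[OF that, of n] finS1 by (simp add: K0_def)
  have "\<exists>L>0. \<forall>y\<in>S1. a y \<longlonglongrightarrow> L"
  proof (rule delayed_average_converges[where S = S1 and ?s0.0 = "?\<sigma>" and d = mlen and D = D and P = P and ?K0.0 = K0])
    show "1 \<le> mlen y \<and> mlen y \<le> D" if "y \<in> S1" for y using len that by simp
    show "0 \<le> P y z" if "y \<in> S1" "z \<in> S1" for y z
      using that hpos q by (auto simp: P_def intro!: divide_nonneg_nonneg mult_nonneg_nonneg less_imp_le)
    show "(\<Sum>z\<in>S1. P y z) = 1" if y: "y \<in> S1" for y
    proof -
      have "(\<Sum>z\<in>S1. P y z) = q ^ mlen y * (\<Sum>z\<in>S1. if y \<leadsto> z then h z else 0) / h y"
        unfolding P_def sum_distrib_left sum_divide_distrib by (intro sum.cong) auto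
      also have "\<dots> = h y / h y" using h_rec[OF S1S[OF y]] S_arrow[of h y] h_unit by simp
      finally show ?thesis using hpos[OF y] by simp
    qed
    show "a y (k + mlen y) = (\<Sum>z\<in>S1. P y z * a z k)" if y: "y \<in> S1" and k: "K0 \<le> k" for y k
    proof -
      have c0: "real (cnt (heads \<one>) k) = 0"
        using k by (simp add: heads_unit cnt_unit K0_def)
      have "real (cnt (heads y) (k + mlen y)) = (\<Sum>z\<in>S1. if y \<leadsto> z then real (cnt (heads z) k) else 0)"
        using cnt_heads_rec[OF S1S[OF y], of k] S_arrow[of "\<lambda>z. real (cnt (heads z) k)" y] c0 by simp
      then have "a y (k + mlen y) = (\<Sum>z\<in>S1. (if y \<leadsto> z then real (cnt (heads z) k) else 0) * q ^ (k + mlen y) / h y)"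
        by (simp add: a_def sum_distrib_right sum_divide_distrib)
      also have "\<dots> = (\<Sum>z\<in>S1. P y z * a z k)"
      proof (rule sum.cong[OF refl])
        fix z assume "z \<in> S1"
        then show "(if y \<leadsto> z then real (cnt (heads z) k) else 0) * q ^ (k + mlen y) / h y = P y z * a z k"
          using hpos[of z] by (simp add: P_def a_def power_add)
      qed
      finally show ?thesis .
    qed
    show "mlen ?\<sigma> = 1" by simp
    show "0 < P ?\<sigma> ?\<sigma>" using s0 h\<sigma> q by (simp add: P_def)
    show "(y, ?\<sigma>) \<in> {(y, z). y \<in> S1 \<and> z \<in> S1 \<and> 0 < P y z}\<^sup>*" if "y \<in> S1" for y
    proof -
      have "E \<subseteq> {(y, z). y \<in> S1 \<and> z \<in> S1 \<and> 0 < P y z}"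
        using hpos q by (auto simp: E_def P_def)
      then show ?thesis using reachE[OF that] rtrancl_mono by blast
    qed
    show "0 < a y k" if y: "y \<in> S1" "K0 \<le> k" for y k
    proof -
      have "1 \<le> cnt (heads y) k" using n[OF y(1)] nK0[OF y(1)] y(2) by simp
      then show ?thesis using hpos[OF y(1)] q by (simp add: a_def)
    qed
  qed (use finS1 \<sigma>S1 in auto)
  then obtain L where L: "0 < L" "\<And>y. y \<in> S1 \<Longrightarrow> a y \<longlonglongrightarrow> L" by blast
  have "(\<lambda>k. \<Sum>y\<in>S1. h y * a y k) \<longlonglongrightarrow> (\<Sum>y\<in>S1. h y * L)"
    using L by (intro tendsto_intros) auto
  moreover have "\<forall>\<^sub>F k in sequentially. (\<Sum>y\<in>S1. h y * a y k) = real (cnt M k) * q ^ k"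
    using eventually_gt_at_top[of 0]
  proof eventually_elim
    case (elim k)
    have "(\<Union>y\<in>S. heads y) = M" by (auto simp: heads_def)
    then have "cnt M k = (\<Sum>y\<in>S. cnt (heads y) k)"
      using cnt_UN[OF finite_S heads_subset disjoint_heads, of k] by simp
    also have "\<dots> = (\<Sum>y\<in>S1. cnt (heads y) k)"
      unfolding S1_def using elim by (intro sum.mono_neutral_right) (auto simp: heads_unit cnt_unit)
    finally have "real (cnt M k) * q ^ k = (\<Sum>y\<in>S1. real (cnt (heads y) k) * q ^ k)"
      by (simp add: sum_distrib_right)
    also have "\<dots> = (\<Sum>y\<in>S1. h y * a y k)"
      using hpos by (intro sum.cong) (auto simp: a_def less_le)
    finally show ?case by simp
  qed
  ultimately have "(\<lambda>k. real (cnt M k) * q ^ k) \<longlonglongrightarrow> (\<Sum>y\<in>S1. h y * L)"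
    by (rule Lim_transform_eventually)
  moreover have "0 < (\<Sum>y\<in>S1. h y * L)"
    using L hpos finS1 \<sigma>S1 by (intro sum_pos) auto
  ultimately show ?thesis by blast
qed

end

subsection \<open>The completion and its cylinders\<close>

context garside
begin

abbreviation "\<M> \<equiv> Mbar G R"
abbreviation "\<T> \<equiv> Mbar_top G R"
abbreviation "\<B> \<equiv> Mbar_meas G R"

definition nbh where "nbh \<xi> m = {\<eta> \<in> \<M>. \<forall>k<m. \<eta> k = \<xi> k}"

text \<open>The same sets as \<open>nbh\<close>, since a product determines its normal form, but
  labelled by elements of the monoid, so that divisibility orders the labels.\<close>

definition cyl where "cyl m x = {\<xi> \<in> \<M>. prefix_prod \<xi> m = x}"

definition prefixes where "prefixes m = (\<lambda>\<xi>. prefix_prod \<xi> m) ` \<M>"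

definition above where "above m x = {\<xi> \<in> \<M>. x \<preceq> prefix_prod \<xi> m}"

lemma topspace_T [simp]: "topspace \<T> = \<M>"
  by (auto simp: Mbar_top_def Mbar_def)

lemma nbh_self: "\<xi> \<in> \<M> \<Longrightarrow> \<xi> \<in> nbh \<xi> m"
  by (simp add: nbh_def)

lemma nbh_antimono: "\<eta> \<in> nbh \<xi> m \<Longrightarrow> m \<le> n \<Longrightarrow> nbh \<eta> n \<subseteq> nbh \<xi> m"
  by (auto simp: nbh_def)

lemma product_cylinder_open:
  assumes "finite K" "\<xi> \<in> UNIV \<rightarrow> S"
  shows "openin (product_topology (\<lambda>_. discrete_topology S) UNIV) {\<eta> \<in> UNIV \<rightarrow> S. \<forall>k\<in>K. \<eta> k = \<xi> k}"
proof -
  have "openin (product_topology (\<lambda>_. discrete_topology S) UNIV) (\<Pi>\<^sub>E k\<in>UNIV. if k \<in> K then {\<xi> k} else S)"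
  proof (rule product_topology_basis)
    show "openin (discrete_topology S) (if k \<in> K then {\<xi> k} else S)" for k using assms by auto
    show "finite {k. (if k \<in> K then {\<xi> k} else S) \<noteq> topspace (discrete_topology S)}"
      by (rule finite_subset[OF _ assms(1)]) auto
  qed
  moreover have "(\<Pi>\<^sub>E k\<in>UNIV. if k \<in> K then {\<xi> k} else S) = {\<eta> \<in> UNIV \<rightarrow> S. \<forall>k\<in>K. \<eta> k = \<xi> k}"
    using assms by (auto simp: PiE_UNIV_domain Pi_iff split: if_splits)
  ultimately show ?thesis by simp
qed

lemma Mbar_Pi: "\<M> \<subseteq> UNIV \<rightarrow> S"
  by (auto simp: Mbar_def)

lemma openin_nbh: assumes "\<xi> \<in> \<M>" shows "openin \<T> (nbh \<xi> m)"
proof -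
  have "nbh \<xi> m = {\<eta> \<in> UNIV \<rightarrow> S. \<forall>k\<in>{..<m}. \<eta> k = \<xi> k} \<inter> \<M>"
    using Mbar_Pi by (auto simp: nbh_def)
  then show ?thesis unfolding Mbar_top_def openin_subtopology
    using product_cylinder_open[of "{..<m}" \<xi>] assms Mbar_Pi by blast
qed

lemma openin_contains_nbh:
  assumes "openin \<T> U" "\<xi> \<in> U"
  obtains m where "nbh \<xi> m \<subseteq> U"
proof -
  obtain V where V: "openin (product_topology (\<lambda>_. discrete_topology S) UNIV) V" "U = V \<inter> \<M>"
    using assms(1) by (auto simp: Mbar_top_def openin_subtopology)
  obtain X where X: "\<xi> \<in> (\<Pi>\<^sub>E i\<in>UNIV. X i)" "finite {i. X i \<noteq> S}" "(\<Pi>\<^sub>E i\<in>UNIV. X i) \<subseteq> V"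
    using product_topology_open_contains_basis[OF V(1), of \<xi>] V(2) assms(2) by auto
  obtain m where m: "\<And>i. X i \<noteq> S \<Longrightarrow> i < m"
    using X(2) by (metis (mono_tags, lifting) finite_nat_set_iff_bounded mem_Collect_eq)
  have "nbh \<xi> m \<subseteq> U"
  proof
    fix \<eta> assume \<eta>: "\<eta> \<in> nbh \<xi> m"
    have "\<eta> i \<in> X i" for i
    proof (cases "X i = S")
      case True then show ?thesis using \<eta> Mbar_simple by (auto simp: nbh_def)
    next
      case False then show ?thesis using m[of i] \<eta> X(1) by (auto simp: nbh_def PiE_UNIV_domain)
    qed
    then show "\<eta> \<in> U" using X(3) V(2) \<eta> by (auto simp: PiE_UNIV_domain nbh_def)
  qed
  then show ?thesis using that by blast
qed

text \<open>An arrow involves two adjacent entries only, so its failure is an open condition: the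
  sequences form a closed subset of a product of finite discrete spaces.\<close>

lemma compact_space_T: "compact_space \<T>"
proof -
  let ?P = "product_topology (\<lambda>_::nat. discrete_topology S) UNIV"
  have top: "topspace ?P = UNIV \<rightarrow> S" by (simp add: PiE_UNIV_domain)
  have "openin ?P (topspace ?P - \<M>)"
  proof (subst openin_subopen, intro ballI)
    fix \<xi> assume "\<xi> \<in> topspace ?P - \<M>"
    then have \<xi>: "\<xi> \<in> UNIV \<rightarrow> S" "\<xi> \<notin> \<M>" using top by auto
    then obtain k where k: "\<not> \<xi> k \<leadsto> \<xi> (Suc k)" by (auto simp: Mbar_def)
    let ?V = "{\<eta> \<in> UNIV \<rightarrow> S. \<forall>j\<in>{k, Suc k}. \<eta> j = \<xi> j}"
    have "?V \<subseteq> topspace ?P - \<M>" using top k by (auto simp: Mbar_def) metis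
    moreover have "openin ?P ?V" using \<xi> by (intro product_cylinder_open) auto
    ultimately show "\<exists>V. openin ?P V \<and> \<xi> \<in> V \<and> V \<subseteq> topspace ?P - \<M>" using \<xi> by blast
  qed
  then have "closedin ?P \<M>" using top Mbar_Pi by (simp add: closedin_def)
  moreover have "compact_space ?P"
    by (simp add: compact_space_product_topology compact_space_discrete_topology)
  ultimately have "compactin ?P \<M>" using closedin_compact_space by blast
  then show ?thesis unfolding Mbar_top_def by (simp add: compact_space_subtopology)
qed

text \<open>A Lebesgue number argument: a property that holds near every point and passes to subsets
  holds at one common depth.\<close>

lemma uniform_nbh:
  assumes local: "\<And>\<xi>. \<xi> \<in> \<M> \<Longrightarrow> \<exists>m. Q (nbh \<xi> m)" and mono: "\<And>A B. Q A \<Longrightarrow> B \<subseteq> A \<Longrightarrow> Q B"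
  obtains m where "\<And>\<xi>. \<xi> \<in> \<M> \<Longrightarrow> Q (nbh \<xi> m)"
proof -
  obtain r where r: "\<And>\<xi>. \<xi> \<in> \<M> \<Longrightarrow> Q (nbh \<xi> (r \<xi>))" using local by metis
  have "\<exists>F. finite F \<and> F \<subseteq> (\<lambda>\<xi>. nbh \<xi> (r \<xi>)) ` \<M> \<and> topspace \<T> \<subseteq> \<Union>F"
    using compact_space_T unfolding compact_space_alt
    by (elim allE[of _ "(\<lambda>\<xi>. nbh \<xi> (r \<xi>)) ` \<M>"] impE) (use openin_nbh nbh_self in auto)
  then obtain X where X: "finite X" "X \<subseteq> \<M>" "\<M> \<subseteq> (\<Union>\<xi>\<in>X. nbh \<xi> (r \<xi>))"
    by (metis (no_types, lifting) finite_subset_image topspace_T)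
  define m where "m = Max (r ` X)"
  have "Q (nbh \<xi> m)" if *: "\<xi> \<in> \<M>" for \<xi>
  proof -
    obtain \<eta> where \<eta>: "\<eta> \<in> X" "\<xi> \<in> nbh \<eta> (r \<eta>)" using X(3) * by blast
    then have "r \<eta> \<le> m" using X(1) by (simp add: m_def)
    then show ?thesis using mono[OF r nbh_antimono[OF \<eta>(2)]] \<eta>(1) X(2) by auto
  qed
  then show ?thesis using that by blast
qed

lemma prefix_prod_cong: "(\<And>k. k < m \<Longrightarrow> \<xi> k = \<eta> k) \<Longrightarrow> prefix_prod \<xi> m = prefix_prod \<eta> m"
proof (induction m arbitrary: \<xi> \<eta>)
  case (Suc m)
  have "prefix_prod (\<lambda>k. \<xi> (Suc k)) m = prefix_prod (\<lambda>k. \<eta> (Suc k)) m"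
    by (rule Suc.IH) (rule Suc.prems, simp)
  moreover have "\<xi> 0 = \<eta> 0" by (rule Suc.prems) simp
  ultimately show ?case by (simp only: prefix_prod.simps)
qed simp

lemma prefix_prod_eq_iff:
  assumes "\<xi> \<in> \<M>" "\<eta> \<in> \<M>"
  shows "prefix_prod \<xi> m = prefix_prod \<eta> m \<longleftrightarrow> (\<forall>k<m. \<xi> k = \<eta> k)"
  using prefix_prod_cong fac_prefix_prod[OF assms(1), of m] fac_prefix_prod[OF assms(2), of m] by metis

lemma cyl_eq_nbh: "\<xi> \<in> \<M> \<Longrightarrow> cyl m (prefix_prod \<xi> m) = nbh \<xi> m"
  using prefix_prod_eq_iff by (auto simp: cyl_def nbh_def)

lemma fac_prefix_in_nbh: "\<xi> \<in> \<M> \<Longrightarrow> fac (prefix_prod \<xi> m) \<in> nbh \<xi> m"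
  by (simp add: nbh_def fac_prefix_prod fac_in_Mbar)

lemma finite_simple_products: "finite (simple_products m)"
proof (induction m)
  case (Suc m)
  have "simple_products (Suc m) = (\<lambda>(a, b). a \<odot> b) ` (S \<times> simple_products m)" by auto
  then show ?case using Suc by simp
qed simp

lemma finite_prefixes [simp]: "finite (prefixes m)"
  by (rule finite_subset[OF _ finite_simple_products[of m]]) (auto simp: prefixes_def prefix_prod_simple_products)

lemma prefixes_in_M: "x \<in> prefixes m \<Longrightarrow> x \<in> M"
  by (auto simp: prefixes_def)

lemma prefixes_simple_products: "x \<in> prefixes m \<Longrightarrow> x \<in> simple_products m"
  by (auto simp: prefixes_def prefix_prod_simple_products)

lemma disjoint_cyl: "disjoint_family_on (cyl m) I"
  by (auto simp: disjoint_family_on_def cyl_def)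

definition clopen where "clopen A \<longleftrightarrow> openin \<T> A \<and> closedin \<T> A"

lemma clopen_Collect: "clopen {\<xi> \<in> \<M>. P (prefix_prod \<xi> m)}"
proof -
  have *: "openin \<T> {\<xi> \<in> \<M>. P (prefix_prod \<xi> m)}" for P
  proof (subst openin_subopen, intro ballI)
    fix \<xi> assume \<xi>: "\<xi> \<in> {\<xi> \<in> \<M>. P (prefix_prod \<xi> m)}"
    then have "nbh \<xi> m \<subseteq> {\<xi> \<in> \<M>. P (prefix_prod \<xi> m)}"
      using cyl_eq_nbh[of \<xi> m, symmetric] by (auto simp: cyl_def)
    then show "\<exists>V. openin \<T> V \<and> \<xi> \<in> V \<and> V \<subseteq> {\<xi> \<in> \<M>. P (prefix_prod \<xi> m)}"
      using \<xi> openin_nbh nbh_self by blast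
  qed
  have "\<M> - {\<xi> \<in> \<M>. P (prefix_prod \<xi> m)} = {\<xi> \<in> \<M>. \<not> P (prefix_prod \<xi> m)}" by auto
  then show ?thesis using *[of P] *[of "\<lambda>x. \<not> P x"] by (auto simp: clopen_def closedin_def)
qed

lemma clopen_cyl: "clopen (cyl m x)"
  unfolding cyl_def by (rule clopen_Collect)

lemma clopen_above: "clopen (above m x)"
  unfolding above_def by (rule clopen_Collect)

text \<open>Near each point, membership in \<open>A\<close> is constant; compactness gives one depth
  \<open>m\<close> that works everywhere.\<close>

lemma clopen_eq_cyl:
  assumes "clopen A"
  obtains m P where "P \<subseteq> prefixes m" "A = (\<Union>x\<in>P. cyl m x)"
proof -
  have loc: "\<exists>m. nbh \<xi> m \<subseteq> A \<or> nbh \<xi> m \<subseteq> \<M> - A" if \<xi>: "\<xi> \<in> \<M>" for \<xi>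
  proof (cases "\<xi> \<in> A")
    case True
    then show ?thesis using openin_contains_nbh[of A \<xi>] assms by (metis clopen_def)
  next
    case False
    then have "openin \<T> (\<M> - A)" "\<xi> \<in> \<M> - A" using assms \<xi> by (auto simp: clopen_def closedin_def)
    then show ?thesis using openin_contains_nbh by metis
  qed
  obtain m where m: "\<And>\<xi>. \<xi> \<in> \<M> \<Longrightarrow> nbh \<xi> m \<subseteq> A \<or> nbh \<xi> m \<subseteq> \<M> - A"
    by (rule uniform_nbh[of "\<lambda>B. B \<subseteq> A \<or> B \<subseteq> \<M> - A"]) (use loc in blast)+
  have AM: "A \<subseteq> \<M>" using assms openin_subset by (fastforce simp: clopen_def)
  have "A = (\<Union>x\<in>(\<lambda>\<xi>. prefix_prod \<xi> m) ` A. cyl m x)"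
  proof (intro equalityI subsetI)
    fix \<xi> assume "\<xi> \<in> A"
    then show "\<xi> \<in> (\<Union>x\<in>(\<lambda>\<xi>. prefix_prod \<xi> m) ` A. cyl m x)" using AM by (auto simp: cyl_def)
  next
    fix \<eta> assume "\<eta> \<in> (\<Union>x\<in>(\<lambda>\<xi>. prefix_prod \<xi> m) ` A. cyl m x)"
    then obtain \<xi> where \<xi>: "\<xi> \<in> A" "\<eta> \<in> nbh \<xi> m" using AM cyl_eq_nbh by blast
    then have "nbh \<xi> m \<subseteq> A" using m[of \<xi>] nbh_self[of \<xi> m] AM by auto
    then show "\<eta> \<in> A" using \<xi> by auto
  qed
  moreover have "(\<lambda>\<xi>. prefix_prod \<xi> m) ` A \<subseteq> prefixes m" using AM by (auto simp: prefixes_def)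
  ultimately show ?thesis using that by blast
qed

lemma space_B [simp]: "space \<B> = \<M>"
  by (simp add: Mbar_meas_def space_measure_of_conv)

lemma sets_B: "sets \<B> = sigma_sets \<M> {U. openin \<T> U}"
  unfolding Mbar_meas_def using openin_subset[of \<T>] by (subst sets_measure_of) auto

lemma clopen_sets [simp]: "clopen A \<Longrightarrow> A \<in> sets \<B>"
  unfolding sets_B by (auto simp: clopen_def)

text \<open>As a product of \<open>m\<close> simple elements, \<open>x\<close> divides an element
  exactly if it divides the product of its first \<open>m\<close> factors; so \<open>m\<close>
  entries decide, and the condition is closed. Conversely a sequence satisfying it is the limit of
  its own truncations, which are multiples of \<open>x\<close> from depth \<open>m\<close>
  on.\<close>

lemma UUp_eq_above: assumes "x \<in> simple_products m" shows "UUp G R x = above m x"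
proof (intro equalityI subsetI)
  let ?Z = "emb G R ` {x \<odot> z |z. z \<in> M}"
  have x: "x \<in> M" using assms by simp
  have "?Z \<subseteq> above m x"
  proof
    fix \<xi> assume "\<xi> \<in> ?Z"
    then obtain z where z: "z \<in> M" "\<xi> = fac (x \<odot> z)" using x emb_eq_fac by auto
    have "x \<preceq> factors_prod m (x \<odot> z)" using assms x z by (intro le_factors_prod) simp_all
    then show "\<xi> \<in> above m x" using z x by (simp add: above_def factors_prod_eq fac_in_Mbar)
  qed
  then show "\<xi> \<in> above m x" if "\<xi> \<in> UUp G R x" for \<xi>
    using that clopen_above[of m x] closure_of_minimal unfolding UUp_def clopen_def by blast
  fix \<xi> assume "\<xi> \<in> above m x"
  then have \<xi>: "\<xi> \<in> \<M>" "x \<preceq> prefix_prod \<xi> m" by (auto simp: above_def)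
  show "\<xi> \<in> UUp G R x"
    unfolding UUp_def in_closure_of topspace_T
  proof (intro conjI \<xi>(1) allI impI)
    fix U assume U: "\<xi> \<in> U \<and> openin \<T> U"
    then obtain j where j: "nbh \<xi> j \<subseteq> U" using openin_contains_nbh by blast
    let ?y = "prefix_prod \<xi> (m + j)"
    have "x \<preceq> ?y" using \<xi> x prefix_prod_mono dv_trans by blast
    then have "emb G R ?y \<in> ?Z" by (auto simp: ldiv_def)
    moreover have "emb G R ?y \<in> U"
      using j fac_prefix_in_nbh[OF \<xi>(1), of "m + j"] emb_eq_fac[of ?y] \<xi>(1) by (auto simp: nbh_def)
    ultimately show "\<exists>y. y \<in> ?Z \<and> y \<in> U" by blast
  qed
qed

lemma factors_prod_full: "x \<in> M \<Longrightarrow> mlen x \<le> m \<Longrightarrow> factors_prod m x = x"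
proof (induction m arbitrary: x)
  case 0
  then show ?case using mlen_0 by simp
next
  case (Suc m)
  have "mlen (tail x) \<le> m" using mlen_tail[of x] Suc.prems by (cases "x = \<one>") auto
  then show ?case using Suc head_tail by simp
qed

lemma emb_inj: assumes "x \<in> M" "y \<in> M" "emb G R x = emb G R y" shows "x = y"
proof -
  have "factors_prod (mlen x + mlen y) x = factors_prod (mlen x + mlen y) y"
    using assms emb_eq_fac by (simp add: factors_prod_eq)
  then show ?thesis using assms factors_prod_full by simp
qed

lemma fac_eq_unit: "x \<in> M \<Longrightarrow> mlen x \<le> k \<Longrightarrow> fac x k = \<one>"
proof (induction k arbitrary: x)
  case 0
  then show ?case using mlen_0 by simp
next
  case (Suc k)
  have "mlen (tail x) \<le> k" using mlen_tail[of x] Suc.prems by (cases "x = \<one>") auto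
  then show ?case using Suc by simp
qed

lemma unit_arrow: assumes "y \<in> S" "\<one> \<leadsto> y" shows "y = \<one>"
proof (rule ccontr)
  assume "y \<noteq> \<one>"
  then obtain s z where s: "s \<in> G" "z \<in> M" "y = gen R s \<odot> z" using M_Cons[of y] assms by auto
  then have "gen R s \<preceq> y" by simp
  then have "\<one> \<odot> gen R s \<notin> S" using assms(2) s(1) by (simp add: arrow_iff)
  then show False using s(1) by simp
qed

text \<open>Elements of the monoid are isolated points, because only units can follow a
  unit.\<close>

lemma clopen_emb: assumes "x \<in> M" shows "clopen {emb G R x}"
proof -
  \<comment> \<open>There are at most \<open>mlen x\<close> nontrivial factors, so the entry with
    index \<open>mlen x\<close> is a unit; the depth has to include it.\<close>
  let ?m = "Suc (mlen x)"
  have f: "fac x \<in> \<M>" using assms by (rule fac_in_Mbar)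
  have "nbh (fac x) ?m = {fac x}"
  proof (intro equalityI subsetI)
    fix \<eta> assume \<eta>: "\<eta> \<in> nbh (fac x) ?m"
    have "\<eta> (mlen x + j) = \<one>" for j
    proof (induction j)
      case 0
      then show ?case using \<eta> fac_eq_unit[OF assms, of "mlen x"] by (simp add: nbh_def)
    next
      case (Suc j)
      have "\<eta> (mlen x + j) \<leadsto> \<eta> (Suc (mlen x + j))" using \<eta> by (simp add: nbh_def Mbar_def)
      then show ?case using Suc unit_arrow Mbar_simple[of \<eta>] \<eta> by (simp add: nbh_def)
    qed
    then have "\<eta> k = fac x k" for k
      using \<eta> fac_eq_unit[OF assms, of k] by (cases "k < mlen x") (simp_all add: nbh_def, metis le_add_diff_inverse not_less)
    then show "\<eta> \<in> {fac x}" by auto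
  qed (use nbh_self[OF f] in auto)
  then show ?thesis using clopen_cyl[of ?m "prefix_prod (fac x) ?m"] cyl_eq_nbh[OF f, of ?m] emb_eq_fac[OF assms] by simp
qed

lemma countable_M: "countable M"
proof -
  have "M \<subseteq> (\<Union>k. {x \<in> M. mlen x \<le> k})" by auto
  moreover have "countable (\<Union>k. {x \<in> M. mlen x \<le> k})"
    by (intro countable_UN countableI_type countable_finite[OF finite_ball])
  ultimately show ?thesis by (rule countable_subset)
qed

lemma emb_M_sets: "emb G R ` M \<in> sets \<B>"
proof -
  have "(\<Union>x\<in>M. {emb G R x}) \<in> sets \<B>"
    using countable_M clopen_emb by (intro sets.countable_UN'') auto
  then show ?thesis by (simp add: UNION_singleton_eq_range)
qed

lemma clopen_UUp: assumes "x \<in> M" shows "clopen (UUp G R x)"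
  using simple_products_prefix[OF assms] UUp_eq_above clopen_above by metis

lemma Up_eq: assumes "x \<in> M" shows "Up G R x = UUp G R x - emb G R ` M"
proof -
  have "UUp G R x \<subseteq> \<M>" using clopen_UUp[OF assms] openin_subset by (fastforce simp: clopen_def)
  then show ?thesis by (auto simp: Up_def boundary_def)
qed

lemma UUp_unit: "UUp G R \<one> = \<M>"
  using UUp_eq_above[of \<one> 0] by (auto simp: above_def)

section \<open>The uniform distributions on spheres\<close>

lemma finite_Msphere: "finite (Msphere G R k)"
  by (simp add: Msphere_def)

lemma card_Msphere: "card (Msphere G R k) = cnt M k"
  by (simp add: Msphere_def cnt_def)

lemma Msphere_nonempty: "Msphere G R k \<noteq> {}"
  using cnt_M_pos[of k] card_Msphere[of k] by (metis card.empty not_one_le_zero)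

lemma emb_measurable: "emb G R \<in> measurable (uniform_count_measure (Msphere G R k)) \<B>"
  by (rule measurableI) (auto simp: space_uniform_count_measure sets_uniform_count_measure Msphere_def emb_eq_fac fac_in_Mbar)

lemma prob_space_mu: "prob_space (mu G R k)"
  unfolding mu_def
  by (intro prob_space.prob_space_distr prob_space_uniform_count_measure finite_Msphere Msphere_nonempty emb_measurable)

lemma sets_mu [simp]: "sets (mu G R k) = sets \<B>"
  by (simp add: mu_def)

lemma space_mu [simp]: "space (mu G R k) = \<M>"
  by (simp add: mu_def)

lemma measure_mu:
  assumes "A \<in> sets \<B>"
  shows "measure (mu G R k) A = real (card {x \<in> Msphere G R k. emb G R x \<in> A}) / real (cnt M k)"
proof -
  have "measure (mu G R k) A = measure (uniform_count_measure (Msphere G R k)) (emb G R -` A \<inter> Msphere G R k)"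
    unfolding mu_def using assms emb_measurable by (simp add: measure_distr space_uniform_count_measure)
  also have "\<dots> = real (card (emb G R -` A \<inter> Msphere G R k)) / real (cnt M k)"
    using finite_Msphere by (subst measure_uniform_count_measure) (auto simp: card_Msphere)
  also have "emb G R -` A \<inter> Msphere G R k = {x \<in> Msphere G R k. emb G R x \<in> A}" by auto
  finally show ?thesis .
qed

lemma measure_mu_above:
  assumes "x \<in> simple_products m" "mlen x \<le> k"
  shows "measure (mu G R k) (above m x) = real (cnt M (k - mlen x)) / real (cnt M k)"
proof -
  have x: "x \<in> M" using assms by simp
  have "{y \<in> Msphere G R k. emb G R y \<in> above m x} = {z \<in> (\<lambda>y. x \<odot> y) ` M. mlen z = mlen x + (k - mlen x)}"
  proof (intro set_eqI)
    fix y
    have "y \<in> {y \<in> Msphere G R k. emb G R y \<in> above m x} \<longleftrightarrow> y \<in> M \<and> mlen y = k \<and> x \<preceq> factors_prod m y"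
      by (auto simp: Msphere_def above_def emb_eq_fac fac_in_Mbar factors_prod_eq)
    also have "\<dots> \<longleftrightarrow> y \<in> M \<and> mlen y = k \<and> x \<preceq> y"
      using le_factors_prod_iff[OF assms(1)] by blast
    also have "\<dots> \<longleftrightarrow> y \<in> {z \<in> (\<lambda>y. x \<odot> y) ` M. mlen z = mlen x + (k - mlen x)}"
      using x assms(2) by (auto simp: ldiv_def)
    finally show "y \<in> {y \<in> Msphere G R k. emb G R y \<in> above m x} \<longleftrightarrow>
      y \<in> {z \<in> (\<lambda>y. x \<odot> y) ` M. mlen z = mlen x + (k - mlen x)}" .
  qed
  then have "card {y \<in> Msphere G R k. emb G R y \<in> above m x} = cnt M (k - mlen x)"
    using cnt_mul[OF x, of M "k - mlen x"] by (simp add: cnt_def)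
  then show ?thesis using measure_mu[OF clopen_sets[OF clopen_above]] by simp
qed

lemma cnt_ratio_tendsto:
  assumes "dominant s0"
  shows "(\<lambda>k. real (cnt M (k - j)) / real (cnt M k)) \<longlonglongrightarrow> q ^ j"
proof -
  note q = conv_radius_q(2)
  obtain L where L: "L > 0" "(\<lambda>k. real (cnt M k) * q ^ k) \<longlonglongrightarrow> L"
    using cnt_M_asymptotics[OF assms] by blast
  have "(\<lambda>k. real (cnt M (k - j)) * q ^ (k - j)) \<longlonglongrightarrow> L"
    by (rule LIMSEQ_offset[of _ j]) (simp add: L(2))
  then have "(\<lambda>k. q ^ j * ((real (cnt M (k - j)) * q ^ (k - j)) / (real (cnt M k) * q ^ k))) \<longlonglongrightarrow> q ^ j * (L / L)"
    using L by (intro tendsto_intros) auto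
  moreover have "\<forall>\<^sub>F k in sequentially. q ^ j * ((real (cnt M (k - j)) * q ^ (k - j)) / (real (cnt M k) * q ^ k))
      = real (cnt M (k - j)) / real (cnt M k)"
    using eventually_ge_at_top[of j]
  proof eventually_elim
    case (elim k)
    have "q ^ k = q ^ j * q ^ (k - j)" using elim by (simp add: power_add[symmetric])
    then show ?case using q by simp
  qed
  ultimately show ?thesis using L(1) by (simp add: Lim_transform_eventually)
qed

end

subsection \<open>The uniform measure at infinity\<close>

context garside
begin

text \<open>The defining condition transferred from the boundary parts \<open>Up\<close> to the
  clopen sets \<open>UUp\<close>, where limits of measures can be computed.\<close>

definition unif :: "(nat \<Rightarrow> 'a list set) measure \<Rightarrow> bool" where
  "unif \<nu> \<longleftrightarrow> prob_space \<nu> \<and> sets \<nu> = sets \<B> \<and> (\<forall>x\<in>M. measure \<nu> (UUp G R x) = q ^ mlen x)"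

text \<open>The condition at the unit says that the boundary has full measure; so the embedded
  monoid is a null set and can be added back.\<close>

lemma is_unif_inf_unif:
  assumes "is_unif_inf G R \<nu>" shows "unif \<nu>"
  unfolding unif_def
proof (intro conjI ballI)
  show "prob_space \<nu>" and sets: "sets \<nu> = sets \<B>" using assms by (auto simp: is_unif_inf_def)
  interpret prob_space \<nu> by fact
  have sp: "space \<nu> = \<M>" using sets sets_eq_imp_space_eq space_B by metis
  have Z: "emb G R ` M \<in> sets \<nu>" using emb_M_sets sets by simp
  have "measure \<nu> (Up G R \<one>) = 1" using assms by (simp add: is_unif_inf_def)
  then have "measure \<nu> (space \<nu> - emb G R ` M) = 1" using Up_eq[of \<one>] UUp_unit sp by simp
  then have 0: "measure \<nu> (emb G R ` M) = 0" using prob_compl[OF Z] by simp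
  fix x assume x: "x \<in> M"
  have U: "UUp G R x \<in> sets \<nu>" using clopen_UUp[OF x] sets by simp
  have "measure \<nu> (Up G R x) = measure \<nu> (UUp G R x)"
    unfolding Up_eq[OF x] using U Z 0 by (simp add: measure_Diff_null_set null_sets_def emeasure_eq_measure)
  then show "measure \<nu> (UUp G R x) = q ^ mlen x" using assms x by (simp add: is_unif_inf_def)
qed

lemma measure_Un_cyl:
  assumes "prob_space N" "sets N = sets \<B>" "P \<subseteq> prefixes m"
  shows "measure N (\<Union>x\<in>P. cyl m x) = (\<Sum>x\<in>P. measure N (cyl m x))"
proof -
  interpret prob_space N by fact
  show ?thesis
    using assms finite_subset[OF assms(3)] clopen_cyl disjoint_cyl
    by (intro finite_measure_finite_Union) auto
qed

lemma above_eq_Un_cyl: "above m x = (\<Union>y\<in>{y \<in> prefixes m. x \<preceq> y}. cyl m y)"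
  by (auto simp: above_def cyl_def prefixes_def)

text \<open>Moebius inversion in triangular form: \<open>above m x\<close> is the disjoint union of
  the cylinders labelled by multiples of \<open>x\<close>, treated from the longest down. One
  constant serves as the limit and as the value of every uniform measure, so the result can be used
  both to build such a measure and to recognize it.\<close>

lemma mu_cyl_tendsto:
  assumes dom: "dominant s0" and "x \<in> prefixes m"
  shows "\<exists>c. (\<lambda>k. measure (mu G R k) (cyl m x)) \<longlonglongrightarrow> c \<and> (\<forall>\<nu>. unif \<nu> \<longrightarrow> measure \<nu> (cyl m x) = c)"
proof -
  \<comment> \<open>A crude bound on the lengths of labels, which turns the descent into a
    well-founded induction.\<close>
  define H where "H = (\<Sum>y\<in>prefixes m. mlen y)"
  have leH: "mlen y \<le> H" if "y \<in> prefixes m" for y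
    unfolding H_def using that by (intro member_le_sum) auto
  show ?thesis using assms(2)
  proof (induction "H - mlen x" arbitrary: x rule: less_induct)
    case less
    let ?Y = "{y \<in> prefixes m. x \<preceq> y}" let ?Z = "?Y - {x}"
    have x: "x \<in> M" "x \<in> simple_products m" using less.prems prefixes_in_M prefixes_simple_products by auto
    have xY: "x \<in> ?Y" "finite ?Y" using less.prems x by auto
    have lt: "H - mlen z < H - mlen x" if z: "z \<in> ?Z" for z
    proof -
      have "x \<preceq> z" "z \<noteq> x" "z \<in> prefixes m" using z by auto
      then have "mlen x < mlen z" using le_mlen[OF x(1)] le_mlen_eq[OF x(1)] by fastforce
      then show ?thesis using leH[OF \<open>z \<in> prefixes m\<close>] by simp
    qed
    have "\<forall>z\<in>?Z. \<exists>c. (\<lambda>k. measure (mu G R k) (cyl m z)) \<longlonglongrightarrow> c \<and> (\<forall>\<nu>. unif \<nu> \<longrightarrow> measure \<nu> (cyl m z) = c)"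
      using less.hyps[OF lt] by simp
    from bchoice[OF this] obtain c where
      c: "\<And>z. z \<in> ?Z \<Longrightarrow> (\<lambda>k. measure (mu G R k) (cyl m z)) \<longlonglongrightarrow> c z"
      "\<And>z \<nu>. z \<in> ?Z \<Longrightarrow> unif \<nu> \<Longrightarrow> measure \<nu> (cyl m z) = c z" by blast
    have split: "measure N (cyl m x) = measure N (above m x) - (\<Sum>z\<in>?Z. measure N (cyl m z))"
      if "prob_space N" "sets N = sets \<B>" for N
      using measure_Un_cyl[OF that, of ?Y m] sum.remove[OF xY(2,1), of "\<lambda>z. measure N (cyl m z)"]
      by (simp add: above_eq_Un_cyl)
    have "(\<lambda>k. measure (mu G R k) (above m x)) \<longlonglongrightarrow> q ^ mlen x"
    proof (rule Lim_transform_eventually[OF cnt_ratio_tendsto[OF dom, of "mlen x"]])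
      show "\<forall>\<^sub>F k in sequentially. real (cnt M (k - mlen x)) / real (cnt M k) = measure (mu G R k) (above m x)"
        using eventually_ge_at_top[of "mlen x"] by eventually_elim (simp add: measure_mu_above[OF x(2)])
    qed
    then have "(\<lambda>k. measure (mu G R k) (above m x) - (\<Sum>z\<in>?Z. measure (mu G R k) (cyl m z)))
      \<longlonglongrightarrow> q ^ mlen x - (\<Sum>z\<in>?Z. c z)"
      using c(1) by (intro tendsto_intros) auto
    then have 1: "(\<lambda>k. measure (mu G R k) (cyl m x)) \<longlonglongrightarrow> q ^ mlen x - (\<Sum>z\<in>?Z. c z)"
      using split[OF prob_space_mu sets_mu] by simp
    have 2: "measure \<nu> (cyl m x) = q ^ mlen x - (\<Sum>z\<in>?Z. c z)" if \<nu>: "unif \<nu>" for \<nu>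
    proof -
      have "measure \<nu> (above m x) = q ^ mlen x" using \<nu> x(1) UUp_eq_above[OF x(2)] unfolding unif_def by metis
      moreover have "(\<Sum>z\<in>?Z. measure \<nu> (cyl m z)) = (\<Sum>z\<in>?Z. c z)" using c(2) \<nu> by (intro sum.cong) auto
      ultimately show ?thesis using split[of \<nu>] \<nu> by (simp add: unif_def)
    qed
    show ?case using 1 2 by blast
  qed
qed

lemma mu_clopen_tendsto:
  assumes dom: "dominant s0" and "clopen A"
  shows "\<exists>c. (\<lambda>k. measure (mu G R k) A) \<longlonglongrightarrow> c"
proof -
  obtain m P where P: "P \<subseteq> prefixes m" "A = (\<Union>x\<in>P. cyl m x)" by (rule clopen_eq_cyl[OF assms(2)])
  have "\<forall>x\<in>P. \<exists>c. (\<lambda>k. measure (mu G R k) (cyl m x)) \<longlonglongrightarrow> c"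
  proof
    fix x assume "x \<in> P"
    then have "x \<in> prefixes m" using P(1) by blast
    from mu_cyl_tendsto[OF dom this] show "\<exists>c. (\<lambda>k. measure (mu G R k) (cyl m x)) \<longlonglongrightarrow> c" by (elim exE conjE) (rule exI)
  qed
  from bchoice[OF this] obtain c where c: "\<And>x. x \<in> P \<Longrightarrow> (\<lambda>k. measure (mu G R k) (cyl m x)) \<longlonglongrightarrow> c x" by blast
  have "(\<lambda>k. \<Sum>x\<in>P. measure (mu G R k) (cyl m x)) \<longlonglongrightarrow> (\<Sum>x\<in>P. c x)"
    using c by (intro tendsto_intros) auto
  then show ?thesis unfolding P(2) measure_Un_cyl[OF prob_space_mu sets_mu P(1)] by blast
qed

text \<open>\<open>f\<close> is replaced by the step function that takes its value at the truncation
  of a sequence to depth \<open>m\<close>, a point of the same cylinder.\<close>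

lemma integral_approx:
  assumes N: "prob_space N" "sets N = sets \<B>"
    and f: "continuous_map \<T> euclideanreal f" "bounded (f ` \<M>)"
    and close: "\<And>\<xi> \<eta>. \<xi> \<in> \<M> \<Longrightarrow> \<eta> \<in> nbh \<xi> m \<Longrightarrow> \<bar>f \<eta> - f \<xi>\<bar> \<le> e"
  shows "\<bar>integral\<^sup>L N f - (\<Sum>x\<in>prefixes m. f (fac x) * measure N (cyl m x))\<bar> \<le> e"
proof -
  interpret prob_space N by fact
  have sp: "space N = \<M>" using N(2) sets_eq_imp_space_eq space_B by metis
  have meas: "f \<in> borel_measurable N"
  proof (rule borel_measurableI)
    fix U :: "real set" assume "open U"
    then have "openin \<T> {\<xi> \<in> \<M>. f \<xi> \<in> U}"
      using openin_continuous_map_preimage[OF f(1), of U] by simp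
    then have "{\<xi> \<in> \<M>. f \<xi> \<in> U} \<in> sets N" unfolding N(2) sets_B by auto
    moreover have "f -` U \<inter> space N = {\<xi> \<in> \<M>. f \<xi> \<in> U}" using sp by auto
    ultimately show "f -` U \<inter> space N \<in> sets N" by simp
  qed
  obtain b where b: "\<And>\<xi>. \<xi> \<in> \<M> \<Longrightarrow> norm (f \<xi>) \<le> b" using f(2) by (auto simp: bounded_iff)
  have int_f: "integrable N f" using meas b sp by (intro integrable_const_bound[of _ b]) auto
  define g where "g \<xi> = (\<Sum>x\<in>prefixes m. f (fac x) * indicator (cyl m x) \<xi>)" for \<xi>
  have cylN: "cyl m x \<in> sets N" for x using clopen_cyl N(2) by simp
  have int_c: "integrable N (\<lambda>\<xi>. f (fac x) * indicator (cyl m x) \<xi>)" for x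
    using cylN by (intro integrable_mult_right integrable_real_indicator) (auto simp: emeasure_eq_measure)
  have int_g: "integrable N g" unfolding g_def using int_c by (intro Bochner_Integration.integrable_sum) auto
  have "integral\<^sup>L N g = (\<Sum>x\<in>prefixes m. f (fac x) * measure N (cyl m x))"
    unfolding g_def using int_c cylN sets.sets_into_space[OF cylN]
    by (subst Bochner_Integration.integral_sum) (auto simp: Int_absorb2)
  moreover have "\<bar>integral\<^sup>L N f - integral\<^sup>L N g\<bar> \<le> e"
  proof -
    have pt: "norm (f \<xi> - g \<xi>) \<le> e" if \<xi>: "\<xi> \<in> space N" for \<xi>
    proof -
      have \<xi>M: "\<xi> \<in> \<M>" using \<xi> sp by simp
      have "g \<xi> = (\<Sum>x\<in>prefixes m. if x = prefix_prod \<xi> m then f (fac x) else 0)"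
        unfolding g_def using \<xi>M by (intro sum.cong) (auto simp: cyl_def indicator_def)
      also have "\<dots> = f (fac (prefix_prod \<xi> m))"
      proof -
        have "prefix_prod \<xi> m \<in> prefixes m" using \<xi>M by (auto simp: prefixes_def)
        then show ?thesis by simp
      qed
      finally show ?thesis using close[OF \<xi>M fac_prefix_in_nbh[OF \<xi>M]] by (simp add: abs_minus_commute)
    qed
    have "\<bar>integral\<^sup>L N f - integral\<^sup>L N g\<bar> = norm (integral\<^sup>L N (\<lambda>\<xi>. f \<xi> - g \<xi>))"
      using int_f int_g by simp
    also have "\<dots> \<le> integral\<^sup>L N (\<lambda>\<xi>. norm (f \<xi> - g \<xi>))" by (rule integral_norm_bound)
    also have "\<dots> \<le> integral\<^sup>L N (\<lambda>\<xi>. e)"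
      using int_f int_g pt by (intro integral_mono) auto
    finally show ?thesis by (simp add: prob_space)
  qed
  ultimately show ?thesis by simp
qed

lemma weak_convergence:
  assumes dom: "dominant s0" and \<nu>: "unif \<nu>"
  shows "weak_conv_top \<T> (mu G R) \<nu>"
  unfolding weak_conv_top_def topspace_T
proof (intro allI impI)
  fix f assume "continuous_map \<T> euclideanreal f \<and> bounded (f ` \<M>)"
  then have f: "continuous_map \<T> euclideanreal f" "bounded (f ` \<M>)" by auto
  show "(\<lambda>k. integral\<^sup>L (mu G R k) f) \<longlonglongrightarrow> integral\<^sup>L \<nu> f"
  proof (rule LIMSEQ_I)
    fix e :: real assume e: "0 < e"
    \<comment> \<open>Three errors of size at most \<open>d\<close>: two from step functions, one
      from the convergence of finitely many cylinder measures.\<close>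
    define d where "d = e / 4"
    have d: "0 < d" using e by (simp add: d_def)
    define Q where "Q A \<longleftrightarrow> (\<forall>\<xi>\<in>A. \<forall>\<eta>\<in>A. \<bar>f \<eta> - f \<xi>\<bar> \<le> d)" for A
    have loc: "\<exists>m. Q (nbh \<xi> m)" if \<xi>: "\<xi> \<in> \<M>" for \<xi>
    proof -
      have "openin \<T> {\<eta> \<in> \<M>. f \<eta> \<in> ball (f \<xi>) (d / 2)}"
        using openin_continuous_map_preimage[OF f(1), of "ball (f \<xi>) (d / 2)"] by simp
      then obtain m where m: "nbh \<xi> m \<subseteq> {\<eta> \<in> \<M>. f \<eta> \<in> ball (f \<xi>) (d / 2)}"
        using openin_contains_nbh[of _ \<xi>] \<xi> d by (metis (mono_tags, lifting) centre_in_ball half_gt_zero mem_Collect_eq)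
      have "Q (nbh \<xi> m)"
        unfolding Q_def
      proof (intro ballI)
        fix \<eta> \<zeta> assume "\<eta> \<in> nbh \<xi> m" "\<zeta> \<in> nbh \<xi> m"
        then have "\<bar>f \<xi> - f \<eta>\<bar> < d / 2" "\<bar>f \<xi> - f \<zeta>\<bar> < d / 2" using m by (auto simp: dist_real_def)
        then show "\<bar>f \<zeta> - f \<eta>\<bar> \<le> d" by linarith
      qed
      then show ?thesis by blast
    qed
    obtain m where m: "\<And>\<xi>. \<xi> \<in> \<M> \<Longrightarrow> Q (nbh \<xi> m)"
      by (rule uniform_nbh[of Q]) (use loc in \<open>auto simp: Q_def\<close>)
    have close: "\<bar>f \<eta> - f \<xi>\<bar> \<le> d" if "\<xi> \<in> \<M>" "\<eta> \<in> nbh \<xi> m" for \<xi> \<eta>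
      using m[OF that(1)] that nbh_self[of \<xi> m] by (auto simp: Q_def)
    let ?I = "\<lambda>N. \<Sum>x\<in>prefixes m. f (fac x) * measure N (cyl m x)"
    have "(\<lambda>k. measure (mu G R k) (cyl m x)) \<longlonglongrightarrow> measure \<nu> (cyl m x)" if "x \<in> prefixes m" for x
      using mu_cyl_tendsto[OF dom that] \<nu> by auto
    then have "(\<lambda>k. ?I (mu G R k)) \<longlonglongrightarrow> ?I \<nu>" by (intro tendsto_intros) auto
    from LIMSEQ_D[OF this d] obtain K where K: "\<And>k. k \<ge> K \<Longrightarrow> \<bar>?I (mu G R k) - ?I \<nu>\<bar> < d" by auto
    have 1: "\<bar>integral\<^sup>L (mu G R k) f - ?I (mu G R k)\<bar> \<le> d" for k
      by (rule integral_approx[OF prob_space_mu sets_mu f close])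
    have "prob_space \<nu>" "sets \<nu> = sets \<B>" using \<nu> by (auto simp: unif_def)
    then have 2: "\<bar>integral\<^sup>L \<nu> f - ?I \<nu>\<bar> \<le> d" by (rule integral_approx[OF _ _ f close])
    show "\<exists>no. \<forall>n\<ge>no. norm (integral\<^sup>L (mu G R n) f - integral\<^sup>L \<nu> f) < e"
    proof (intro exI[of _ K] allI impI)
      fix k assume "K \<le> k"
      from K[OF this] 1[of k] 2 show "norm (integral\<^sup>L (mu G R k) f - integral\<^sup>L \<nu> f) < e"
        using d unfolding real_norm_def d_def by linarith
    qed
  qed
qed

section \<open>Extension of the limit from clopen to Borel sets\<close>

lemma clopen_algebra: "algebra \<M> {A. clopen A}"
proof (rule algebra_iff_Un[THEN iffD2], intro conjI ballI)
  show "{A. clopen A} \<subseteq> Pow \<M>" using openin_subset[of \<T>] by (auto simp: clopen_def)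
  show "{} \<in> {A. clopen A}" by (simp add: clopen_def)
  show "\<M> - A \<in> {A. clopen A}" if "A \<in> {A. clopen A}" for A
    using that openin_diff[of \<T> \<M> A] closedin_diff[of \<T> \<M> A] openin_topspace[of \<T>] closedin_topspace[of \<T>]
    by (simp add: clopen_def)
  show "A \<union> B \<in> {A. clopen A}" if "A \<in> {A. clopen A}" "B \<in> {A. clopen A}" for A B
    using that by (auto simp: clopen_def)
qed

text \<open>An open set is the union over \<open>m\<close> of the parts \<open>V m\<close> made of
  its cylinders of depth \<open>m\<close>; each part is clopen, as it is decided by \<open>m\<close>
  entries.\<close>

lemma sets_B_clopen: "sets \<B> = sigma_sets \<M> {A. clopen A}"
proof (intro equalityI)
  show "sigma_sets \<M> {A. clopen A} \<subseteq> sets \<B>"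
    using sets.sigma_sets_subset[of "{A. clopen A}" \<B>] clopen_sets by (simp add: subset_iff)
  have "U \<in> sigma_sets \<M> {A. clopen A}" if U: "openin \<T> U" for U
  proof -
    define V where "V m = {\<xi> \<in> \<M>. cyl m (prefix_prod \<xi> m) \<subseteq> U}" for m
    have "U = (\<Union>m. V m)"
    proof (intro equalityI subsetI)
      fix \<xi> assume \<xi>: "\<xi> \<in> U"
      then have "\<xi> \<in> \<M>" using openin_subset[OF U] by auto
      obtain m where "nbh \<xi> m \<subseteq> U" using openin_contains_nbh[OF U \<xi>] by blast
      then show "\<xi> \<in> (\<Union>m. V m)" using cyl_eq_nbh[OF \<open>\<xi> \<in> \<M>\<close>] \<open>\<xi> \<in> \<M>\<close> by (auto simp: V_def)
    next
      fix \<xi> assume "\<xi> \<in> (\<Union>m. V m)"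
      then obtain m where "\<xi> \<in> \<M>" "cyl m (prefix_prod \<xi> m) \<subseteq> U" by (auto simp: V_def)
      then show "\<xi> \<in> U" by (auto simp: cyl_def)
    qed
    moreover have "V m \<in> sigma_sets \<M> {A. clopen A}" for m
      unfolding V_def using clopen_Collect[of "\<lambda>x. cyl m x \<subseteq> U" m] by (auto intro: sigma_sets.Basic)
    ultimately show ?thesis using sigma_sets.Union[of V] by simp
  qed
  then have "sigma_sets \<M> {U. openin \<T> U} \<subseteq> sigma_sets \<M> {A. clopen A}"
    by (intro sigma_sets_mono) auto
  then show "sets \<B> \<subseteq> sigma_sets \<M> {A. clopen A}" by (simp add: sets_B)
qed

text \<open>Compactness makes the sequence empty from some index on, so every finitely additive set
  function on clopen sets is continuous at the empty set.\<close>

lemma clopen_decreasing_empty: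
  assumes "\<And>i. clopen (A i)" "decseq A" "(\<Inter>i. A i) = {}"
  shows "\<exists>n. \<forall>i\<ge>n. A i = {}"
proof -
  have AM: "A i \<subseteq> \<M>" for i using assms(1) openin_subset by (fastforce simp: clopen_def)
  have "\<exists>F. finite F \<and> F \<subseteq> range (\<lambda>i. \<M> - A i) \<and> topspace \<T> \<subseteq> \<Union>F"
    using compact_space_T unfolding compact_space_alt
  proof (elim allE[of _ "range (\<lambda>i. \<M> - A i)"] impE)
    show "(\<forall>U\<in>range (\<lambda>i. \<M> - A i). openin \<T> U) \<and> topspace \<T> \<subseteq> \<Union> (range (\<lambda>i. \<M> - A i))"
      using assms(1,3) by (auto simp: clopen_def closedin_def)
  qed simp
  then obtain I where I: "finite I" "\<M> \<subseteq> (\<Union>i\<in>I. \<M> - A i)"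
    by (metis (no_types, lifting) finite_subset_image topspace_T)
  define n where "n = Max (insert 0 I)"
  have "A i = {}" if i: "n \<le> i" for i
  proof -
    have "A i \<subseteq> A j" if "j \<in> I" for j
      using that I(1) i assms(2) by (auto simp: n_def decseq_def)
    then show ?thesis using I(2) AM by blast
  qed
  then show ?thesis by blast
qed

lemma unif_inf_exists:
  assumes dom: "dominant s0"
  shows "\<exists>\<nu>. is_unif_inf G R \<nu>"
proof -
  define l where "l A = lim (\<lambda>k. measure (mu G R k) A)" for A
  have l: "(\<lambda>k. measure (mu G R k) A) \<longlonglongrightarrow> l A" if "clopen A" for A
    using mu_clopen_tendsto[OF dom that] convergent_LIMSEQ_iff convergentI unfolding l_def by blast
  have l0: "0 \<le> l A" if "clopen A" for A
    using l[OF that] by (rule LIMSEQ_le_const) simp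
  have l_empty: "l {} = 0" by (simp add: l_def)
  interpret algebra \<M> "{A. clopen A}" by (rule clopen_algebra)
  have "\<exists>\<mu>. (\<forall>A\<in>{A. clopen A}. \<mu> A = ennreal (l A)) \<and> measure_space \<M> (sigma_sets \<M> {A. clopen A}) \<mu>"
  proof (rule caratheodory_empty_continuous)
    show "positive {A. clopen A} (\<lambda>A. ennreal (l A))" by (simp add: positive_def l_empty)
    show "additive {A. clopen A} (\<lambda>A. ennreal (l A))"
      unfolding additive_def
    proof (intro ballI impI)
      fix A B assume AB: "A \<in> {A. clopen A}" "B \<in> {A. clopen A}" "A \<inter> B = {}"
      have "measure (mu G R k) (A \<union> B) = measure (mu G R k) A + measure (mu G R k) B" for k
      proof -
        interpret prob_space "mu G R k" by (rule prob_space_mu)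
        show ?thesis using AB by (intro finite_measure_Union) auto
      qed
      moreover have "clopen (A \<union> B)" using AB by (auto simp: clopen_def)
      ultimately have "l (A \<union> B) = l A + l B"
        using l[of "A \<union> B"] tendsto_add[OF l[of A] l[of B]] AB LIMSEQ_unique by auto
      then show "ennreal (l (A \<union> B)) = ennreal (l A) + ennreal (l B)" using l0 AB by simp
    qed
    show "ennreal (l A) \<noteq> \<infinity>" for A by simp
    fix A :: "nat \<Rightarrow> (nat \<Rightarrow> 'a list set) set"
    assume A: "range A \<subseteq> {A. clopen A}" "decseq A" "(\<Inter>i. A i) = {}"
    then obtain n where "\<forall>i\<ge>n. A i = {}" using clopen_decreasing_empty[of A] by auto
    then have "\<forall>\<^sub>F i in sequentially. 0 = ennreal (l (A i))"
      unfolding eventually_sequentially by (intro exI[of _ n]) (simp add: l_empty)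
    then show "(\<lambda>i. ennreal (l (A i))) \<longlonglongrightarrow> 0" by (rule Lim_transform_eventually[OF tendsto_const])
  qed
  then obtain \<mu> where \<mu>: "\<And>A. clopen A \<Longrightarrow> \<mu> A = ennreal (l A)" "measure_space \<M> (sets \<B>) \<mu>"
    using sets_B_clopen by auto
  define \<nu> where "\<nu> = measure_of \<M> (sets \<B>) \<mu>"
  have sB: "sigma_algebra \<M> (sets \<B>)" using sets.sigma_algebra_axioms[of \<B>] by simp
  have sets: "sets \<nu> = sets \<B>" unfolding \<nu>_def using sB by (simp add: sigma_algebra.sets_measure_of_eq)
  have space: "space \<nu> = \<M>" using sets sets_eq_imp_space_eq space_B by metis
  have em: "emeasure \<nu> A = \<mu> A" if "A \<in> sets \<B>" for A
    unfolding \<nu>_def using \<mu>(2) that sB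
    by (intro emeasure_measure_of_sigma) (auto simp: measure_space_def)
  have m: "measure \<nu> A = l A" if "clopen A" for A
    using em[of A] \<mu>(1)[OF that] that l0 by (simp add: measure_def)
  have clM: "clopen \<M>" using openin_topspace[of \<T>] closedin_topspace[of \<T>] by (simp add: clopen_def)
  have "l \<M> = 1"
  proof -
    have "measure (mu G R k) \<M> = 1" for k using prob_space.prob_space[OF prob_space_mu[of k]] by simp
    then show ?thesis by (simp add: l_def)
  qed
  then have ps: "prob_space \<nu>"
    using em[of \<M>] \<mu>(1)[OF clM] clM space by (intro prob_spaceI) simp
  interpret prob_space \<nu> by (rule ps)
  have lU: "l (UUp G R x) = q ^ mlen x" if x: "x \<in> M" for x
  proof -
    obtain j where j: "x \<in> simple_products j" using simple_products_prefix[OF x] by blast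
    have "(\<lambda>k. measure (mu G R k) (above j x)) \<longlonglongrightarrow> q ^ mlen x"
    proof (rule Lim_transform_eventually[OF cnt_ratio_tendsto[OF dom, of "mlen x"]])
      show "\<forall>\<^sub>F k in sequentially. real (cnt M (k - mlen x)) / real (cnt M k) = measure (mu G R k) (above j x)"
        using eventually_ge_at_top[of "mlen x"] by eventually_elim (simp add: measure_mu_above[OF j])
    qed
    then show ?thesis using l[OF clopen_above[of j x]] UUp_eq_above[OF j] LIMSEQ_unique by metis
  qed
  \<comment> \<open>The distributions on spheres give a point no mass once \<open>k\<close> exceeds
    its length. As \<open>M\<close> is countable, the limit measure then lives on the
    boundary.\<close>
  have l_emb: "l {emb G R x} = 0" if x: "x \<in> M" for x
  proof -
    have "\<forall>\<^sub>F k in sequentially. 0 = measure (mu G R k) {emb G R x}"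
      using eventually_gt_at_top[of "mlen x"]
    proof eventually_elim
      case (elim k)
      then have "{y \<in> Msphere G R k. emb G R y \<in> {emb G R x}} = {}"
        using emb_inj[OF _ x] by (auto simp: Msphere_def)
      then show ?case
        unfolding measure_mu[OF clopen_sets[OF clopen_emb[OF x]]] by (simp only: card.empty)
    qed
    then have "(\<lambda>k. measure (mu G R k) {emb G R x}) \<longlonglongrightarrow> 0" by (rule Lim_transform_eventually[OF tendsto_const])
    then show ?thesis using l[OF clopen_emb[OF x]] LIMSEQ_unique by blast
  qed
  have "(\<Union>x\<in>M. {emb G R x}) \<in> null_sets \<nu>"
  proof (rule null_sets_UN'[OF countable_M])
    fix x assume x: "x \<in> M"
    then show "{emb G R x} \<in> null_sets \<nu>"
      using m[OF clopen_emb[OF x]] l_emb[OF x] clopen_sets[OF clopen_emb[OF x]] sets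
      by (simp add: null_sets_def emeasure_eq_measure)
  qed
  then have null: "emb G R ` M \<in> null_sets \<nu>" by (simp add: UNION_singleton_eq_range)
  have "measure \<nu> (Up G R x) = q ^ mlen x" if x: "x \<in> M" for x
    unfolding Up_eq[OF x] using null m[OF clopen_UUp[OF x]] lU[OF x] clopen_sets[OF clopen_UUp[OF x]] sets
    by (simp add: measure_Diff_null_set)
  then show ?thesis using ps sets unfolding is_unif_inf_def by blast
qed

theorem weak_convergence_to_uniform:
  assumes "dominant s0"
  shows "(\<exists>\<nu>. is_unif_inf G R \<nu>) \<and> (\<forall>\<nu>. is_unif_inf G R \<nu> \<longrightarrow> weak_conv_top (Mbar_top G R) (mu G R) \<nu>)"
  using unif_inf_exists[OF assms] weak_convergence[OF assms is_unif_inf_unif] by blast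

end

subsection \<open>Criteria for a dominant generator\<close>

context garside
begin

lemma gen_inj: assumes "s \<in> G" "t \<in> G" "gen R s = gen R t" "C s t \<noteq> []" shows False
proof -
  have "gen R t \<preceq> gen R s \<odot> \<one>" using assms(1-3) by simp
  then have "cls R (C s t) \<preceq> \<one>" using assms by (intro gen_le_gen_mul) auto
  then have "length (C s t) \<le> 0" using le_mlen[of "cls R (C s t)" \<one>] C_lists assms(1,2) by (auto simp: mlen_cls)
  then show False using assms(4) by simp
qed

lemma gen_arrow_gen:
  assumes "x \<in> M" "t \<in> G" "x \<odot> gen R t \<notin> S" shows "x \<leadsto> gen R t"
  unfolding arrow_iff using assms gen_le_gen by metis

lemma mul_gen_arrow:
  assumes "w \<in> M" "s \<in> G" "gen R s \<odot> gen R s \<notin> S" shows "w \<odot> gen R s \<leadsto> gen R s"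
proof (rule gen_arrow_gen)
  show "w \<odot> gen R s \<odot> gen R s \<notin> S"
    using simple_right[of w "gen R s \<odot> gen R s"] assms by (auto simp: mul_assoc)
qed (use assms in auto)

abbreviation "arrows \<equiv> {(y, z). y \<in> S - {\<one>} \<and> z \<in> S - {\<one>} \<and> y \<leadsto> z}"

lemma gen_neq_unit: "gen R s \<noteq> \<one>"
  using mlen_gen[of s] mlen_unit by (metis zero_neq_one)

lemma cnt_submonoid_mono: "A \<subseteq> X \<Longrightarrow> X \<subseteq> G \<Longrightarrow> cnt (submonoid A) k \<le> cnt (submonoid X) k"
  using lists_mono[of A X] by (intro cnt_mono submonoid_subset) auto

text \<open>Since the square of a generator is never simple, every nontrivial simple element has an
  arrow to its last letter; accessibility therefore reduces to generators.\<close>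

lemma dominantI:
  assumes sq: "\<And>s. s \<in> G \<Longrightarrow> gen R s \<odot> gen R s \<notin> S" and s0: "s0 \<in> G"
    and path: "\<And>s. s \<in> G \<Longrightarrow> (gen R s, gen R s0) \<in> arrows\<^sup>*"
    and X: "G - Rset G R (gen R s0) \<subseteq> X" "X \<subseteq> G" "summable (\<lambda>k. real (cnt (submonoid X) k) * q ^ k)"
  shows "dominant s0"
  unfolding dominant_def
proof (intro conjI ballI)
  show "s0 \<in> G" "gen R s0 \<leadsto> gen R s0"
    using s0 mul_gen_arrow[of \<one> s0] sq by simp_all
  show "(y, gen R s0) \<in> arrows\<^sup>*" if y: "y \<in> S - {\<one>}" for y
  proof -
    have "y \<in> M" "y \<noteq> \<one>" using y by auto
    then obtain s w where s: "s \<in> G" "w \<in> M" "y = w \<odot> gen R s" using M_snoc by blast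
    then have "y \<leadsto> gen R s" using mul_gen_arrow sq by blast
    then have "(y, gen R s) \<in> arrows" using y s gen_neq_unit by simp
    then show ?thesis using path[OF s(1)] by (rule converse_rtrancl_into_rtrancl)
  qed
  show "summable (\<lambda>k. real (cnt (submonoid (G - Rset G R (gen R s0))) k) * q ^ k)"
  proof (rule summable_comparison_test'[OF X(3)])
    show "norm (real (cnt (submonoid (G - Rset G R (gen R s0))) k) * q ^ k) \<le> real (cnt (submonoid X) k) * q ^ k" for k
      using cnt_submonoid_mono[OF X(1,2), of k] conv_radius_q(2) by (simp add: mult_right_mono)
  qed
qed

lemma summable_submonoid_empty: "summable (\<lambda>k. real (cnt (submonoid {}) k) * q ^ k)"
proof -
  have "submonoid {} = {\<one>}" by (auto simp: munit_def)
  then show ?thesis using summable_finite[of "{0}" "\<lambda>k. real (cnt (submonoid {}) k) * q ^ k"]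
    by (simp add: cnt_unit)
qed

text \<open>All letters \<open>c\<close> can be moved to the front, so the new series is at most the
  old one times the geometric series in \<open>q\<close>.\<close>

lemma summable_submonoid_insert:
  assumes q1: "q < 1" and X: "X \<subseteq> G" and c: "c \<in> G"
    and comm: "\<And>s. s \<in> X \<Longrightarrow> gen R s \<odot> gen R c = gen R c \<odot> gen R s"
    and sum: "summable (\<lambda>k. real (cnt (submonoid X) k) * q ^ k)"
  shows "summable (\<lambda>k. real (cnt (submonoid (insert c X)) k) * q ^ k)"
proof -
  note q0 = conv_radius_q(2)
  have XM: "submonoid X \<subseteq> M" using X by (rule submonoid_subset)
  define pw where "pw i = cls R (replicate i c)" for i
  have pw: "pw i \<in> M" "mlen (pw i) = i" "pw (Suc i) = gen R c \<odot> pw i" "pw 0 = \<one>" for i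
    using c by (auto simp: pw_def mlen_cls cls_Cons munit_def)
  have comm_pw: "gen R s \<odot> pw i = pw i \<odot> gen R s" if s: "s \<in> X" for s i
  proof (induction i)
    case 0
    then show ?case using s X pw by auto
  next
    case (Suc i)
    have sM: "gen R s \<in> M" "gen R c \<in> M" using s X c by auto
    have "gen R s \<odot> pw (Suc i) = (gen R s \<odot> gen R c) \<odot> pw i" using sM pw by (simp add: mul_assoc)
    also have "\<dots> = gen R c \<odot> (gen R s \<odot> pw i)" using sM pw comm[OF s] by (simp add: mul_assoc)
    also have "\<dots> = pw (Suc i) \<odot> gen R s" unfolding Suc using sM pw by (simp add: mul_assoc)
    finally show ?case .
  qed
  have dec: "\<exists>i. \<exists>p\<in>submonoid X. cls R w = pw i \<odot> p" if "w \<in> lists (insert c X)" for w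
    using that
  proof (induction w)
    case Nil
    then show ?case using pw(4) submonoid_unit[of X] by (intro exI[of _ 0] bexI[of _ \<one>]) (auto simp: munit_def[symmetric])
  next
    case (Cons s w)
    then obtain i p where ip: "p \<in> submonoid X" "cls R w = pw i \<odot> p" by blast
    have pM: "p \<in> M" using ip XM by auto
    show ?case
    proof (cases "s = c")
      case True
      then have "cls R (s # w) = pw (Suc i) \<odot> p" using ip pw pM c by (simp add: cls_Cons mul_assoc)
      then show ?thesis using ip by blast
    next
      case False
      then have s: "s \<in> X" "gen R s \<in> M" using Cons X by auto
      have "cls R (s # w) = (gen R s \<odot> pw i) \<odot> p" using ip pw pM s by (simp add: cls_Cons mul_assoc)
      also have "\<dots> = pw i \<odot> (gen R s \<odot> p)" using comm_pw[OF s(1)] pw pM s by (simp add: mul_assoc)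
      finally show ?thesis using submonoid_mul[OF submonoid_gen[OF s(1)] ip(1)] by blast
    qed
  qed
  have cnt_le: "cnt (submonoid (insert c X)) k \<le> (\<Sum>i\<le>k. cnt (submonoid X) (k - i))" for k
  proof -
    let ?D = "SIGMA i:{..k}. {p \<in> submonoid X. mlen p = k - i}"
    have fin: "finite ?D" using XM by auto
    have "{y \<in> submonoid (insert c X). mlen y = k} \<subseteq> (\<lambda>(i, p). pw i \<odot> p) ` ?D"
    proof
      fix y assume "y \<in> {y \<in> submonoid (insert c X). mlen y = k}"
      then obtain w where w: "w \<in> lists (insert c X)" "y = cls R w" "mlen y = k" by blast
      obtain i p where ip: "p \<in> submonoid X" "y = pw i \<odot> p" "mlen y = k"
        using dec[OF w(1)] w(2,3) by metis
      have "i + mlen p = k" using ip XM pw by (metis mlen_mul subsetD)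
      then show "y \<in> (\<lambda>(i, p). pw i \<odot> p) ` ?D" using ip by (intro image_eqI[of _ _ "(i, p)"]) auto
    qed
    then have "cnt (submonoid (insert c X)) k \<le> card ?D"
      unfolding cnt_def using surj_card_le[OF fin] by blast
    also have "card ?D = (\<Sum>i\<le>k. cnt (submonoid X) (k - i))"
      unfolding cnt_def using XM by (intro card_SigmaI) auto
    finally show ?thesis .
  qed
  have "summable (\<lambda>k. \<Sum>i\<le>k. q ^ i * (real (cnt (submonoid X) (k - i)) * q ^ (k - i)))"
    using sum q0 q1 by (intro summable_Cauchy_product) (auto simp: summable_geometric)
  then show ?thesis
  proof (rule summable_comparison_test')
    fix k
    have "real (cnt (submonoid (insert c X)) k) * q ^ k \<le> real (\<Sum>i\<le>k. cnt (submonoid X) (k - i)) * q ^ k"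
      using q0 by (intro mult_right_mono of_nat_mono cnt_le) auto
    also have "\<dots> = (\<Sum>i\<le>k. q ^ i * (real (cnt (submonoid X) (k - i)) * q ^ (k - i)))"
      unfolding of_nat_sum sum_distrib_right by (intro sum.cong refl) (simp add: mult.left_commute power_add[symmetric])
    finally show "norm (real (cnt (submonoid (insert c X)) k) * q ^ k) \<le> (\<Sum>i\<le>k. q ^ i * (real (cnt (submonoid X) (k - i)) * q ^ (k - i)))"
      using q0 by simp
  qed
qed

lemma cls_Cons_le: "a \<in> G \<Longrightarrow> v \<in> lists G \<Longrightarrow> cls R (a # v) \<preceq> x \<Longrightarrow> gen R a \<preceq> x"
  unfolding cls_Cons by (meson cls_in_M dv_trans gen_in_M le_mulR)

text \<open>The lub \<open>z\<close> of all complements \<open>C s u\<close> lies in the parabolic,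
  and \<open>s\<close> times \<open>z\<close> is a multiple of \<Delta>. Were the product of
  \<open>s\<close> and \<open>t\<close> simple, \<open>t\<close> would divide \<open>z\<close>; but
  by \<open>closed\<close> every word for \<open>z\<close> is over \<open>X\<close>.\<close>

lemma not_simple_of_parabolic:
  assumes X: "lcm_closed X" and closed: "\<And>l r. (l, r) \<in> R \<Longrightarrow> set l \<subseteq> X \<longleftrightarrow> set r \<subseteq> X"
    and s: "s \<in> G" "\<And>t. t \<in> G \<Longrightarrow> C s t \<in> lists X" and t: "t \<in> G" "t \<notin> X"
  shows "gen R s \<odot> gen R t \<notin> S"
proof
  assume simple: "gen R s \<odot> gen R t \<in> S"
  have XG: "X \<subseteq> G" using X by (simp add: lcm_closed_def)
  obtain d where d: "d \<in> M" "\<Delta> = gen R s \<odot> d" using gen_le_Delta[OF s(1)] by (rule ldivE)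
  let ?F = "(\<lambda>t. cls R (C s t)) ` G"
  have FX: "?F \<subseteq> submonoid X" using s(2) by auto
  have Fd: "p \<preceq> d" if p: "p \<in> ?F" for p
  proof -
    obtain u where u: "u \<in> G" "p = cls R (C s u)" using p by blast
    show ?thesis unfolding u(2) using gen_le_gen_mul[OF u(1) s(1) d(1)] gen_le_Delta[OF u(1)] d(2) by simp
  qed
  have "\<exists>z\<in>submonoid X. (\<forall>p\<in>?F. p \<preceq> z) \<and> (\<forall>m'\<in>M. (\<forall>p\<in>?F. p \<preceq> m') \<longrightarrow> z \<preceq> m')"
    by (rule submonoid_lub[OF X finite_imageI[OF finite_G] FX d(1)]) (rule Fd)
  then obtain z where z: "z \<in> submonoid X" "\<forall>p\<in>?F. p \<preceq> z" by (elim bexE conjE) blast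
  have zM: "z \<in> M" using z(1) submonoid_subset[OF XG] by auto
  have "\<Delta> \<preceq> gen R s \<odot> z"
  proof (rule Delta_le)
    show "gen R s \<odot> z \<in> M" using zM s by simp
    fix u assume u: "u \<in> G"
    have M: "cls R (C s u) \<in> M" "cls R (C u s) \<in> M" using C_lists s u by auto
    have "gen R u \<preceq> gen R s \<odot> cls R (C s u)" using M u s by (subst gen_mul_C) auto
    moreover have "gen R s \<odot> cls R (C s u) \<preceq> gen R s \<odot> z" using z(2) u s M by (intro le_mulL) auto
    ultimately show "gen R u \<preceq> gen R s \<odot> z" using u dv_trans by blast
  qed
  moreover have "gen R s \<odot> gen R t \<in> M" "gen R s \<odot> gen R t \<preceq> \<Delta>" using simple by (simp_all only: simple_iff)
  ultimately have "gen R s \<odot> gen R t \<preceq> gen R s \<odot> z" using dv_trans by blast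
  then have tz: "gen R t \<preceq> z" using le_cancel[of "gen R s" "gen R t" z] s(1) t(1) zM by simp
  obtain w where w: "w \<in> lists X" "z = cls R w" using z(1) by blast
  have "cls R [t] \<preceq> cls R w" using tz w by (simp add: gen_def)
  then obtain v where v: "[t] @ v \<doteq> w" using cls_le_iff[of "[t]" w] t by auto
  have "set ([t] @ v) \<subseteq> X \<longleftrightarrow> set w \<subseteq> X"
    by (rule wcong_invariant[OF _ v, where P = "\<lambda>w. set w \<subseteq> X"]) (use closed in auto)
  then show False using w t by auto
qed

text \<open>Otherwise the counting constraint would hold at 3/4. That value violates it in both
  uses: the left side is 69/64 for two generators with an lcm of length 3, and 9/8 for three
  generators with a common lcm of length 2.\<close>

lemma q_less_1:
  assumes T: "T \<subseteq> G" "card T = d" and \<delta>: "\<delta> \<in> M" "mlen \<delta> = l"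
    and lcm: "\<And>s t. s \<in> T \<Longrightarrow> t \<in> T \<Longrightarrow> s \<noteq> t \<Longrightarrow> cls R (s # C s t) = \<delta>"
    and two: "\<And>s. s \<in> T \<Longrightarrow> \<exists>t\<in>T. s \<noteq> t"
    and val: "1 < real d * (3/4 - (3/4) ^ l) + (3/4) ^ l"
  shows "q < 1"
proof (rule ccontr)
  assume "\<not> q < 1"
  then have t: "3/4 < q" by simp
  have "real (card T) * (3/4 - (3/4) ^ mlen \<delta>) + (3/4) ^ mlen \<delta> \<le> 1"
  proof (rule q_constraint[OF T(1) \<delta>(1) _ _ _ t])
    show "gen R s \<preceq> \<delta>" if s: "s \<in> T" for s
    proof -
      obtain t where t: "t \<in> T" "s \<noteq> t" using two[OF s] by blast
      show ?thesis unfolding lcm[OF s t, symmetric] cls_Cons using T(1) s t C_lists[of s t] by (intro le_mulR) auto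
    qed
    show "\<delta> \<preceq> x" if *: "s \<in> T" "s' \<in> T" "s \<noteq> s'" "x \<in> M" "gen R s \<preceq> x" "gen R s' \<preceq> x" for s s' x
      unfolding lcm[OF *(1-3), symmetric] using * T(1) by (intro gen_mul_C_le) auto
  qed simp
  then show False using val T(2) \<delta>(2) by simp
qed

end

subsection \<open>The Artin presentation\<close>

definition artinC :: "(nat \<Rightarrow> nat \<Rightarrow> bool) \<Rightarrow> nat \<Rightarrow> nat \<Rightarrow> nat list" where
  "artinC E i j = (if i = j then [] else if E i j then [j, i] else [j])"

abbreviation adjacent :: "nat \<Rightarrow> nat \<Rightarrow> bool" where "adjacent i j \<equiv> j = i + 1 \<or> i = j + 1"

text \<open>Only the pattern with all three pairs adjacent is absent: it does not occur among
  integers, and three such generators (affine type A2) have no common multiple. The number 4 is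
  sufficient fuel.\<close>

lemma artin_cube_pattern:
  "list_all (\<lambda>(x, y, z). list_all (\<lambda>r. list_all (\<lambda>s. list_all (\<lambda>t.
     cube (artinC (\<lambda>i j. if {i, j} = {0, 1} then x else if {i, j} = {0, 2} then y else z)) 4 r s t)
     [0, 1, 2]) [0, 1, 2]) [0, 1, 2])
   [(False, False, False), (False, False, True), (False, True, False), (True, False, False),
    (False, True, True), (True, False, True), (True, True, False)]"
  by code_simp

text \<open>Coinciding letters are supplemented by others, so that only patterns of three distinct
  letters have to be evaluated.\<close>

lemma three_distinct: "\<exists>a b c. a \<noteq> b \<and> a \<noteq> c \<and> b \<noteq> c \<and> {r, s, t} \<subseteq> {a, b, c :: nat}"
proof -
  obtain A where A: "finite A" "card A = 3" "{r, s, t} \<subseteq> A"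
  proof -
    have "finite {r, s, t}" "card {r, s, t} \<le> 3" by (auto simp: card_insert_if)
    then show ?thesis
      using that exists_subset_between[of "{r, s, t}" 3 "{..r + s + t + 3}"] by (auto intro: finite_subset)
  qed
  then obtain a b c where "A = {a, b, c}" "a \<noteq> b" "a \<noteq> c" "b \<noteq> c" by (auto simp: card_3_iff)
  then show ?thesis using A by blast
qed

lemma artinC_pattern:
  assumes "a \<noteq> b" "a \<noteq> c" "b \<noteq> c" "E b a = E a b" "E c a = E a c" "E c b = E b c" "i \<in> {0, 1, 2}" "j \<in> {0, 1, 2}"
  shows "artinC (\<lambda>i j. if {i, j} = {0, 1} then E a b else if {i, j} = {0, 2} then E a c else E b c) i j \<in> lists {0, 1, 2} \<and>
    artinC E ((\<lambda>i. if i = 0 then a else if i = 1 then b else c) i) ((\<lambda>i. if i = 0 then a else if i = 1 then b else c) j) =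
    map (\<lambda>i. if i = 0 then a else if i = 1 then b else c)
      (artinC (\<lambda>i j. if {i, j} = {0, 1} then E a b else if {i, j} = {0, 2} then E a c else E b c) i j)"
  using assms(7,8) by (elim insertE emptyE; simp add: artinC_def doubleton_eq_iff assms(1-6) assms(1-3)[symmetric])

lemma artin_cube: "cube (artinC adjacent) 4 r s t"
proof -
  obtain a b c where abc: "a \<noteq> b" "a \<noteq> c" "b \<noteq> c" "{r, s, t} \<subseteq> {a, b, c}" using three_distinct by metis
  define \<phi> where "\<phi> i = (if i = 0 then a else if i = 1 then b else c)" for i :: nat
  let ?E = "\<lambda>i j. if {i, j} = {0, 1} then adjacent a b else if {i, j} = {0, 2} then adjacent a c else adjacent b c"
  have pat: "(adjacent a b, adjacent a c, adjacent b c) \<in> set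
    [(False, False, False), (False, False, True), (False, True, False), (True, False, False),
    (False, True, True), (True, False, True), (True, True, False)]"
  proof -
    have *: "(x, y, z) \<in> set [(False, False, False), (False, False, True), (False, True, False), (True, False, False),
      (False, True, True), (True, False, True), (True, True, False)]" if "\<not> (x \<and> y \<and> z)" for x y z
      using that by (cases x; cases y; cases z) auto
    show ?thesis by (rule *) auto
  qed
  have C: "artinC ?E i j \<in> lists {0, 1, 2} \<and> artinC adjacent (\<phi> i) (\<phi> j) = map \<phi> (artinC ?E i j)"
    if "i \<in> {0, 1, 2}" "j \<in> {0, 1, 2}" for i j
    unfolding \<phi>_def by (rule artinC_pattern) (use that abc(1-3) in auto)
  have "\<phi> ` {0, 1, 2} = {a, b, c}" by (auto simp: \<phi>_def)
  then have "r \<in> \<phi> ` {0, 1, 2}" "s \<in> \<phi> ` {0, 1, 2}" "t \<in> \<phi> ` {0, 1, 2}" using abc(4) by simp_all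
  then obtain r' s' t' where r: "r = \<phi> r'" "s = \<phi> s'" "t = \<phi> t'" "r' \<in> {0, 1, 2}" "s' \<in> {0, 1, 2}" "t' \<in> {0, 1, 2}"
    by (elim imageE) (rule that)
  have cube': "cube (artinC ?E) 4 r' s' t'"
    using bspec[OF artin_cube_pattern[unfolded list_all_iff] pat] r(4-6)
    by (simp only: split_conv list.set)
  show ?thesis unfolding r(1-3)
    by (rule cube_map[where A = "{0, 1, 2}" and C' = "artinC ?E", OF _ r(4-6) cube']) (rule C)
qed

text \<open>The sequence of pairs of strands that cross in the braid diagram of a word, with \<open>f i\<close> the
  strand currently in position \<open>i\<close>.\<close>

fun crossings :: "(nat \<Rightarrow> nat) \<Rightarrow> nat list \<Rightarrow> nat set list" where
  "crossings f [] = []"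
| "crossings f (i # w) = {f i, f (i + 1)} # crossings (f(i := f (i + 1), i + 1 := f i)) w"

fun strands :: "(nat \<Rightarrow> nat) \<Rightarrow> nat list \<Rightarrow> nat \<Rightarrow> nat" where
  "strands f [] = f"
| "strands f (i # w) = strands (f(i := f (i + 1), i + 1 := f i)) w"

lemma crossings_append: "crossings f (u @ v) = crossings f u @ crossings (strands f u) v"
  by (induction u arbitrary: f) auto

lemma strands_append: "strands f (u @ v) = strands (strands f u) v"
  by (induction u arbitrary: f) auto

text \<open>A commutation exchanges two crossings and a braid relation reverses the order of three;
  hence the passage to multisets.\<close>

lemma crossings_rel:
  assumes "(l, r) \<in> artin_rels n"
  shows "strands f l = strands f r \<and> mset (crossings f l) = mset (crossings f r)"
  using assms
  by (auto simp: artin_rels_def fun_eq_iff insert_commute add_mset_commute)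

lemma crossings_wcong:
  assumes "(u, v) \<in> wcong (artin_rels n)" shows "mset (crossings f u) = mset (crossings f v)"
  by (rule wcong_invariant[OF _ assms, where P = "\<lambda>w. mset (crossings f w)"])
    (simp add: crossings_append strands_append crossings_rel)

lemma crossings_upt: "crossings f [a..<b] = map (\<lambda>k. {f a, f (k + 1)}) [a..<b]"
proof (induction "b - a" arbitrary: a f)
  case (Suc d)
  then have ab: "[a..<b] = a # [Suc a..<b]" "d = b - Suc a" by (auto simp: upt_rec)
  have "crossings (f(a := f (a + 1), a + 1 := f a)) [Suc a..<b] =
    map (\<lambda>k. {(f(a := f (a + 1), a + 1 := f a)) (Suc a), (f(a := f (a + 1), a + 1 := f a)) (k + 1)}) [Suc a..<b]"
    by (rule Suc.hyps(1)[OF ab(2)])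
  also have "\<dots> = map (\<lambda>k. {f a, f (k + 1)}) [Suc a..<b]"
    by (rule map_cong) auto
  finally show ?case unfolding ab(1) by simp
qed simp

lemma strands_upt:
  "a \<le> b \<Longrightarrow> strands f [a..<b] i = (if a \<le> i \<and> i < b then f (i + 1) else if i = b then f a else f i)"
proof (induction "b - a" arbitrary: a f)
  case (Suc d)
  then have ab: "[a..<b] = a # [Suc a..<b]" "d = b - Suc a" "Suc a \<le> b" by (auto simp: upt_rec)
  show ?case unfolding ab(1) using Suc.hyps(1)[OF ab(2,3), of "f(a := f (a + 1), a + 1 := f a)"] ab(3)
    by auto
qed auto

text \<open>The classical word for the half twist on \<open>m + 1\<close> strands: the first strand
  is carried across all others, which are then twisted among themselves.\<close>

primrec half_twist :: "nat \<Rightarrow> nat list" where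
  "half_twist 0 = []"
| "half_twist (Suc m) = [1..<Suc (Suc m)] @ half_twist m"

lemma half_twist_set: "set (half_twist m) \<subseteq> {1..m}"
  by (induction m) auto

lemma half_twist_lists: "m < n \<Longrightarrow> half_twist m \<in> lists (artin_gens n)"
  using half_twist_set[of m] by (fastforce simp: artin_gens_def)

lemma crossings_subset:
  "set w \<subseteq> {1..m} \<Longrightarrow> A \<in> set (crossings f w) \<Longrightarrow> A \<subseteq> f ` {1..Suc m}"
proof (induction w arbitrary: f)
  case (Cons i w)
  have i: "1 \<le> i" "i \<le> m" using Cons.prems by auto
  have "(f(i := f (i + 1), i + 1 := f i)) ` {1..Suc m} \<subseteq> f ` {1..Suc m}"
    using i by auto
  moreover have "A \<subseteq> (f(i := f (i + 1), i + 1 := f i)) ` {1..Suc m}"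
    if "A \<in> set (crossings (f(i := f (i + 1), i + 1 := f i)) w)"
    by (rule Cons.IH[OF _ that]) (use Cons.prems in simp)
  moreover have "{f i, f (i + 1)} \<subseteq> f ` {1..Suc m}" using i by auto
  moreover have "A = {f i, f (i + 1)} \<or> A \<in> set (crossings (f(i := f (i + 1), i + 1 := f i)) w)"
    using Cons.prems(2) by simp
  ultimately show ?case by blast
qed simp

text \<open>In the first block the strand \<open>f 1\<close> meets every other strand once and ends
  in the last position, which the remaining letters do not touch.\<close>

lemma distinct_crossings_half_twist: "inj f \<Longrightarrow> distinct (crossings f (half_twist m))"
proof (induction m arbitrary: f)
  case (Suc m)
  define g where "g = strands f [1..<Suc (Suc m)]"
  have g: "g i = (if 1 \<le> i \<and> i < Suc (Suc m) then f (i + 1) else if i = Suc (Suc m) then f 1 else f i)" for i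
    unfolding g_def by (rule strands_upt) simp
  have "inj g"
    using Suc.prems by (intro injI) (auto simp: g inj_eq split: if_splits)
  then have 1: "distinct (crossings g (half_twist m))" by (rule Suc.IH)
  have 2: "distinct (crossings f [1..<Suc (Suc m)])"
  proof -
    have "k = l" if "{f 1, f (k + 1)} = {f 1, f (l + 1)}" for k l
      using that Suc.prems unfolding doubleton_eq_iff by (elim disjE conjE) (simp_all add: inj_eq)
    then show ?thesis unfolding crossings_upt distinct_map by (intro conjI distinct_upt inj_onI)
  qed
  have "f 1 \<in> A" if "A \<in> set (crossings f [1..<Suc (Suc m)])" for A
    using that unfolding crossings_upt by auto
  moreover have "f 1 \<notin> A" if A: "A \<in> set (crossings g (half_twist m))" for A
  proof -
    have "A \<subseteq> g ` {1..Suc m}" using crossings_subset[OF half_twist_set A] .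
    moreover have "f 1 \<notin> g ` {1..Suc m}" using Suc.prems by (auto simp: g inj_eq)
    ultimately show ?thesis by blast
  qed
  ultimately show ?case
    unfolding half_twist.simps crossings_append g_def[symmetric] distinct_append using 1 2 by blast
qed simp

lemma commute_word:
  assumes "\<And>x. x \<in> set w \<Longrightarrow> ([x, i], [i, x]) \<in> wcong R" shows "(w @ [i], i # w) \<in> wcong R"
  using assms
proof (induction w)
  case (Cons x w)
  then have "(x # (w @ [i]), x # (i # w)) \<in> wcong R" by (intro wcong_Cons) auto
  moreover have "([x, i] @ w, [i, x] @ w) \<in> wcong R" using Cons.prems by (intro wcong_appendR) auto
  ultimately show ?case using wcong_trans by fastforce
qed simp

lemma artin_commute:
  assumes "i \<in> artin_gens n" "j \<in> artin_gens n" "i + 2 \<le> j \<or> j + 2 \<le> i"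
  shows "([i, j], [j, i]) \<in> wcong (artin_rels n)"
  using assms by (intro wcong_rel) (auto simp: artin_rels_def)

text \<open>The letter \<open>i\<close> moves left past the larger letters, turns into
  \<open>i + 1\<close> by the braid relation with \<open>i\<close> and \<open>i + 1\<close>, and
  moves on past the smaller letters.\<close>

lemma artin_shift:
  assumes "1 \<le> i" "i < m" "m < n"
  shows "([1..<Suc m] @ [i], (i + 1) # [1..<Suc m]) \<in> wcong (artin_rels n)"
proof -
  let ?R = "artin_rels n"
  let ?a = "[1..<i]" and ?b = "[i + 2..<Suc m]"
  have G: "k \<in> artin_gens n" if "1 \<le> k" "k \<le> m" for k using that assms by (auto simp: artin_gens_def)
  have split: "[1..<Suc m] = ?a @ [i, i + 1] @ ?b"
  proof -
    have "[1..<Suc m] = ?a @ [i..<Suc m]" using assms upt_add_eq_append[of 1 i "Suc m - i"] by simp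
    also have "[i..<Suc m] = [i, i + 1] @ ?b" using assms by (simp add: upt_rec)
    finally show ?thesis .
  qed
  have "(?b @ [i], i # ?b) \<in> wcong ?R"
    using assms by (intro commute_word artin_commute G) auto
  then have 1: "(?a @ [i, i + 1] @ ?b @ [i], ?a @ [i, i + 1, i] @ ?b) \<in> wcong ?R"
    using wcong_appendL[of "?b @ [i]" "i # ?b" ?R "?a @ [i, i + 1]"] by (simp del: upt_Suc)
  have "([i, i + 1, i], [i + 1, i, i + 1]) \<in> wcong ?R"
    using assms G[of i] G[of "i + 1"] by (intro wcong_rel) (auto simp: artin_rels_def)
  then have 2: "(?a @ [i, i + 1, i] @ ?b, ?a @ [i + 1, i, i + 1] @ ?b) \<in> wcong ?R" by (rule wcong_ctx)
  have "(?a @ [i + 1], (i + 1) # ?a) \<in> wcong ?R"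
    using assms by (intro commute_word artin_commute G) auto
  then have 3: "(?a @ [i + 1, i, i + 1] @ ?b, (i + 1) # ?a @ [i, i + 1] @ ?b) \<in> wcong ?R"
    using wcong_appendR[of "?a @ [i + 1]" "(i + 1) # ?a" ?R "[i, i + 1] @ ?b"] by (simp del: upt_Suc)
  have "(?a @ [i, i + 1] @ ?b @ [i], (i + 1) # ?a @ [i, i + 1] @ ?b) \<in> wcong ?R"
    using wcong_trans[OF wcong_trans[OF 1 2] 3] .
  then show ?thesis unfolding split by simp
qed

text \<open>The word begins with 1. A larger \<open>i\<close> comes from the divisor
  \<open>i - 1\<close> of the shorter half twist, raised by one when pulled through the first
  block.\<close>

lemma half_twist_multiple:
  assumes "m < n" "i \<in> {1..m}"
  shows "\<exists>v\<in>lists (artin_gens n). (i # v, half_twist m) \<in> wcong (artin_rels n)"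
  using assms
proof (induction m arbitrary: i)
  case (Suc m)
  have lists: "[1..<Suc (Suc m)] \<in> lists (artin_gens n)" "half_twist m \<in> lists (artin_gens n)"
    using Suc.prems half_twist_lists[of m n] by (auto simp: artin_gens_def)
  show ?case
  proof (cases "i = 1")
    case True
    have "[1..<Suc (Suc m)] = 1 # [2..<Suc (Suc m)]" by (simp add: upt_rec numeral_2_eq_2)
    then show ?thesis using True lists by (intro bexI[of _ "[2..<Suc (Suc m)] @ half_twist m"]) auto
  next
    case False
    define j where "j = i - 1"
    have j: "i = j + 1" "1 \<le> j" "j < Suc m" "j \<in> {1..m}" using False Suc.prems by (auto simp: j_def)
    obtain v where v: "v \<in> lists (artin_gens n)" "(j # v, half_twist m) \<in> wcong (artin_rels n)"
      using Suc.IH[OF _ j(4)] Suc.prems by auto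
    have "((i # [1..<Suc (Suc m)]) @ v, ([1..<Suc (Suc m)] @ [j]) @ v) \<in> wcong (artin_rels n)"
    proof (rule wcong_appendR, rule wcong_sym)
      show "([1..<Suc (Suc m)] @ [j], i # [1..<Suc (Suc m)]) \<in> wcong (artin_rels n)"
        unfolding j(1) by (rule artin_shift) (use j Suc.prems in auto)
    qed
    moreover have "([1..<Suc (Suc m)] @ j # v, [1..<Suc (Suc m)] @ half_twist m) \<in> wcong (artin_rels n)"
      using v(2) by (rule wcong_appendL)
    ultimately have "(i # [1..<Suc (Suc m)] @ v, half_twist (Suc m)) \<in> wcong (artin_rels n)"
      using wcong_trans[of "i # [1..<Suc (Suc m)] @ v" "[1..<Suc (Suc m)] @ j # v"] by (simp del: upt_Suc)
    then show ?thesis using lists v by (intro bexI[of _ "[1..<Suc (Suc m)] @ v"]) (auto simp del: upt_Suc)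
  qed
qed simp

lemma artin_complemented: assumes "n \<ge> 2" shows "complemented (artin_gens n) (artin_rels n) (artinC adjacent)"
proof
  show "finite (artin_gens n)" "artin_gens n \<noteq> {}" using assms by (auto simp: artin_gens_def)
  show "l \<in> lists (artin_gens n) \<and> r \<in> lists (artin_gens n) \<and> length l = length r" if "(l, r) \<in> artin_rels n" for l r
    using that by (auto simp: artin_rels_def)
  show "artinC adjacent s t \<in> lists (artin_gens n)" if "s \<in> artin_gens n" "t \<in> artin_gens n" for s t
    using that by (auto simp: artinC_def)
  show "artinC adjacent s s = []" for s by (simp add: artinC_def)
  show "(s # artinC adjacent s t, t # artinC adjacent t s) \<in> wcong (artin_rels n)"
    if st: "s \<in> artin_gens n" "t \<in> artin_gens n" for s t
  proof (cases "adjacent s t")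
    case True
    then have "([s, t, s], [t, s, t]) \<in> artin_rels n" using st by (auto simp: artin_rels_def)
    then show ?thesis using True wcong_rel by (auto simp: artinC_def)
  next
    case False
    then have "s = t \<or> s + 2 \<le> t \<or> t + 2 \<le> s" by auto
    then show ?thesis using artin_commute[OF st] False by (auto simp: artinC_def)
  qed
  show "\<exists>s\<in>artin_gens n. \<exists>t\<in>artin_gens n. l = s # artinC adjacent s t \<and> r = t # artinC adjacent t s"
    if "(l, r) \<in> artin_rels n" for l r
    using that unfolding artin_rels_def artinC_def by fastforce
  show "\<exists>k. cube (artinC adjacent) k r s t" for r s t using artin_cube by blast
qed

locale artin =
  fixes n :: nat
  assumes n: "n \<ge> 2"
begin

abbreviation artin_mul (infixl "\<odot>" 70) where "x \<odot> y \<equiv> mmult (artin_rels n) x y"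
abbreviation artin_unit ("\<one>") where "\<one> \<equiv> munit (artin_rels n)"
abbreviation artin_le (infix "\<preceq>" 50) where "x \<preceq> y \<equiv> ldiv (artin_gens n) (artin_rels n) x y"
abbreviation artin_equivalent (infix "\<doteq>" 50) where "u \<doteq> v \<equiv> (u, v) \<in> wcong (artin_rels n)"
abbreviation artin_arr (infix "\<leadsto>" 50) where "x \<leadsto> y \<equiv> arrow (artin_gens n) (artin_rels n) x y"

lemma artin_garside: "garside (artin_gens n) (artin_rels n) (artinC adjacent)"
proof -
  interpret complemented "artin_gens n" "artin_rels n" "artinC adjacent" using artin_complemented[OF n] .
  show ?thesis
  proof
    have "half_twist (n - 1) \<in> lists (artin_gens n)" using half_twist_lists[of "n - 1" n] n by simp
    moreover have "gen (artin_rels n) s \<preceq> cls (artin_rels n) (half_twist (n - 1))" if "s \<in> artin_gens n" for s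
      unfolding gen_def using half_twist_multiple[of "n - 1" n s] that n
      by (subst cls_le_iff) (auto simp: artin_gens_def)
    ultimately show "\<exists>D\<in>M. \<forall>s\<in>artin_gens n. gen (artin_rels n) s \<preceq> D" by blast
    show "\<exists>a\<in>artin_gens n. \<exists>b\<in>artin_gens n. \<exists>v\<in>lists (artin_gens n). artinC adjacent s t @ v = a # artinC adjacent a b"
      if st: "s \<in> artin_gens n" "t \<in> artin_gens n" for s t
    proof (cases "adjacent s t")
      case True
      then show ?thesis using st by (intro bexI[of _ t] bexI[of _ s] bexI[of _ "[t]"]) (auto simp: artinC_def)
    next
      case False
      then show ?thesis using st
        by (intro bexI[of _ t] bexI[of _ t] bexI[of _ "if s = t then [t] else []"]) (auto simp: artinC_def)
    qed
  qed
qed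

lemma artin_dominant: "garside.dominant (artin_gens n) (artin_rels n) 1"
proof -
  interpret garside "artin_gens n" "artin_rels n" "artinC adjacent" using artin_garside .
  let ?G = "artin_gens n" let ?R = "artin_rels n"
  have G: "k \<in> ?G \<longleftrightarrow> 1 \<le> k \<and> k < n" for k using n by (auto simp: artin_gens_def)
  \<comment> \<open>A square makes the same two strands cross twice, whereas in the half twist, a
    multiple of \<Delta>, every pair crosses at most once.\<close>
  have sq: "gen ?R s \<odot> gen ?R s \<notin> S" if s: "s \<in> ?G" for s
  proof
    assume "gen ?R s \<odot> gen ?R s \<in> S"
    moreover have "half_twist (n - 1) \<in> lists ?G" using half_twist_lists[of "n - 1" n] n by simp
    moreover have "\<Delta> \<preceq> cls ?R (half_twist (n - 1))"
    proof (rule Delta_le)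
      show "gen ?R s \<preceq> cls ?R (half_twist (n - 1))" if "s \<in> ?G" for s
        unfolding gen_def using half_twist_multiple[of "n - 1" n s] that n
        by (subst cls_le_iff) (auto simp: artin_gens_def)
    qed (use \<open>half_twist (n - 1) \<in> lists ?G\<close> in auto)
    moreover have "gen ?R s \<odot> gen ?R s = cls ?R [s, s]" by (simp add: gen_def mmult_cls)
    ultimately have "cls ?R [s, s] \<preceq> cls ?R (half_twist (n - 1))"
      using dv_trans[of "cls ?R [s, s]" \<Delta> "cls ?R (half_twist (n - 1))"] by (simp only: simple_iff)
    then obtain v where "[s, s] @ v \<doteq> half_twist (n - 1)" using s by (subst (asm) cls_le_iff) auto
    then have "mset (crossings id ([s, s] @ v)) = mset (crossings id (half_twist (n - 1)))"
      by (rule crossings_wcong)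
    from iffD2[OF mset_eq_imp_distinct_iff[OF this]]
    have "distinct (crossings id ([s, s] @ v))" using distinct_crossings_half_twist[OF inj_on_id] by blast
    then show False by (simp add: insert_commute)
  qed
  have neq: "gen ?R s \<noteq> gen ?R t" if "s \<in> ?G" "t \<in> ?G" "s \<noteq> t" for s t
  proof
    assume "gen ?R s = gen ?R t"
    moreover have "artinC adjacent s t \<noteq> []" using that(3) by (simp add: artinC_def)
    ultimately show False by (rule gen_inj[OF that(1,2)])
  qed
  \<comment> \<open>The path passes through the simple element \<open>?y\<close>: the only generator
    dividing it from the left is \<open>i + 1\<close>, and it ends with \<open>i\<close>.\<close>
  have step: "(gen ?R (i + 1), gen ?R i) \<in> arrows\<^sup>*" if i: "1 \<le> i" "i + 1 < n" for i
  proof -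
    let ?y = "gen ?R (i + 1) \<odot> gen ?R i"
    have iG: "i \<in> ?G" "i + 1 \<in> ?G" using i by (auto simp: G)
    have yM: "?y \<in> M" using iG by simp
    have "cls ?R ((i + 1) # artinC adjacent (i + 1) i) \<preceq> \<Delta>"
      using iG gen_le_Delta by (intro gen_mul_C_le) auto
    moreover have "cls ?R ((i + 1) # artinC adjacent (i + 1) i) = ?y \<odot> gen ?R (i + 1)"
      by (simp add: artinC_def gen_def mmult_cls)
    ultimately have "?y \<odot> gen ?R (i + 1) \<in> S" using yM iG by (simp only: simple_iff) simp
    then have yS: "?y \<in> S" by (rule simple_left[OF yM gen_in_M[OF iG(2)]])
    have y1: "?y \<noteq> \<one>"
    proof
      assume "?y = \<one>"
      then have "mlen ?y = 0" by simp
      then show False using iG by simp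
    qed
    have "gen ?R (i + 1) \<leadsto> ?y"
      unfolding arrow_iff
    proof (intro ballI impI)
      fix t assume t: "t \<in> ?G" "gen ?R t \<preceq> ?y"
      have "t = i + 1"
      proof (rule ccontr)
        assume ne: "t \<noteq> i + 1"
        let ?c = "artinC adjacent (i + 1) t"
        have le: "cls ?R ?c \<preceq> gen ?R i" using gen_le_gen_mul[OF t(1) iG(2) _ t(2)] iG by simp
        have c: "?c \<in> lists ?G" using C_lists iG t by blast
        have "length ?c \<le> 1" using le_mlen[OF cls_in_M[OF c] le] by (simp add: mlen_cls)
        then have "?c = [t]" "t \<noteq> i" using ne by (auto simp: artinC_def split: if_splits)
        then have "gen ?R t \<preceq> gen ?R i" using le by (simp add: gen_def)
        then show False using gen_le_gen[OF t(1) iG(1)] neq[OF t(1) iG(1)] \<open>t \<noteq> i\<close> by blast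
      qed
      then show "gen ?R (i + 1) \<odot> gen ?R t \<notin> S" using sq[OF iG(2)] by simp
    qed
    then have 1: "(gen ?R (i + 1), ?y) \<in> arrows" using yS y1 iG gen_neq_unit by simp
    have "?y \<leadsto> gen ?R i" using iG sq by (intro mul_gen_arrow) auto
    then have 2: "(?y, gen ?R i) \<in> arrows" using yS y1 iG gen_neq_unit by simp
    show ?thesis using rtrancl_trans[OF r_into_rtrancl[OF 1] r_into_rtrancl[OF 2]] .
  qed
  have path: "(gen ?R s, gen ?R 1) \<in> arrows\<^sup>*" if "s \<in> ?G" for s
    using that
  proof (induction s)
    case (Suc i)
    show ?case
    proof (cases "i = 0")
      case False
      then have "(gen ?R (Suc i), gen ?R i) \<in> arrows\<^sup>*" using step[of i] Suc.prems by (simp add: G)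
      moreover have "(gen ?R i, gen ?R 1) \<in> arrows\<^sup>*" using Suc False by (simp add: G)
      ultimately show ?thesis by (rule rtrancl_trans)
    qed simp
  qed (simp add: G)
  have q1: "q < 1" if n3: "3 \<le> n"
  proof (rule q_less_1[of "{1, 2}" 2 "cls ?R [1, 2, 1]" 3])
    have "[1, 2, 1] \<doteq> [2, 1, 2]" using n3 by (intro wcong_rel) (auto simp: artin_rels_def artin_gens_def)
    then have eq: "cls ?R [2, 1, 2] = cls ?R [1, 2, 1]" by (simp only: cls_eq_iff wcong_sym)
    have c: "artinC adjacent 1 2 = [2, 1]" "artinC adjacent 2 1 = [1, 2]" by (simp_all add: artinC_def)
    show "cls ?R (s # artinC adjacent s t) = cls ?R [1, 2, 1]" if st: "s \<in> {1, 2}" "t \<in> {1, 2}" "s \<noteq> t" for s t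
    proof -
      consider "s = 1" "t = 2" | "s = 2" "t = 1" using st by auto
      then show ?thesis by cases (simp_all only: c eq)
    qed
    show "cls ?R [1, 2, 1] \<in> M" using n3 by (intro cls_in_M) (auto simp: G)
  qed (use n3 in \<open>auto simp: G mlen_cls field_simps power3_eq_cube\<close>)
  \<comment> \<open>Descent in \<open>p\<close>. The stepping stone \<open>?Y\<close> trades
    \<open>p\<close> for \<open>p - 1\<close>, which commutes with everything beyond
    \<open>p\<close>; room for \<open>p - 1\<close> is the reason for starting at 2.\<close>
  have summ: "summable (\<lambda>k. real (cnt (submonoid {p..n - 1}) k) * q ^ k)" if "2 \<le> p" "p \<le> n" for p
    using that
  proof (induction "n - p" arbitrary: p)
    case 0
    then have "{p..n - 1} = {}" by auto
    then show ?case using summable_submonoid_empty by simp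
  next
    case (Suc d)
    have p: "p < n" "1 \<le> p - 1" "p - 1 < n" using Suc by auto
    have pG: "p \<in> ?G" "p - 1 \<in> ?G" using p Suc.prems by (auto simp: G)
    let ?X = "{p + 1..n - 1}" let ?Y = "insert (p - 1) ?X"
    have XG: "?X \<subseteq> ?G" "?Y \<subseteq> ?G" "{p..n - 1} \<subseteq> ?G" using p by (auto simp: G)
    have X: "summable (\<lambda>k. real (cnt (submonoid ?X) k) * q ^ k)" using Suc.hyps(1)[of "p + 1"] Suc.hyps(2) Suc.prems p by auto
    show ?case
    proof (rule summable_submonoid_step[where Y = ?Y and w = "gen ?R (p - 1) \<odot> gen ?R p"])
      show "lcm_closed {p..n - 1}" unfolding lcm_closed_def using XG by (auto simp: artinC_def)
      show "summable (\<lambda>k. real (cnt (submonoid ?Y) k) * q ^ k)"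
      proof (rule summable_submonoid_insert[OF q1 XG(1) pG(2) _ X])
        show "3 \<le> n" using p by simp
        show "gen ?R s \<odot> gen ?R (p - 1) = gen ?R (p - 1) \<odot> gen ?R s" if "s \<in> ?X" for s
          using artin_commute[of s n "p - 1"] that p by (auto simp: gen_def mmult_cls cls_eq_iff G)
      qed
      \<comment> \<open>If \<open>p\<close> divided the product, \<open>p - 1\<close> would divide
        \<open>x\<close>; a divisor beyond \<open>p\<close> passes through both letters and divides
        \<open>x\<close> itself. Both contradict the choice of \<open>?Y\<close>.\<close>
      show "gen ?R (p - 1) \<odot> gen ?R p \<odot> x \<in> free {p..n - 1}" if x: "x \<in> free ?Y" for x
      proof -
        have xM: "x \<in> M" using x by (simp add: free_def)
        have nx: "\<not> gen ?R s \<preceq> x" if "s \<in> ?Y" for s using x that unfolding free_def by blast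
        have no: False if s: "s \<in> {p..n - 1}" "gen ?R s \<preceq> gen ?R (p - 1) \<odot> (gen ?R p \<odot> x)" for s
        proof -
          have sG: "s \<in> ?G" using s XG by auto
          have 1: "cls ?R (artinC adjacent (p - 1) s) \<preceq> gen ?R p \<odot> x"
            using gen_le_gen_mul[OF sG pG(2) _ s(2)] pG xM by simp
          show False
          proof (cases "s = p")
            case True
            then have "cls ?R (artinC adjacent (p - 1) s) = gen ?R p \<odot> gen ?R (p - 1)"
              using p by (auto simp: artinC_def gen_def mmult_cls)
            then have "gen ?R (p - 1) \<preceq> x" using 1 le_cancel[of "gen ?R p"] pG xM by simp
            then show False using nx by simp
          next
            case False
            then have sp: "p + 1 \<le> s" "s \<in> ?X" using s by auto
            then have "cls ?R (artinC adjacent (p - 1) s) = gen ?R s"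
              using p by (auto simp: artinC_def gen_def)
            then have "cls ?R (artinC adjacent p s) \<preceq> x" using 1 gen_le_gen_mul[OF sG pG(1) xM] by simp
            moreover have "\<exists>v\<in>lists ?G. artinC adjacent p s = s # v" using sp pG by (auto simp: artinC_def)
            ultimately have "gen ?R s \<preceq> x" using cls_Cons_le[OF sG] by metis
            then show False using nx sp by simp
          qed
        qed
        have eq: "gen ?R (p - 1) \<odot> gen ?R p \<odot> x = gen ?R (p - 1) \<odot> (gen ?R p \<odot> x)"
          using pG xM by (intro mul_assoc) auto
        have "gen ?R (p - 1) \<odot> (gen ?R p \<odot> x) \<in> M" using pG xM by simp
        then show ?thesis unfolding eq free_def using no by blast
      qed
    qed (use XG pG in auto)
  qed
  show ?thesis
  proof (rule dominantI[OF sq _ path])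
    show "1 \<in> ?G" using n by (simp add: G)
    show "?G - Rset ?G ?R (gen ?R 1) \<subseteq> {2..n - 1}"
      using sq[of 1] n by (auto simp: Rset_def artin_gens_def Suc_le_eq le_less)
    show "{2..n - 1} \<subseteq> ?G" by (auto simp: artin_gens_def)
    show "summable (\<lambda>k. real (cnt (submonoid {2..n - 1}) k) * q ^ k)" using summ[of 2] n by simp
  qed
qed

end

subsection \<open>The dual presentation\<close>

text \<open>For crossing chords this is the complement given by the derived relation
  \<open>a\<^sub>1\<^sub>3 a\<^sub>1\<^sub>2 a\<^sub>3\<^sub>4 = a\<^sub>2\<^sub>4 a\<^sub>1\<^sub>4 a\<^sub>2\<^sub>3\<close>.\<close>

definition dualC :: "nat \<times> nat \<Rightarrow> nat \<times> nat \<Rightarrow> (nat \<times> nat) list" where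
  "dualC s t = (case s of (i, j) \<Rightarrow> case t of (k, l) \<Rightarrow>
     if i = k \<and> j = l then []
     else if i < k \<and> k < j \<and> j < l then [(i, k), (j, l)]
     else if k < i \<and> i < l \<and> l < j then [(k, j), (i, l)]
     else if i = l then [(k, j)]
     else if j = l \<and> i < k then [(i, k)]
     else if i = k \<and> j < l then [(j, l)]
     else [(k, l)])"

definition chords6 :: "(nat \<times> nat) list" where
  "chords6 = [(i, j). i \<leftarrow> [0..<6], j \<leftarrow> [Suc i..<6]]"

lemma dual_cube6: "list_all (\<lambda>r. list_all (\<lambda>s. list_all (\<lambda>t. cube dualC 4 r s t) chords6) chords6) chords6"
  by code_simp

lemma in_chords6: "(i, j) \<in> set chords6 \<longleftrightarrow> i < j \<and> j < 6"
  by (auto simp: chords6_def intro!: bexI[of _ i])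

text \<open>Three chords have at most six endpoints, and complements only depend on the relative order of
  endpoints.\<close>

lemma dual_cube:
  assumes "fst r < snd r" "fst s < snd s" "fst t < snd t"
  shows "cube dualC 4 r s t"
proof -
  define P where "P = {fst r, snd r, fst s, snd s, fst t, snd t}"
  define xs where "xs = sorted_list_of_set P"
  have "finite P" by (simp add: P_def)
  then have xs: "sorted_wrt (<) xs" "set xs = P" "length xs = card P"
    by (simp_all add: xs_def)
  have len: "length xs \<le> 6" unfolding xs(3) P_def by (simp add: card_insert_if)
  define A where "A = {(i, j). i < j \<and> j < length xs}"
  define \<phi> where "\<phi> = map_prod ((!) xs) ((!) xs)"
  have less: "xs ! i < xs ! j \<longleftrightarrow> i < j" and eq: "xs ! i = xs ! j \<longleftrightarrow> i = j" if "i < length xs" "j < length xs" for i j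
    using sorted_wrt_nth_less[OF xs(1), of i j] sorted_wrt_nth_less[OF xs(1), of j i] that by (metis less_asym' nat_neq_iff less_irrefl)+
  have C: "dualC a b \<in> lists A \<and> dualC (\<phi> a) (\<phi> b) = map \<phi> (dualC a b)" if "a \<in> A" "b \<in> A" for a b
    using that by (cases a; cases b) (auto simp: dualC_def A_def \<phi>_def less eq)
  have pre: "\<exists>a\<in>A. c = \<phi> a" if c: "fst c < snd c" "fst c \<in> P" "snd c \<in> P" for c
  proof -
    obtain i j where ij: "i < length xs" "fst c = xs ! i" "j < length xs" "snd c = xs ! j"
      using c(2,3) xs(2) by (metis in_set_conv_nth)
    then have "i < j" using less c(1) by simp
    then show ?thesis using ij by (intro bexI[of _ "(i, j)"]) (auto simp: A_def \<phi>_def prod_eq_iff)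
  qed
  obtain a b c where abc: "a \<in> A" "b \<in> A" "c \<in> A" "r = \<phi> a" "s = \<phi> b" "t = \<phi> c"
    using pre[of r] pre[of s] pre[of t] assms by (auto simp: P_def)
  have "A \<subseteq> set chords6" using len by (auto simp: A_def in_chords6)
  then have "a \<in> set chords6" "b \<in> set chords6" "c \<in> set chords6" using abc(1-3) by auto
  then have cube: "cube dualC 4 a b c"
    using dual_cube6 unfolding list_all_iff by blast
  show ?thesis unfolding abc(4-6) by (rule cube_map[where A = A and C' = dualC, OF _ abc(1-3) cube]) (rule C)
qed

lemma dual_gens_iff: "(i, j) \<in> dual_gens n \<longleftrightarrow> 1 \<le> i \<and> i < j \<and> j \<le> n"
  by (auto simp: dual_gens_def)

lemma sg_less: "a < b \<Longrightarrow> sg a b = (a, b)" "a < b \<Longrightarrow> sg b a = (a, b)"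
  by (auto simp: sg_def)

lemma dual_relsE:
  assumes "(u, v) \<in> dual_rels n"
  obtains (tri1) i j k where "1 \<le> i" "i < j" "j < k" "k \<le> n" "u = [(i, j), (j, k)]" "v = [(j, k), (i, k)]"
    | (tri2) i j k where "1 \<le> i" "i < j" "j < k" "k \<le> n" "u = [(j, k), (i, k)]" "v = [(i, k), (i, j)]"
    | (comm1) i j k l where "1 \<le> i" "i < j" "j < k" "k < l" "l \<le> n" "u = [(i, j), (k, l)]" "v = [(k, l), (i, j)]"
    | (comm2) i j k l where "1 \<le> i" "i < k" "k < l" "l < j" "j \<le> n" "u = [(i, j), (k, l)]" "v = [(k, l), (i, j)]"
proof -
  note assms[unfolded dual_rels_def Un_iff mem_Collect_eq prod.inject]
  then show ?thesis
  proof (elim disjE exE conjE)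
    fix i j k assume "u = [sg i j, sg j k]" "v = [sg j k, sg k i]" "1 \<le> i" "i < j" "j < k" "k \<le> n"
    then show ?thesis by (intro tri1[of i j k]) (simp_all add: sg_less)
  next
    fix i j k assume "u = [sg j k, sg k i]" "v = [sg k i, sg i j]" "1 \<le> i" "i < j" "j < k" "k \<le> n"
    then show ?thesis by (intro tri2[of i j k]) (simp_all add: sg_less)
  next
    fix i j k l assume "u = [sg i j, sg k l]" "v = [sg k l, sg i j]" "1 \<le> i" "i < j" "j < k" "k < l" "l \<le> n"
    then show ?thesis by (intro comm1[of i j k l]) (simp_all add: sg_less)
  next
    fix i j k l assume "u = [sg i j, sg k l]" "v = [sg k l, sg i j]" "1 \<le> i" "i < k" "k < l" "l < j" "j \<le> n"
    then show ?thesis by (intro comm2[of i k l j]) (simp_all add: sg_less)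
  qed
qed

lemma dual_triangle:
  assumes "1 \<le> i" "i < j" "j < k" "k \<le> n"
  shows "([(i, j), (j, k)], [(j, k), (i, k)]) \<in> wcong (dual_rels n)"
    and "([(j, k), (i, k)], [(i, k), (i, j)]) \<in> wcong (dual_rels n)"
    and "([(i, j), (j, k)], [(i, k), (i, j)]) \<in> wcong (dual_rels n)"
proof -
  have "([sg i j, sg j k], [sg j k, sg k i]) \<in> dual_rels n" "([sg j k, sg k i], [sg k i, sg i j]) \<in> dual_rels n"
    using assms unfolding dual_rels_def by blast+
  then show 1: "([(i, j), (j, k)], [(j, k), (i, k)]) \<in> wcong (dual_rels n)"
    and 2: "([(j, k), (i, k)], [(i, k), (i, j)]) \<in> wcong (dual_rels n)"
    using assms by (simp_all add: sg_less wcong_rel)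
  show "([(i, j), (j, k)], [(i, k), (i, j)]) \<in> wcong (dual_rels n)" using wcong_trans[OF 1 2] .
qed

lemma dual_commute:
  assumes "1 \<le> i" "i < j" "j \<le> n" "1 \<le> k" "k < l" "l \<le> n" "j < k \<or> l < i \<or> (i < k \<and> l < j) \<or> (k < i \<and> j < l)"
  shows "([(i, j), (k, l)], [(k, l), (i, j)]) \<in> wcong (dual_rels n)"
proof -
  have *: "([(i, j), (k, l)], [(k, l), (i, j)]) \<in> wcong (dual_rels n)"
    if "1 \<le> i" "i < j" "j \<le> n" "1 \<le> k" "k < l" "l \<le> n" "j < k \<or> (i < k \<and> l < j)" for i j k l
  proof -
    have "([sg i j, sg k l], [sg k l, sg i j]) \<in> dual_rels n"
      using that unfolding dual_rels_def by blast
    then show ?thesis using that by (simp add: sg_less wcong_rel)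
  qed
  show ?thesis using *[of i j k l] wcong_sym[OF *[of k l i j]] assms by blast
qed

text \<open>Three triangle relations, by way of the word that follows the path i, k, j, l around the
  quadrilateral.\<close>

lemma dual_crossing:
  assumes "1 \<le> i" "i < k" "k < j" "j < l" "l \<le> n"
  shows "([(i, j), (i, k), (j, l)], [(k, l), (i, l), (k, j)]) \<in> wcong (dual_rels n)"
proof -
  let ?R = "dual_rels n"
  have 1: "([(i, j), (i, k), (j, l)], [(i, k), (k, j), (j, l)]) \<in> wcong ?R"
    using wcong_appendR[OF wcong_sym[OF dual_triangle(3)[of i k j n]], of "[(j, l)]"] assms by simp
  have 2: "([(i, k), (k, j), (j, l)], [(i, k), (k, l), (k, j)]) \<in> wcong ?R"
    using wcong_appendL[OF dual_triangle(3)[of k j l n], of "[(i, k)]"] assms by simp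
  have 3: "([(i, k), (k, l), (k, j)], [(k, l), (i, l), (k, j)]) \<in> wcong ?R"
    using wcong_appendR[OF dual_triangle(1)[of i k l n], of "[(k, j)]"] assms by simp
  show ?thesis using wcong_trans[OF 1 wcong_trans[OF 2 3]] .
qed

lemma dualC_equiv:
  assumes "s \<in> dual_gens n" "t \<in> dual_gens n"
  shows "(s # dualC s t, t # dualC t s) \<in> wcong (dual_rels n)"
proof -
  obtain i j k l where st: "s = (i, j)" "t = (k, l)" by (cases s; cases t)
  have ij: "1 \<le> i" "i < j" "j \<le> n" "1 \<le> k" "k < l" "l \<le> n" using assms st by (auto simp: dual_gens_iff)
  have comm: ?thesis if c: "j < k \<or> l < i \<or> (i < k \<and> l < j) \<or> (k < i \<and> j < l)"
  proof -
    have "dualC s t = [t]" "dualC t s = [s]" using ij c by (auto simp: st dualC_def)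
    then show ?thesis using dual_commute[OF ij c] by (simp add: st)
  qed
  consider (lt) "i < k" | (eq) "i = k" | (gt) "k < i" by linarith
  then show ?thesis
  proof cases
    case lt
    consider "j < k" | "j = k" | "k < j" "j < l" | "j = l" | "l < j" by linarith
    then show ?thesis
    proof cases
      case 2 then show ?thesis using dual_triangle(1)[of i j l n] ij by (simp add: st dualC_def)
    next
      case 3 then show ?thesis using dual_crossing[of i k j l n] ij lt by (simp add: st dualC_def)
    next
      case 4 then show ?thesis using wcong_sym[OF dual_triangle(2)[of i k j n]] ij lt by (simp add: st dualC_def)
    qed (use comm lt in auto)
  next
    case eq
    consider "j = l" | "j < l" | "l < j" by linarith
    then show ?thesis
    proof cases
      case 1 then show ?thesis using eq by (simp add: st)
    next
      case 2 then show ?thesis using dual_triangle(3)[of i j l n] ij eq by (simp add: st dualC_def)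
    next
      case 3 then show ?thesis using wcong_sym[OF dual_triangle(3)[of i l j n]] ij eq by (simp add: st dualC_def)
    qed
  next
    case gt
    consider "l < i" | "l = i" | "i < l" "l < j" | "l = j" | "j < l" by linarith
    then show ?thesis
    proof cases
      case 2 then show ?thesis using wcong_sym[OF dual_triangle(1)[of k l j n]] ij by (simp add: st dualC_def)
    next
      case 3 then show ?thesis using wcong_sym[OF dual_crossing[of k i l j n]] ij gt by (simp add: st dualC_def)
    next
      case 4 then show ?thesis using dual_triangle(2)[of k i j n] ij gt by (simp add: st dualC_def)
    qed (use comm gt in auto)
  qed
qed

lemma dual_complemented: assumes "n \<ge> 2" shows "complemented (dual_gens n) (dual_rels n) dualC"
proof
  have "dual_gens n \<subseteq> {1..n} \<times> {1..n}" by (auto simp: dual_gens_def)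
  then show "finite (dual_gens n)" by (rule finite_subset) simp
  have "(1, 2) \<in> dual_gens n" using assms by (simp add: dual_gens_iff)
  then show "dual_gens n \<noteq> {}" by blast
  show "l \<in> lists (dual_gens n) \<and> r \<in> lists (dual_gens n) \<and> length l = length r" if "(l, r) \<in> dual_rels n" for l r
    using that by (cases rule: dual_relsE) (simp_all add: dual_gens_iff)
  show "dualC s t \<in> lists (dual_gens n)" if "s \<in> dual_gens n" "t \<in> dual_gens n" for s t
    using that by (cases s; cases t) (auto simp: dualC_def dual_gens_iff)
  show "dualC s s = []" for s by (cases s) (simp add: dualC_def)
  show "(s # dualC s t, t # dualC t s) \<in> wcong (dual_rels n)" if "s \<in> dual_gens n" "t \<in> dual_gens n" for s t
    using dualC_equiv that .
  show "\<exists>s\<in>dual_gens n. \<exists>t\<in>dual_gens n. l = s # dualC s t \<and> r = t # dualC t s" if lr: "(l, r) \<in> dual_rels n" for l r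
  proof -
    have "l = [hd l, hd (tl l)]" "r = [hd r, hd (tl r)]" "hd l \<in> dual_gens n" "hd r \<in> dual_gens n"
      "dualC (hd l) (hd r) = [hd (tl l)]" "dualC (hd r) (hd l) = [hd (tl r)]"
      using lr by (cases rule: dual_relsE; simp add: dual_gens_iff dualC_def)+
    then show ?thesis by metis
  qed
  show "\<exists>k. cube dualC k r s t" if "r \<in> dual_gens n" "s \<in> dual_gens n" "t \<in> dual_gens n" for r s t
    using that by (intro exI[of _ 4] dual_cube) (auto simp: dual_gens_def)
qed

text \<open>A word for the dual Garside element of the points from \<open>p\<close> to
  \<open>n\<close>.\<close>

definition chain :: "nat \<Rightarrow> nat \<Rightarrow> (nat \<times> nat) list" where
  "chain n p = map (\<lambda>i. (i, Suc i)) [p..<n]"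

lemma chain_lists: "1 \<le> p \<Longrightarrow> chain n p \<in> lists (dual_gens n)"
  by (auto simp: chain_def dual_gens_iff)

text \<open>A chord from \<open>p\<close> or \<open>p + 1\<close> to some \<open>j\<close> beyond is
  brought to the front by a triangle relation on \<open>p\<close>, \<open>p + 1\<close>,
  \<open>j\<close>; a chord further right commutes with the first letter of the chain.\<close>

lemma chain_multiple:
  assumes "1 \<le> p" "p \<le> n" "p \<le> i" "i < j" "j \<le> n"
  shows "\<exists>v\<in>lists (dual_gens n). ((i, j) # v, chain n p) \<in> wcong (dual_rels n)"
  using assms
proof (induction "n - p" arbitrary: p i j)
  case (Suc d)
  let ?R = "dual_rels n" let ?c = "(p, Suc p)"
  have p: "p < n" using Suc by simp
  have ch: "chain n p = ?c # chain n (Suc p)" using p by (simp add: chain_def upt_rec)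
  have cG: "?c \<in> dual_gens n" using p Suc.prems by (simp add: dual_gens_iff)
  have IH: "\<exists>v\<in>lists (dual_gens n). ((a, b) # v, chain n (Suc p)) \<in> wcong ?R"
    if "Suc p \<le> a" "a < b" "b \<le> n" for a b
    using Suc.hyps(1)[of "Suc p" a b] Suc.hyps(2) that p by auto
  consider "i = p" "j = Suc p" | "i = p" "Suc p < j" | "i = Suc p" | "Suc p < i" using Suc.prems by linarith
  then show ?case
  proof cases
    case 1
    then show ?thesis using ch chain_lists[of "Suc p" n] by auto
  next
    case 2
    then obtain v where v: "v \<in> lists (dual_gens n)" "((Suc p, j) # v, chain n (Suc p)) \<in> wcong ?R"
      using IH[of "Suc p" j] Suc.prems by auto
    have "([(p, j), ?c] @ v, [?c, (Suc p, j)] @ v) \<in> wcong ?R"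
      using 2 Suc.prems by (intro wcong_appendR wcong_sym[OF dual_triangle(3)]) auto
    then have "((i, j) # ?c # v, ?c # (Suc p, j) # v) \<in> wcong ?R" using 2 by simp
    moreover have "(?c # (Suc p, j) # v, chain n p) \<in> wcong ?R" unfolding ch using v(2) by (rule wcong_Cons)
    ultimately show ?thesis using v cG wcong_trans by (intro bexI[of _ "?c # v"]) auto
  next
    case 3
    then obtain v where v: "v \<in> lists (dual_gens n)" "((Suc p, j) # v, chain n (Suc p)) \<in> wcong ?R"
      using IH[of "Suc p" j] Suc.prems by auto
    have "([(Suc p, j), (p, j)] @ v, [?c, (Suc p, j)] @ v) \<in> wcong ?R"
      using 3 Suc.prems by (intro wcong_appendR wcong_sym[OF dual_triangle(1)]) auto
    then have "((i, j) # (p, j) # v, ?c # (Suc p, j) # v) \<in> wcong ?R" using 3 by simp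
    moreover have "(?c # (Suc p, j) # v, chain n p) \<in> wcong ?R" unfolding ch using v(2) by (rule wcong_Cons)
    moreover have "(p, j) \<in> dual_gens n" using Suc.prems 3 by (simp add: dual_gens_iff)
    ultimately show ?thesis using v wcong_trans by (intro bexI[of _ "(p, j) # v"]) auto
  next
    case 4
    then obtain v where v: "v \<in> lists (dual_gens n)" "((i, j) # v, chain n (Suc p)) \<in> wcong ?R"
      using IH[of i j] Suc.prems by auto
    have "([(i, j), ?c] @ v, [?c, (i, j)] @ v) \<in> wcong ?R"
      using 4 Suc.prems by (intro wcong_appendR dual_commute) auto
    then have "((i, j) # ?c # v, ?c # (i, j) # v) \<in> wcong ?R" by simp
    moreover have "(?c # (i, j) # v, chain n p) \<in> wcong ?R" unfolding ch using v(2) by (rule wcong_Cons)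
    ultimately show ?thesis using v cG wcong_trans by (intro bexI[of _ "?c # v"]) auto
  qed
qed simp

locale dual =
  fixes n :: nat
  assumes n: "n \<ge> 2"
begin

abbreviation dual_mul (infixl "\<odot>" 70) where "x \<odot> y \<equiv> mmult (dual_rels n) x y"
abbreviation dual_unit ("\<one>") where "\<one> \<equiv> munit (dual_rels n)"
abbreviation dual_le (infix "\<preceq>" 50) where "x \<preceq> y \<equiv> ldiv (dual_gens n) (dual_rels n) x y"
abbreviation dual_arr (infix "\<leadsto>" 50) where "x \<leadsto> y \<equiv> arrow (dual_gens n) (dual_rels n) x y"

lemma dual_garside: "garside (dual_gens n) (dual_rels n) dualC"
proof -
  interpret complemented "dual_gens n" "dual_rels n" dualC using dual_complemented[OF n] .
  show ?thesis
  proof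
    have "gen (dual_rels n) s \<preceq> cls (dual_rels n) (chain n 1)" if "s \<in> dual_gens n" for s
    proof -
      obtain i j where s: "s = (i, j)" by (cases s)
      show ?thesis unfolding gen_def using chain_multiple[of 1 n i j] that n
        by (subst cls_le_iff) (auto simp: s dual_gens_iff)
    qed
    moreover have "cls (dual_rels n) (chain n 1) \<in> M" using chain_lists[of 1 n] by (intro cls_in_M) simp
    ultimately show "\<exists>D\<in>M. \<forall>s\<in>dual_gens n. gen (dual_rels n) s \<preceq> D" by blast
    show "\<exists>a\<in>dual_gens n. \<exists>b\<in>dual_gens n. \<exists>v\<in>lists (dual_gens n). dualC s t @ v = a # dualC a b"
      if st: "s \<in> dual_gens n" "t \<in> dual_gens n" for s t
    proof -
      \<comment> \<open>A complement of two letters comes from crossing chords and consists of two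
        disjoint ones, so it is the lcm of its own letters.\<close>
      have "dualC s t = [] \<or> (\<exists>a. dualC s t = [a]) \<or> (\<exists>a b. dualC s t = [a, b] \<and> dualC a b = [b])"
        by (cases s; cases t) (auto simp: dualC_def)
      moreover have l: "dualC s t \<in> lists (dual_gens n)" using C_lists st by blast
      moreover have e: "dualC a a = []" for a by (cases a) (simp add: dualC_def)
      ultimately consider "dualC s t = []" | a where "dualC s t = [a]" "a \<in> dual_gens n"
        | a b where "dualC s t = [a, b]" "dualC a b = [b]" "a \<in> dual_gens n" "b \<in> dual_gens n" by auto
      then show ?thesis
      proof cases
        case 1
        then show ?thesis using e st by (intro bexI[of _ s] bexI[of _ s] bexI[of _ "[s]"]) auto
      next
        case (2 a)
        then show ?thesis using e by (intro bexI[of _ a] bexI[of _ a] bexI[of _ "[]"]) auto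
      next
        case (3 a b)
        then show ?thesis by (intro bexI[of _ a] bexI[of _ b] bexI[of _ "[]"]) auto
      qed
    qed
  qed
qed

text \<open>Removing \<open>a\<^sub>i\<^sub>j\<close> from the Garside element splits the polygon into the two arcs
  \<open>{i..<j}\<close> and its complement; the remaining factor only involves chords within the arcs.\<close>

definition arcs where
  "arcs i j = {(k, l) \<in> dual_gens n. (i \<le> k \<and> k < j) \<longleftrightarrow> (i \<le> l \<and> l < j)}"

lemma dual_not_simple:
  assumes "(i, j) \<in> dual_gens n" "t \<in> dual_gens n" "t \<notin> arcs i j"
  shows "gen (dual_rels n) (i, j) \<odot> gen (dual_rels n) t \<notin> Simples (dual_gens n) (dual_rels n)"
proof -
  interpret garside "dual_gens n" "dual_rels n" dualC by (rule dual_garside)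
  show ?thesis
  proof (rule not_simple_of_parabolic[where X = "arcs i j"])
    show "lcm_closed (arcs i j)"
      unfolding lcm_closed_def
    proof (intro conjI ballI)
      fix s t assume "s \<in> arcs i j" "t \<in> arcs i j"
      then show "dualC s t \<in> lists (arcs i j)"
        by (cases s; cases t) (auto simp: arcs_def dualC_def dual_gens_iff)
    qed (auto simp: arcs_def)
    show "set l \<subseteq> arcs i j \<longleftrightarrow> set r \<subseteq> arcs i j" if "(l, r) \<in> dual_rels n" for l r
      using that by (cases rule: dual_relsE) (auto simp: arcs_def dual_gens_iff)
    show "dualC (i, j) t \<in> lists (arcs i j)" if "t \<in> dual_gens n" for t
      using that assms(1) by (cases t) (auto simp: arcs_def dualC_def dual_gens_iff)
  qed (use assms in auto)
qed

lemma dual_dominant: "garside.dominant (dual_gens n) (dual_rels n) (1, 2)"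
proof -
  interpret garside "dual_gens n" "dual_rels n" dualC by (rule dual_garside)
  let ?G = "dual_gens n" let ?R = "dual_rels n"
  have sq: "gen ?R s \<odot> gen ?R s \<notin> S" if "s \<in> ?G" for s
    using that dual_not_simple[of "fst s" "snd s" s] by (cases s) (auto simp: arcs_def dual_gens_iff)
  \<comment> \<open>A chord joining the two arcs cut out by \<open>(i, j)\<close> may follow it;
    this supplies all arrows needed below.\<close>
  have arr: "(gen ?R (i, j), gen ?R t) \<in> arrows" if "(i, j) \<in> ?G" "t \<in> ?G" "t \<notin> arcs i j" for i j t
    using that dual_not_simple[OF that] gen_neq_unit by (auto intro: gen_arrow_gen)
  have path2: "(gen ?R (2, a), gen ?R (1, 2)) \<in> arrows\<^sup>*" if "(2, a) \<in> ?G" for a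
    using that n by (intro r_into_rtrancl arr) (auto simp: arcs_def dual_gens_iff)
  have path: "(gen ?R s, gen ?R (1, 2)) \<in> arrows\<^sup>*" if s: "s \<in> ?G" for s
  proof -
    obtain i j where ij: "s = (i, j)" "(i, j) \<in> ?G" using s by (cases s) auto
    consider "i = 1" "j = 2" | "i = 1" "2 < j" | "i = 2" | "2 < i" using ij(2) by (auto simp: dual_gens_iff) linarith
    then show ?thesis
    proof cases
      case 1
      then show ?thesis using ij by simp
    next
      case 2
      then have g: "(2, j) \<in> ?G" "(2, j) \<notin> arcs i j" using ij(2) by (auto simp: arcs_def dual_gens_iff)
      show ?thesis unfolding ij(1) using arr[OF ij(2) g] path2[OF g(1)] by (rule converse_rtrancl_into_rtrancl)
    next
      case 3
      then show ?thesis using path2 ij by simp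
    next
      case 4
      then have g: "(2, i) \<in> ?G" "(2, i) \<notin> arcs i j" using ij(2) by (auto simp: arcs_def dual_gens_iff)
      show ?thesis unfolding ij(1) using arr[OF ij(2) g] path2[OF g(1)] by (rule converse_rtrancl_into_rtrancl)
    qed
  qed
  \<comment> \<open>Any two sides of the triangle 1, 2, 3 have the same lcm, of length 2.\<close>
  have q1: "q < 1" if n3: "3 \<le> n"
  proof (rule q_less_1[of "{(1, 2), (2, 3), (1, 3)}" 3 "cls ?R [(1, 2), (2, 3)]" 2])
    have tri: "([(2, 3), (1, 3)], [(1, 2), (2, 3)]) \<in> wcong ?R" "([(1, 3), (1, 2)], [(1, 2), (2, 3)]) \<in> wcong ?R"
      using dual_triangle(1,3)[of 1 2 3 n, THEN wcong_sym] n3 by auto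
    show "cls ?R (s # dualC s t) = cls ?R [(1, 2), (2, 3)]"
      if "s \<in> {(1, 2), (2, 3), (1, 3)}" "t \<in> {(1, 2), (2, 3), (1, 3)}" "s \<noteq> t" for s t
      using that tri by (auto simp: dualC_def cls_eq_iff)
    show "cls ?R [(1, 2), (2, 3)] \<in> M" using n3 by (intro cls_in_M) (auto simp: dual_gens_iff)
  qed (use n3 in \<open>auto simp: dual_gens_iff mlen_cls field_simps power2_eq_square\<close>)
  define ch where "ch p = {(i, j) \<in> ?G. p \<le> i}" for p
  \<comment> \<open>Descent in \<open>p\<close> as for the classical monoid: the chord
    \<open>?c\<close> is disjoint from all chords beyond \<open>p\<close>, hence commutes with them,
    and the multiplier is the single chord \<open>?s\<close>.\<close>
  have summ: "summable (\<lambda>k. real (cnt (submonoid (ch p)) k) * q ^ k)" if "2 \<le> p" "p \<le> n" for p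
    using that
  proof (induction "n - p" arbitrary: p)
    case 0
    then have "ch p = {}" by (auto simp: ch_def dual_gens_iff)
    then show ?case using summable_submonoid_empty by simp
  next
    case (Suc d)
    have p: "p < n" "1 \<le> p - 1" "p - 1 < p" using Suc by auto
    let ?c = "(p - 1, p)" let ?s = "(p - 1, p + 1)" let ?Y = "insert ?c (ch (p + 1))"
    have cG: "?c \<in> ?G" "?s \<in> ?G" using p Suc.prems by (auto simp: dual_gens_iff)
    have chG: "ch p \<subseteq> ?G" for p by (auto simp: ch_def)
    have X: "summable (\<lambda>k. real (cnt (submonoid (ch (p + 1))) k) * q ^ k)"
      using Suc.hyps(1)[of "p + 1"] Suc.hyps(2) Suc.prems p by auto
    show ?case
    proof (rule summable_submonoid_step[where Y = ?Y and w = "gen ?R ?s"])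
      show "lcm_closed (ch p)"
        unfolding lcm_closed_def
      proof (intro conjI ballI chG)
        fix s t assume "s \<in> ch p" "t \<in> ch p"
        then show "dualC s t \<in> lists (ch p)" by (cases s; cases t) (auto simp: ch_def dualC_def dual_gens_iff)
      qed
      show "summable (\<lambda>k. real (cnt (submonoid ?Y) k) * q ^ k)"
      proof (rule summable_submonoid_insert[OF q1 chG cG(1) _ X])
        show "3 \<le> n" using p by simp
        show "gen ?R s \<odot> gen ?R ?c = gen ?R ?c \<odot> gen ?R s" if s: "s \<in> ch (p + 1)" for s
        proof -
          obtain k l where kl: "s = (k, l)" "p + 1 \<le> k" "k < l" "l \<le> n" using s by (auto simp: ch_def dual_gens_iff)
          have "([(k, l), ?c], [?c, (k, l)]) \<in> wcong ?R" using kl p by (intro dual_commute) auto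
          then show ?thesis using kl by (simp add: gen_def mmult_cls cls_eq_iff)
        qed
      qed
      show "gen ?R ?s \<odot> x \<in> free (ch p)" if x: "x \<in> free ?Y" for x
      proof -
        have xM: "x \<in> M" using x by (simp add: free_def)
        have nx: "\<not> gen ?R a \<preceq> x" if "a \<in> ?Y" for a using x that unfolding free_def by blast
        have no: False if s: "s \<in> ch p" "gen ?R s \<preceq> gen ?R ?s \<odot> x" for s
        proof -
          obtain k l where kl: "s = (k, l)" "p \<le> k" "k < l" "l \<le> n" using s(1) by (auto simp: ch_def dual_gens_iff)
          have sG: "s \<in> ?G" using s chG by auto
          have 1: "cls ?R (dualC ?s s) \<preceq> x" using gen_le_gen_mul[OF sG cG(2) xM s(2)] .
          \<comment> \<open>If \<open>s\<close> starts at \<open>p\<close>, it shares the endpoint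
            \<open>p + 1\<close> with \<open>?s\<close> or crosses it, and the complement begins
            with \<open>?c\<close>; if it starts later, the complement is \<open>s\<close>
            itself.\<close>
          have "\<exists>a v. dualC ?s s = a # v \<and> a \<in> ?Y"
            using kl p by (auto simp: dualC_def ch_def dual_gens_iff)
          then obtain a v where a: "dualC ?s s = a # v" "a \<in> ?Y" by blast
          moreover have "a # v \<in> lists ?G" using C_lists[OF cG(2) sG] a by simp
          ultimately have "gen ?R a \<preceq> x" using 1 cls_Cons_le[of a v x] by simp
          then show False using nx a by blast
        qed
        have "gen ?R ?s \<odot> x \<in> M" using cG xM by simp
        then show ?thesis unfolding free_def using no by blast
      qed
    qed (use chG cG in auto)
  qed
  show ?thesis
  proof (rule dominantI[OF sq _ path])
    show "(1, 2) \<in> ?G" using n by (simp add: dual_gens_iff)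
    show "?G - Rset ?G ?R (gen ?R (1, 2)) \<subseteq> ch 2"
    proof
      fix t assume t: "t \<in> ?G - Rset ?G ?R (gen ?R (1, 2))"
      \<comment> \<open>One of the two arcs is the single point 1, so these are the chords that
        avoid it.\<close>
      have "t \<in> arcs 1 2"
        using dual_not_simple[of 1 2 t] t n by (auto simp: Rset_def dual_gens_iff)
      then show "t \<in> ch 2" by (auto simp: arcs_def ch_def dual_gens_iff)
    qed
    show "ch 2 \<subseteq> ?G" by (auto simp: ch_def)
    show "summable (\<lambda>k. real (cnt (submonoid (ch 2)) k) * q ^ k)" using summ[of 2] n by simp
  qed
qed

end

theorem theorem5p1:
  fixes n :: nat
  assumes "n \<ge> 2"
  shows "((\<exists>\<nu>. is_unif_inf (artin_gens n) (artin_rels n) \<nu>) \<and>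
          (\<forall>\<nu>. is_unif_inf (artin_gens n) (artin_rels n) \<nu> \<longrightarrow>
             weak_conv_top (Mbar_top (artin_gens n) (artin_rels n))
               (mu (artin_gens n) (artin_rels n)) \<nu>))
       \<and> ((\<exists>\<nu>. is_unif_inf (dual_gens n) (dual_rels n) \<nu>) \<and>
          (\<forall>\<nu>. is_unif_inf (dual_gens n) (dual_rels n) \<nu> \<longrightarrow>
             weak_conv_top (Mbar_top (dual_gens n) (dual_rels n))
               (mu (dual_gens n) (dual_rels n)) \<nu>))"
proof (rule conjI)
  interpret artin n using assms by unfold_locales
  show "(\<exists>\<nu>. is_unif_inf (artin_gens n) (artin_rels n) \<nu>) \<and>
    (\<forall>\<nu>. is_unif_inf (artin_gens n) (artin_rels n) \<nu> \<longrightarrow>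
       weak_conv_top (Mbar_top (artin_gens n) (artin_rels n)) (mu (artin_gens n) (artin_rels n)) \<nu>)"
    using garside.weak_convergence_to_uniform[OF artin_garside artin_dominant] .
next
  interpret dual n using assms by unfold_locales
  show "(\<exists>\<nu>. is_unif_inf (dual_gens n) (dual_rels n) \<nu>) \<and>
    (\<forall>\<nu>. is_unif_inf (dual_gens n) (dual_rels n) \<nu> \<longrightarrow>
       weak_conv_top (Mbar_top (dual_gens n) (dual_rels n)) (mu (dual_gens n) (dual_rels n)) \<nu>)"
    using garside.weak_convergence_to_uniform[OF dual_garside dual_dominant] .
qed

end
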